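(* Let $f\in S_k^{\mathrm{new}}(\Gamma_0(N),\chi)$ be a normalized primitive holomorphic newform with real Fourier coefficients, with completed $L$-function satisfying $\Lambda(f,s)=\varepsilon_f\Lambda(f,k-s)$, $\varepsilon_f\in\{\pm1\}$. Let $m\ge 0$, $\delta\ge 1$, $n\ge 1$ be integers such that $$\delta(2n+3)\le k-2\qquad\text{and}\qquad k-\delta(2n+3)\equiv 0\pmod 2.$$ Then $\mathscr Q_{f,\delta,n}^{(m)}$ and $\mathscr Q_{f,\delta,n+1}^{(m)}$ have degrees $n$ and $n+1$, respectively, have simple zeros, all lying in $(-2,2)$, and strictly interlace.
   Context: For $f(\tau)=\sum_{r\ge1}a_f(r)e^{2\pi i r\tau}$ of weight $k$ and level $N$, put $$L(f,s)=\sum_{r\ge1}\frac{a_f(r)}{r^s},\qquad \Lambda(f,s)=\left(\frac{\sqrt N}{2\pi}\right)^s\Gamma(s)L(f,s),$$ continued to an entire function; since $f$ has real coefficients, $\Lambda(f,s)=\varepsilon_f\Lambda(f,k-s)$ with root number $\varepsilon_f\in\{\pm1\}$. $\Lambda^{(m)}(f,s)$ denotes the $m$-th derivative in $s$. For integers $m\ge0$, $\delta\ge1$, $n\ge1$ define $$\mathcal P_{f,\delta,n}^{(m)}(z)=\sum_{j=0}^{2n+1}\binom{2n+1}{j}\Lambda^{(m)}\!\left(f,\frac k2+\delta\left(j-n-\frac12\right)\right)z^j.$$ The functional equation gives a unique real polynomial $\mathscr Q_{f,\delta,n}^{(m)}$ with $$\mathcal P_{f,\delta,n}^{(m)}(z)=z^n\bigl(z+\varepsilon_f(-1)^m\bigr)\mathscr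 Q_{f,\delta,n}^{(m)}(z+z^{-1}).$$ Two finite sets of distinct real points strictly interlace if they are disjoint and, when their union is listed in increasing order, the entries come alternately from the two sets; two polynomials strictly interlace if their (simple, real) zero sets do. *)

theory Defs
  imports
    "HOL-Complex_Analysis.Complex_Analysis"
    "HOL-Computational_Algebra.Polynomial"
    "HOL-Library.Function_Algebras"
    "HOL-Number_Theory.Cong"
begin

section \<open>Cusp forms with character\<close>

text \<open>Modular forms are represented by functions on the whole complex plane of which only the
  values on the upper half plane matter.\<close>

definition upper_half_plane :: "complex set" where
  "upper_half_plane = {z. Im z > 0}"

definition dirichlet_char :: "nat \<Rightarrow> (int \<Rightarrow> complex) \<Rightarrow> bool" where
  "dirichlet_char N chi \<longleftrightarrow>
     (\<forall>a. chi (a + int N) = chi a) \<and>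
     (\<forall>a b. chi (a * b) = chi a * chi b) \<and>
     (\<forall>a. chi a \<noteq> 0 \<longleftrightarrow> coprime a (int N))"

definition SL2Z :: "(int ^ 2 ^ 2) set" where
  "SL2Z = {A. det A = 1}"

definition Gamma0 :: "nat \<Rightarrow> (int ^ 2 ^ 2) set" where
  "Gamma0 N = {A \<in> SL2Z. int N dvd A $ 2 $ 1}"

definition moebius_act :: "int ^ 2 ^ 2 \<Rightarrow> complex \<Rightarrow> complex" where
  "moebius_act A z =
     (of_int (A $ 1 $ 1) * z + of_int (A $ 1 $ 2)) / (of_int (A $ 2 $ 1) * z + of_int (A $ 2 $ 2))"

definition slash :: "nat \<Rightarrow> int ^ 2 ^ 2 \<Rightarrow> (complex \<Rightarrow> complex) \<Rightarrow> complex \<Rightarrow> complex" where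
  "slash k A f z =
     (of_int (A $ 2 $ 1) * z + of_int (A $ 2 $ 2)) powi (- int k) * f (moebius_act A z)"

text \<open>The last condition is vanishing at every cusp: each translate under the full modular group
  tends to 0 as \<open>Im z\<close> tends to infinity, uniformly in \<open>Re z\<close>.\<close>

definition cusp_forms :: "nat \<Rightarrow> nat \<Rightarrow> (int \<Rightarrow> complex) \<Rightarrow> (complex \<Rightarrow> complex) set" where
  "cusp_forms k N chi = {f.
     f holomorphic_on upper_half_plane \<and>
     (\<forall>A \<in> Gamma0 N. \<forall>z \<in> upper_half_plane. slash k A f z = chi (A $ 2 $ 2) * f z) \<and>
     (\<forall>A \<in> SL2Z. (slash k A f \<longlongrightarrow> 0) (filtercomap Im at_top))}"


section \<open>Oldforms, the Petersson product and newforms\<close>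

text \<open>The lifts \<open>g(d z)\<close> of cusp forms \<open>g\<close> of proper divisor level \<open>M\<close>, where \<open>d\<close> divides
  \<open>N / M\<close> and the nebentypus of \<open>g\<close> induces \<open>chi\<close>.\<close>

definition old_generators :: "nat \<Rightarrow> nat \<Rightarrow> (int \<Rightarrow> complex) \<Rightarrow> (complex \<Rightarrow> complex) set" where
  "old_generators k N chi = {h. \<exists>M d \<psi> g.
     M dvd N \<and> M < N \<and> d dvd N div M \<and>
     dirichlet_char M \<psi> \<and> (\<forall>a. coprime a (int N) \<longrightarrow> \<psi> a = chi a) \<and>
     g \<in> cusp_forms k M \<psi> \<and> h = (\<lambda>z. g (of_nat d * z))}"

definition fun_scale :: "complex \<Rightarrow> (complex \<Rightarrow> complex) \<Rightarrow> complex \<Rightarrow> complex" where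
  "fun_scale c f = (\<lambda>z. c * f z)"

global_interpretation complex_fun: vector_space fun_scale
  by unfold_locales (auto simp: fun_scale_def fun_eq_iff algebra_simps)

definition old_forms :: "nat \<Rightarrow> nat \<Rightarrow> (int \<Rightarrow> complex) \<Rightarrow> (complex \<Rightarrow> complex) set" where
  "old_forms k N chi = complex_fun.span (old_generators k N chi)"

definition fundamental_domain :: "complex set" where
  "fundamental_domain = {z. Im z > 0 \<and> norm z \<ge> 1 \<and> \<bar>Re z\<bar> \<le> 1 / 2}"

definition Gamma0_coset_rel :: "nat \<Rightarrow> ((int ^ 2 ^ 2) \<times> (int ^ 2 ^ 2)) set" where
  "Gamma0_coset_rel N = {(A, B). A \<in> SL2Z \<and> B \<in> SL2Z \<and> (\<exists>G \<in> Gamma0 N. B = G ** A)}"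

text \<open>The Petersson product \<open>\<integral> f \<cdot> cnj g \<cdot> y\<^sup>k dx dy / y\<^sup>2\<close> over the quotient of the upper half plane
  by \<open>Gamma0 N\<close>, without the volume factor.  A fundamental domain for \<open>Gamma0 N\<close> is tiled by
  the translates \<open>A F\<close> of the one for the full modular group, \<open>A\<close> running over representatives
  of the cosets of \<open>Gamma0 N\<close>; the value is independent of the representatives because the
  characters are unitary.\<close>

definition petersson :: "nat \<Rightarrow> nat \<Rightarrow> (complex \<Rightarrow> complex) \<Rightarrow> (complex \<Rightarrow> complex) \<Rightarrow> complex" where
  "petersson k N f g =
     (\<Sum>C \<in> SL2Z // Gamma0_coset_rel N. let A = (SOME A. A \<in> C) in
        set_lebesgue_integral lborel fundamental_domain
          (\<lambda>z. slash k A f z * cnj (slash k A g z) * of_real (Im z powi (int k - 2))))"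

definition new_subspace :: "nat \<Rightarrow> nat \<Rightarrow> (int \<Rightarrow> complex) \<Rightarrow> (complex \<Rightarrow> complex) set" where
  "new_subspace k N chi = {f \<in> cusp_forms k N chi. \<forall>g \<in> old_forms k N chi. petersson k N f g = 0}"

text \<open>\<open>T\<^sub>n\<close> for level \<open>N\<close>; since \<open>chi a = 0\<close> unless \<open>a\<close> is coprime to \<open>N\<close>, this is the operator
  \<open>U\<^sub>p\<close> at primes \<open>p\<close> dividing \<open>N\<close>.\<close>

definition hecke :: "nat \<Rightarrow> (int \<Rightarrow> complex) \<Rightarrow> nat \<Rightarrow> (complex \<Rightarrow> complex) \<Rightarrow> complex \<Rightarrow> complex" where
  "hecke k chi n f z =
     1 / of_nat n * (\<Sum>a | a dvd n. chi (int a) * of_nat a ^ k *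
       (\<Sum>b<n div a. f ((of_nat a * z + of_nat b) / of_nat (n div a))))"

definition fourier_expansion :: "(complex \<Rightarrow> complex) \<Rightarrow> (nat \<Rightarrow> complex) \<Rightarrow> bool" where
  "fourier_expansion f a \<longleftrightarrow>
     (\<forall>z \<in> upper_half_plane. (\<lambda>r. a r * exp (2 * of_real pi * \<i> * of_nat r * z)) sums f z)"

definition fourier_coeff :: "(complex \<Rightarrow> complex) \<Rightarrow> nat \<Rightarrow> complex" where
  "fourier_coeff f = (THE a. fourier_expansion f a)"

definition primitive_newform :: "nat \<Rightarrow> nat \<Rightarrow> (int \<Rightarrow> complex) \<Rightarrow> (complex \<Rightarrow> complex) \<Rightarrow> bool" where
  "primitive_newform k N chi f \<longleftrightarrow>
     f \<in> new_subspace k N chi \<and>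
     (\<forall>n\<ge>1. \<exists>c. \<forall>z \<in> upper_half_plane. hecke k chi n f z = c * f z) \<and>
     fourier_coeff f 1 = 1"


section \<open>The completed L-function\<close>

definition L_series :: "(complex \<Rightarrow> complex) \<Rightarrow> complex \<Rightarrow> complex" where
  "L_series f s = (\<Sum>r. fourier_coeff f (Suc r) / of_nat (Suc r) powr s)"

text \<open>The entire function that agrees with the defining expression on some right half plane.\<close>

definition completed_L :: "nat \<Rightarrow> (complex \<Rightarrow> complex) \<Rightarrow> complex \<Rightarrow> complex" where
  "completed_L N f = (THE \<Lambda>. \<Lambda> holomorphic_on UNIV \<and>
     (\<exists>\<sigma>. \<forall>s. Re s > \<sigma> \<longrightarrow>
        \<Lambda> s = of_real (sqrt (real N) / (2 * pi)) powr s * Gamma s * L_series f s))"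


section \<open>The polynomials\<close>

definition P_poly ::
    "nat \<Rightarrow> nat \<Rightarrow> (complex \<Rightarrow> complex) \<Rightarrow> nat \<Rightarrow> nat \<Rightarrow> nat \<Rightarrow> complex poly" where
  "P_poly k N f m \<delta> n =
     (\<Sum>j\<le>2*n+1. monom (of_nat ((2*n+1) choose j) *
        (deriv ^^ m) (completed_L N f)
          (of_real (real k / 2 + real \<delta> * (real j - real n - 1 / 2)))) j)"

definition Q_poly ::
    "nat \<Rightarrow> nat \<Rightarrow> (complex \<Rightarrow> complex) \<Rightarrow> real \<Rightarrow> nat \<Rightarrow> nat \<Rightarrow> nat \<Rightarrow> real poly" where
  "Q_poly k N f \<epsilon> m \<delta> n = (THE Q. \<forall>z. z \<noteq> 0 \<longrightarrow>
     poly (P_poly k N f m \<delta> n) z =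
       z ^ n * (z + of_real \<epsilon> * (-1) ^ m) * poly (map_poly complex_of_real Q) (z + inverse z))"


section \<open>Zeros and interlacing\<close>

definition simple_zeros_in :: "real set \<Rightarrow> real poly \<Rightarrow> bool" where
  "simple_zeros_in S p \<longleftrightarrow>
     (\<forall>w. poly (map_poly complex_of_real p) w = 0 \<longrightarrow>
        w \<in> complex_of_real ` S \<and> order w (map_poly complex_of_real p) = 1)"

definition strictly_interlace_sets :: "real set \<Rightarrow> real set \<Rightarrow> bool" where
  "strictly_interlace_sets A B \<longleftrightarrow>
     finite A \<and> finite B \<and> A \<inter> B = {} \<and>
     (let xs = sorted_list_of_set (A \<union> B) in
        \<forall>i. Suc i < length xs \<longrightarrow> (xs ! i \<in> A \<longleftrightarrow> xs ! Suc i \<in> B))"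

definition strictly_interlace :: "real poly \<Rightarrow> real poly \<Rightarrow> bool" where
  "strictly_interlace p q \<longleftrightarrow>
     simple_zeros_in UNIV p \<and> simple_zeros_in UNIV q \<and>
     strictly_interlace_sets {x. poly p x = 0} {x. poly q x = 0}"

end

theory Submission
  imports
    Defs
    "HOL-Computational_Algebra.Computational_Algebra"
    "HOL-Real_Asymp.Real_Asymp"
begin

text \<open>Since \<open>L(f, s)\<close> does not vanish for \<open>Re s > (k + 1) / 2\<close>, the functional equation confines the
  zeros of \<open>\<Lambda>\<close> to the strip of width 1 around \<open>Re s = k / 2\<close>.  Rotated by a quarter turn and scaled
  by \<open>1 / \<delta>\<close>, \<open>\<Lambda>\<close> becomes a real even or odd entire function \<open>G\<close> of order less than two with zeros
  in \<open>\<bar>Im z\<bar> \<le> 1 / 2\<close>, hence a limit of polynomials with such zeros, and differentiation preserves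
  this class.  Up to an explicit factor, any combination \<open>a Q\<^sub>n\<^sub>+\<^sub>1 + b Q\<^sub>n\<close> at \<open>2 cos x\<close> is an antiperiodic
  trigonometric polynomial whose coefficient at the frequency \<open>\<omega>\<close> is multiplied by \<open>G(\<i> \<omega>)\<close>, that is,
  \<open>G(d/dx)\<close> is applied to an elementary one.  A polynomial \<open>p\<close> with zeros in the strip loses
  no sign alternations under \<open>p(d/dx)\<close>: a quadratic factor \<open>(D - c)\<^sup>2 + b\<^sup>2\<close> is two applications of Rolle's
  theorem with the weights \<open>exp(-c x)\<close> and \<open>cos(b x)\<close>, where \<open>\<bar>b\<bar> \<le> 1 / 2\<close> keeps the cosine positive
  inside an interval of length \<open>2 \<pi>\<close>.  A quantitative version shows that every nonzero combination \<open>a Q\<^sub>n\<^sub>+\<^sub>1 + b Q\<^sub>n\<close>, even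
  after a small perturbation, has at least \<open>n\<close> zeros in \<open>(-2, 2)\<close>.  A zero of the Wronskian of
  \<open>Q\<^sub>n\<close> and \<open>Q\<^sub>n\<^sub>+\<^sub>1\<close> would be a double zero of some combination, which a perturbation would remove;
  so the Wronskian has no zero and the polynomials interlace.\<close>

section \<open>Sign alternations\<close>

text \<open>The constants fit together exactly. The completed L-function is sampled at k/2 +
  \<delta> \<omega> with half-odd integers \<omega>. Scaling by 1/\<delta> turns these into the
  frequencies of functions that change sign under x -> x + 2 pi, and moves the zeros into |Im z|
  \<le> 1/(2 \<delta>) \<le> 1/2, the largest half width for which cos(b x) stays positive inside a
  window of length 2 pi. The obstacle is that the elementary function need not alternate enough:
  zeros of total order 2 n + 1 sit at the single point pi. Each zero of an operator factor turns one
  order of vanishing into one alternation, so 2 n + 1 of them are needed; they exist because an even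
  or odd function of this growth that is no polynomial has infinitely many zeros. In a mere limit of
  polynomials the alternations could degenerate again. Hence finitely many zeros are split off
  exactly, the alternations they produce are strict and survive small changes, and only the
  remaining factor \<open>G0\<close>, which is nonzero at all frequencies, is approximated.\<close>

definition alternates :: "(real \<Rightarrow> real) \<Rightarrow> real \<Rightarrow> real \<Rightarrow> nat \<Rightarrow> bool" where
  "alternates f a b k \<longleftrightarrow> (\<exists>p s. (s = 1 \<or> s = -1) \<and>
     (\<forall>i<k. a < p i \<and> p i < b \<and> s * (-1) ^ i * f (p i) > 0) \<and>
     (\<forall>i. Suc i < k \<longrightarrow> p i < p (Suc i)))"

lemma alternatesE:
  assumes "alternates f a b k"
  obtains p s where "s = 1 \<or> s = -1" "\<And>i. i < k \<Longrightarrow> a < p i" "\<And>i. i < k \<Longrightarrow> p i < b"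
    "\<And>i. i < k \<Longrightarrow> s * (-1) ^ i * f (p i) > 0" "\<And>i. Suc i < k \<Longrightarrow> p i < p (Suc i)"
  using assms unfolding alternates_def by auto

lemma alternatesI:
  assumes "s = 1 \<or> s = -1" "\<And>i. i < k \<Longrightarrow> a < p i" "\<And>i. i < k \<Longrightarrow> p i < b"
    "\<And>i. i < k \<Longrightarrow> s * (-1) ^ i * f (p i) > 0" "\<And>i. Suc i < k \<Longrightarrow> p i < p (Suc i)"
  shows "alternates f a b k"
  unfolding alternates_def using assms by (intro exI[of _ p] exI[of _ s]) auto

lemma alternates_mono:
  assumes "alternates f a b k" "k' \<le> k"
  shows "alternates f a b k'"
  using assms(1)
proof (rule alternatesE)
  fix p s assume *: "s = 1 \<or> s = -1" "\<And>i. i < k \<Longrightarrow> a < p i" "\<And>i. i < k \<Longrightarrow> p i < b"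
    "\<And>i. i < k \<Longrightarrow> s * (-1) ^ i * f (p i) > 0" "\<And>i. Suc i < k \<Longrightarrow> p i < p (Suc i)"
  show ?thesis by (rule alternatesI[of s _ _ p]) (use * assms(2) in auto)
qed

lemma alternates_mult_pos:
  assumes "alternates f a b k" "\<And>x. a < x \<Longrightarrow> x < b \<Longrightarrow> g x > 0"
    "\<And>x. a < x \<Longrightarrow> x < b \<Longrightarrow> h x = g x * f x"
  shows "alternates h a b k"
  using assms(1)
proof (rule alternatesE)
  fix p s assume *: "s = 1 \<or> s = -1" "\<And>i. i < k \<Longrightarrow> a < p i" "\<And>i. i < k \<Longrightarrow> p i < b"
    "\<And>i. i < k \<Longrightarrow> s * (-1) ^ i * f (p i) > 0" "\<And>i. Suc i < k \<Longrightarrow> p i < p (Suc i)"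
  have "s * (-1) ^ i * h (p i) > 0" if "i < k" for i
  proof -
    have "s * (-1) ^ i * h (p i) = g (p i) * (s * (-1) ^ i * f (p i))"
      using assms(3)[OF *(2,3)[OF that]] by simp
    also have "\<dots> > 0" using assms(2)[OF *(2,3)[OF that]] *(4)[OF that] by simp
    finally show ?thesis .
  qed
  thus ?thesis using * by (intro alternatesI[of s _ _ p]) auto
qed

lemma alternates_scale:
  assumes "alternates f a b k" "c \<noteq> 0"
  shows "alternates (\<lambda>x. c * f x) a b k"
proof -
  obtain p s where *: "s = 1 \<or> s = -1" "\<And>i. i < k \<Longrightarrow> a < p i" "\<And>i. i < k \<Longrightarrow> p i < b"
    "\<And>i. i < k \<Longrightarrow> s * (-1) ^ i * f (p i) > 0" "\<And>i. Suc i < k \<Longrightarrow> p i < p (Suc i)"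
    using assms(1) unfolding alternates_def by blast
  have "sgn c * s * (-1) ^ i * (c * f (p i)) > 0" if "i < k" for i
  proof -
    have "sgn c * s * (-1) ^ i * (c * f (p i)) = (sgn c * c) * (s * (-1) ^ i * f (p i))" by simp
    moreover have "sgn c * c > 0" using assms(2) by (simp add: sgn_if)
    ultimately show ?thesis using *(4)[OF that] by (metis mult_pos_pos)
  qed
  thus ?thesis using * assms(2)
    by (intro alternatesI[of "sgn c * s" _ _ p]) (auto simp: sgn_if)
qed

text \<open>Mean value theorem on each of the \<open>k\<close> steps between \<open>k + 1\<close>
  nodes. The nodes may be the end points \<open>a\<close> and \<open>b\<close>, where only
  continuity is available; this lets both versions of Rolle's theorem below share one proof.\<close>

lemma alternates_zigzag_deriv:
  assumes D: "\<And>x. a < x \<Longrightarrow> x < b \<Longrightarrow> (f has_real_derivative f' x) (at x)"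
    and p: "\<And>i. i \<le> k \<Longrightarrow> a \<le> p i" "\<And>i. i \<le> k \<Longrightarrow> p i \<le> b" "\<And>i. i < k \<Longrightarrow> p i < p (Suc i)"
    and cont: "\<And>i. i < k \<Longrightarrow> continuous_on {p i..p (Suc i)} f"
    and s: "s = 1 \<or> s = -1" "\<And>i. i < k \<Longrightarrow> s * (-1) ^ i * (f (p (Suc i)) - f (p i)) > 0"
  shows "alternates f' a b k"
proof -
  have "\<exists>\<xi>. p i < \<xi> \<and> \<xi> < p (Suc i) \<and> s * (-1) ^ i * f' \<xi> > 0" if i: "i < k" for i
  proof -
    have "\<exists>l z. p i < z \<and> z < p (Suc i) \<and> (f has_real_derivative l) (at z) \<and>
        f (p (Suc i)) - f (p i) = (p (Suc i) - p i) * l"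
    proof (rule MVT)
      show "p i < p (Suc i)" "continuous_on {p i..p (Suc i)} f" using i p(3) cont by auto
      fix x assume "p i < x" "x < p (Suc i)"
      hence "a < x" "x < b" using p(1)[of i] p(2)[of "Suc i"] i by auto
      thus "f differentiable (at x)" using D real_differentiable_def by blast
    qed
    then obtain l z where z: "p i < z" "z < p (Suc i)" "(f has_real_derivative l) (at z)"
        "f (p (Suc i)) - f (p i) = (p (Suc i) - p i) * l" by blast
    have "a < z" "z < b" using z p(1)[of i] p(2)[of "Suc i"] i by auto
    hence "l = f' z" using D z(3) DERIV_unique by blast
    have "0 < s * (-1) ^ i * (f (p (Suc i)) - f (p i))" using s(2)[OF i] .
    also have "\<dots> = (p (Suc i) - p i) * (s * (-1) ^ i * f' z)" using z(4) \<open>l = f' z\<close> by simp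
    finally have "s * (-1) ^ i * f' z > 0" using p(3)[OF i] by (simp add: zero_less_mult_iff)
    thus ?thesis using z by blast
  qed
  then obtain \<xi> where \<xi>: "\<And>i. i < k \<Longrightarrow> p i < \<xi> i" "\<And>i. i < k \<Longrightarrow> \<xi> i < p (Suc i)"
    "\<And>i. i < k \<Longrightarrow> s * (-1) ^ i * f' (\<xi> i) > 0" by metis
  show ?thesis
  proof (rule alternatesI[OF s(1), of _ _ \<xi>])
    show "a < \<xi> i" if "i < k" for i using \<xi>(1)[OF that] p(1)[of i] that by linarith
    show "\<xi> i < b" if "i < k" for i using \<xi>(2)[OF that] p(2)[of "Suc i"] that by linarith
    show "\<xi> i < \<xi> (Suc i)" if "Suc i < k" for i
      using \<xi>(2)[of i] \<xi>(1)[of "Suc i"] that by linarith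
  qed (use \<xi> in auto)
qed

lemma alternates_deriv:
  assumes D: "\<And>x. a < x \<Longrightarrow> x < b \<Longrightarrow> (f has_real_derivative f' x) (at x)"
    and alt: "alternates f a b (Suc k)"
  shows "alternates f' a b k"
proof -
  obtain p s where *: "s = 1 \<or> s = -1" "\<And>i. i < Suc k \<Longrightarrow> a < p i" "\<And>i. i < Suc k \<Longrightarrow> p i < b"
    "\<And>i. i < Suc k \<Longrightarrow> s * (-1) ^ i * f (p i) > 0" "\<And>i. Suc i < Suc k \<Longrightarrow> p i < p (Suc i)"
    using alt unfolding alternates_def by blast
  show ?thesis
  proof (rule alternates_zigzag_deriv[OF D, where k = k and p = p and s = "-s"])
    show "a \<le> p i" "p i \<le> b" if "i \<le> k" for i using *(2,3)[of i] that by auto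
    show "p i < p (Suc i)" if "i < k" for i using *(5)[of i] that by auto
    show "continuous_on {p i..p (Suc i)} f" if "i < k" for i
    proof (rule DERIV_continuous_on)
      fix x assume "x \<in> {p i..p (Suc i)}"
      hence "a < x" "x < b" using *(2)[of i] *(3)[of "Suc i"] that by auto
      thus "(f has_real_derivative f' x) (at x within {p i..p (Suc i)})"
        using D has_field_derivative_at_within by blast
    qed
    show "- s * (-1) ^ i * (f (p (Suc i)) - f (p i)) > 0" if "i < k" for i
      using *(4)[of i] *(4)[of "Suc i"] that by (simp add: algebra_simps)
  qed (use * in auto)
qed

text \<open>Zero values at both ends act as two more nodes of the zigzag, so one alternation is
  gained where the plain version loses one.\<close>

lemma alternates_deriv_zero_ends:
  assumes D: "\<And>x. a < x \<Longrightarrow> x < b \<Longrightarrow> (f has_real_derivative f' x) (at x)"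
    and cont: "continuous_on {a..b} f" and ends: "f a = 0" "f b = 0"
    and alt: "alternates f a b k" and k: "k \<ge> 1"
  shows "alternates f' a b (Suc k)"
proof -
  obtain p s where *: "s = 1 \<or> s = -1" "\<And>i. i < k \<Longrightarrow> a < p i" "\<And>i. i < k \<Longrightarrow> p i < b"
    "\<And>i. i < k \<Longrightarrow> s * (-1) ^ i * f (p i) > 0" "\<And>i. Suc i < k \<Longrightarrow> p i < p (Suc i)"
    using alt unfolding alternates_def by blast
  define q where "q = (\<lambda>i. if i = 0 then a else if i \<le> k then p (i - 1) else b)"
  have ab: "a < b" using *(2)[of 0] *(3)[of 0] k by auto
  have qab: "a \<le> q i" "q i \<le> b" for i
    using *(2)[of "i - 1"] *(3)[of "i - 1"] ab by (cases i; force simp: q_def)+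
  show ?thesis
  proof (rule alternates_zigzag_deriv[OF D, where k = "Suc k" and p = q and s = s])
    show "a \<le> q i" "q i \<le> b" for i by (fact qab)+
    show "q i < q (Suc i)" if "i < Suc k" for i
    proof (cases i)
      case 0 thus ?thesis using k *(2)[of 0] by (auto simp: q_def)
    next
      case (Suc j)
      thus ?thesis using that *(3)[of j] *(5)[of j] by (auto simp: q_def)
    qed
    show "continuous_on {q i..q (Suc i)} f" for i
      by (rule continuous_on_subset[OF cont]) (use qab in auto)
    show "s * (-1) ^ i * (f (q (Suc i)) - f (q i)) > 0" if "i < Suc k" for i
    proof (cases i)
      case 0 thus ?thesis using k *(4)[of 0] ends by (auto simp: q_def)
    next
      case (Suc j)
      thus ?thesis using that *(4)[of j] *(4)[of i] ends by (auto simp: q_def algebra_simps)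
    qed
  qed (use * in auto)
qed

text \<open>A solution of w'' = - b^2 w without zeros inside the window. For |b| < 1/2 it is a
  cosine centred in the window and positive at the ends too; for |b| = 1/2 it is the half-angle
  sine, whose simple zeros are exactly the two ends. The two cases are kept apart because a quotient
  by \<open>w\<close> behaves differently at the ends.\<close>

lemma oscillation_weight:
  assumes b: "\<bar>b\<bar> \<le> (1/2::real)"
  obtains w w' where
    "\<And>x. (w has_real_derivative w' x) (at x)" "\<And>x. (w' has_real_derivative - (b^2 * w x)) (at x)"
    "\<And>x. \<alpha> < x \<Longrightarrow> x < \<alpha> + 2 * pi \<Longrightarrow> w x > 0"
    "(w \<alpha> > 0 \<and> w (\<alpha> + 2 * pi) > 0) \<or>
     (w \<alpha> = 0 \<and> w (\<alpha> + 2 * pi) = 0 \<and> w' \<alpha> \<noteq> 0 \<and> w' (\<alpha> + 2 * pi) \<noteq> 0)"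
proof (cases "\<bar>b\<bar> < 1/2")
  case True
  define w where "w = (\<lambda>x. cos (b * (x - (\<alpha> + pi))))"
  have "w x > 0" if "\<alpha> \<le> x" "x \<le> \<alpha> + 2 * pi" for x
  proof -
    have "\<bar>x - (\<alpha> + pi)\<bar> \<le> pi" using that by linarith
    hence "\<bar>b * (x - (\<alpha> + pi))\<bar> \<le> \<bar>b\<bar> * pi" by (simp add: abs_mult mult_left_mono)
    also have "\<dots> < pi / 2" using True by simp
    finally show ?thesis unfolding w_def by (intro cos_gt_zero_pi) auto
  qed
  note wpos = this
  show ?thesis
  proof (rule that[of w "\<lambda>x. - b * sin (b * (x - (\<alpha> + pi)))"])
    show "(w has_real_derivative - b * sin (b * (x - (\<alpha> + pi)))) (at x)" for x
      unfolding w_def by (auto intro!: derivative_eq_intros)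
    show "((\<lambda>x. - b * sin (b * (x - (\<alpha> + pi)))) has_real_derivative - (b\<^sup>2 * w x)) (at x)" for x
      unfolding w_def by (auto intro!: derivative_eq_intros simp: power2_eq_square)
  qed (use wpos in auto)
next
  case False
  hence "\<bar>b\<bar> = 1/2" using b by linarith
  hence b2: "b^2 = 1/4" by (metis power2_abs power_divide one_power2 power2_eq_square numeral_Bit0 mult_2 mult_numeral_1_right mult.commute numeral_times_numeral num_double)
  show ?thesis
  proof (rule that[of "\<lambda>x. sin ((x - \<alpha>) / 2)" "\<lambda>x. cos ((x - \<alpha>) / 2) / 2"])
    show "((\<lambda>x. sin ((x - \<alpha>) / 2)) has_real_derivative cos ((x - \<alpha>) / 2) / 2) (at x)" for x
      by (auto intro!: derivative_eq_intros)
    show "((\<lambda>x. cos ((x - \<alpha>) / 2) / 2) has_real_derivative - (b\<^sup>2 * sin ((x - \<alpha>) / 2))) (at x)" for x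
      unfolding b2 by (auto intro!: derivative_eq_intros)
    show "sin ((x - \<alpha>) / 2) > 0" if "\<alpha> < x" "x < \<alpha> + 2 * pi" for x
      by (rule sin_gt_zero) (use that in auto)
  qed auto
qed

text \<open>Integrating factor: the derivative of exp(-a x) u is exp(-a x) (u' - a u), and the zeros
  of \<open>u\<close> at both ends give the additional alternation.\<close>

lemma alternates_first_order:
  assumes D: "\<And>x. (u has_real_derivative u' x) (at x)"
    and ends: "u \<alpha> = 0" "u \<beta> = 0" and alt: "alternates u \<alpha> \<beta> k" and k: "k \<ge> 1"
  shows "alternates (\<lambda>x. u' x - a * u x) \<alpha> \<beta> (Suc k)"
proof -
  define v where "v = (\<lambda>x. exp (- (a * x)) * u x)"
  define v' where "v' = (\<lambda>x. exp (- (a * x)) * (u' x - a * u x))"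
  have Dv: "(v has_real_derivative v' x) (at x)" for x
    unfolding v_def v'_def by (auto intro!: derivative_eq_intros D simp: algebra_simps)
  have "alternates v' \<alpha> \<beta> (Suc k)"
  proof (rule alternates_deriv_zero_ends[OF Dv _ _ _ _ k])
    show "continuous_on {\<alpha>..\<beta>} v" by (rule DERIV_continuous_on[OF has_field_derivative_at_within[OF Dv]])
    show "alternates v \<alpha> \<beta> k"
      by (rule alternates_mult_pos[OF alt, of "\<lambda>x. exp (- (a * x))"]) (auto simp: v_def)
  qed (use ends in \<open>auto simp: v_def\<close>)
  thus ?thesis
    by (rule alternates_mult_pos[of _ _ _ _ "\<lambda>x. exp (a * x)"]) (auto simp: v'_def exp_minus)
qed

text \<open>The operator (D - a)^2 + b^2 is factored by the weight: for g = exp(-a x) u and y = w g'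
  - w' g one has (g/w)' = y / w^2 and y' = w exp(-a x) q, with \<open>q\<close> the desired
  expression. So Rolle's theorem is applied twice. Simple zeros of \<open>u\<close> at the ends give
  one gain and one loss; double zeros give two gains.\<close>

lemma alternates_second_order:
  fixes u u' u'' :: "real \<Rightarrow> real"
  assumes D: "\<And>x. (u has_real_derivative u' x) (at x)" and D2: "\<And>x. (u' has_real_derivative u'' x) (at x)"
    and b: "\<bar>b\<bar> \<le> 1/2"
    and ends: "u \<alpha> = 0" "u (\<alpha> + 2 * pi) = 0" and alt: "alternates u \<alpha> (\<alpha> + 2 * pi) k"
  shows "k \<ge> 2 \<Longrightarrow> alternates (\<lambda>x. u'' x - 2 * a * u' x + (a^2 + b^2) * u x) \<alpha> (\<alpha> + 2 * pi) k"
    and "k \<ge> 1 \<Longrightarrow> u' \<alpha> = 0 \<Longrightarrow> u' (\<alpha> + 2 * pi) = 0 \<Longrightarrow>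
      alternates (\<lambda>x. u'' x - 2 * a * u' x + (a^2 + b^2) * u x) \<alpha> (\<alpha> + 2 * pi) (Suc (Suc k))"
proof -
  define \<beta> where "\<beta> = \<alpha> + 2 * pi"
  note ends = ends[folded \<beta>_def] and alt = alt[folded \<beta>_def]
  obtain w w' where w: "\<And>x. (w has_real_derivative w' x) (at x)"
    "\<And>x. (w' has_real_derivative - (b^2 * w x)) (at x)" "\<And>x. \<alpha> < x \<Longrightarrow> x < \<beta> \<Longrightarrow> w x > 0"
    "(w \<alpha> > 0 \<and> w \<beta> > 0) \<or> (w \<alpha> = 0 \<and> w \<beta> = 0 \<and> w' \<alpha> \<noteq> 0 \<and> w' \<beta> \<noteq> 0)"
    unfolding \<beta>_def using oscillation_weight[OF b] by metis
  define e where "e = (\<lambda>x. exp (- (a * x)) :: real)"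
  define g where "g = (\<lambda>x. e x * u x)"
  define g' where "g' = (\<lambda>x. e x * (u' x - a * u x))"
  define q where "q = (\<lambda>x. u'' x - 2 * a * u' x + (a^2 + b^2) * u x)"
  have De: "(e has_real_derivative - a * e x) (at x)" for x
    unfolding e_def by (auto intro!: derivative_eq_intros)
  have Dg: "(g has_real_derivative g' x) (at x)" for x
    unfolding g_def g'_def by (auto intro!: derivative_eq_intros D De simp: algebra_simps)
  define y where "y = (\<lambda>x. w x * g' x - w' x * g x)"
  have Dy: "(y has_real_derivative (w x * e x * q x)) (at x)" for x
    unfolding y_def g'_def g_def q_def
    by (auto intro!: derivative_eq_intros D D2 De w(1,2) simp: algebra_simps power2_eq_square)
  define v where "v = (\<lambda>x. g x / w x)"
  have Dv: "(v has_real_derivative (y x / (w x)^2)) (at x)" if "\<alpha> < x" "x < \<beta>" for x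
    unfolding v_def y_def using w(3)[OF that]
    by (auto intro!: derivative_eq_intros Dg w(1) simp: power2_eq_square field_simps)
  have altv: "alternates v \<alpha> \<beta> k"
    by (rule alternates_mult_pos[OF alt, of "\<lambda>x. e x / w x"]) (auto simp: v_def g_def e_def w(3))
  have altyI: "alternates y \<alpha> \<beta> j" if "alternates (\<lambda>x. y x / (w x)^2) \<alpha> \<beta> j" for j
    using w(3) by (intro alternates_mult_pos[OF that, of "\<lambda>x. (w x)^2"]) force+
  have conty: "continuous_on {\<alpha>..\<beta>} y"
    by (rule DERIV_continuous_on[OF has_field_derivative_at_within[OF Dy]])
  have contg: "continuous_on A g" for A
    by (rule DERIV_continuous_on[OF has_field_derivative_at_within[OF Dg]])
  have contw: "continuous_on A w" for A
    by (rule DERIV_continuous_on[OF has_field_derivative_at_within[OF w(1)]])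
  have g0: "g \<alpha> = 0" "g \<beta> = 0" using ends by (auto simp: g_def)
  have altqI: "alternates q \<alpha> \<beta> j" if "alternates (\<lambda>x. w x * e x * q x) \<alpha> \<beta> j" for j
    using w(3) by (intro alternates_mult_pos[OF that, of "\<lambda>x. 1 / (w x * e x)"]) (force simp: e_def)+
  have "k \<ge> 2 \<Longrightarrow> alternates q \<alpha> \<beta> k"
    using w(4)
  proof (elim disjE conjE)
    \<comment> \<open>The quotient \<open>v\<close> vanishes at the ends, so the first derivative
      gains one alternation and the second loses it.\<close>
    assume k: "k \<ge> 2" and wp: "w \<alpha> > 0" "w \<beta> > 0"
    have "w x > 0" if "x \<in> {\<alpha>..\<beta>}" for x
      using wp w(3)[of x] that by (cases "x = \<alpha>"; cases "x = \<beta>") auto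
    hence cv: "continuous_on {\<alpha>..\<beta>} v" unfolding v_def
      by (intro continuous_on_divide contg contw) force
    have "alternates y \<alpha> \<beta> (Suc k)"
      by (intro altyI alternates_deriv_zero_ends[OF Dv cv _ _ altv]) (use k g0 in \<open>auto simp: v_def\<close>)
    thus ?thesis by (intro altqI alternates_deriv[OF Dy])
  next
    \<comment> \<open>Now \<open>v\<close> is not controlled at the ends, but \<open>y\<close>
      vanishes there. The loss comes first, leaving \<open>k - 1\<close>, and the gain second;
      \<open>k \<ge> 2\<close> keeps \<open>k - 1\<close> positive in between.\<close>
    assume k: "k \<ge> 2" and wp: "w \<alpha> = 0" "w \<beta> = 0"
    have "alternates v \<alpha> \<beta> (Suc (k - 1))" using altv k by simp
    hence "alternates y \<alpha> \<beta> (k - 1)" by (intro altyI alternates_deriv[OF Dv])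
    hence "alternates (\<lambda>x. w x * e x * q x) \<alpha> \<beta> (Suc (k - 1))"
      by (intro alternates_deriv_zero_ends[OF Dy conty]) (use k wp g0 in \<open>auto simp: y_def\<close>)
    thus ?thesis using k by (intro altqI) auto
  qed
  thus "k \<ge> 2 \<Longrightarrow> alternates (\<lambda>x. u'' x - 2 * a * u' x + (a^2 + b^2) * u x) \<alpha> (\<alpha> + 2 * pi) k"
    unfolding q_def \<beta>_def .
  assume k: "k \<ge> 1" and u'0: "u' \<alpha> = 0" "u' (\<alpha> + 2 * pi) = 0"
  hence g'0: "g' \<alpha> = 0" "g' \<beta> = 0" using ends unfolding g'_def \<beta>_def by auto
  \<comment> \<open>Continuous extension of g/w by 0. If \<open>w\<close> has a simple zero at an
    end, the limit there is g'/w', which is 0 because \<open>u\<close> has a double zero.\<close>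
  define v1 where "v1 = (\<lambda>x. if x = \<alpha> \<or> x = \<beta> then 0 else v x)"
  have lim: "(v \<longlongrightarrow> 0) (at x)" if "x = \<alpha> \<or> x = \<beta>" for x
    using w(4)
  proof (elim disjE conjE)
    assume "w \<alpha> > 0" "w \<beta> > 0"
    hence "w x \<noteq> 0" using that by auto
    have "isCont v x" unfolding v_def
      using DERIV_isCont[OF Dg] DERIV_isCont[OF w(1)] \<open>w x \<noteq> 0\<close> by (intro continuous_divide) auto
    moreover have "v x = 0" using that g0 by (auto simp: v_def)
    ultimately show ?thesis by (simp add: isCont_def)
  next
    assume w0: "w \<alpha> = 0" "w \<beta> = 0" "w' \<alpha> \<noteq> 0" "w' \<beta> \<noteq> 0"
    have "((\<lambda>h. (g h - g x) / (h - x)) \<longlongrightarrow> g' x) (at x)" "((\<lambda>h. (w h - w x) / (h - x)) \<longlongrightarrow> w' x) (at x)"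
      using Dg[of x] w(1)[of x] by (auto simp: has_field_derivative_iff)
    hence "((\<lambda>h. ((g h - g x) / (h - x)) / ((w h - w x) / (h - x))) \<longlongrightarrow> g' x / w' x) (at x)"
      by (rule tendsto_divide) (use that w0 in auto)
    moreover have "g' x / w' x = 0" using that g'0 by auto
    moreover have "\<forall>\<^sub>F h in at x. ((g h - g x) / (h - x)) / ((w h - w x) / (h - x)) = v h"
      using eventually_neq_at_within[of x x UNIV]
      by eventually_elim (use that g0 w0 in \<open>auto simp: v_def\<close>)
    ultimately show ?thesis by (simp add: filterlim_cong)
  qed
  have "continuous (at x within {\<alpha>..\<beta>}) v1" if "x \<in> {\<alpha>..\<beta>}" for x
  proof (cases "x = \<alpha> \<or> x = \<beta>")
    case True
    have "\<forall>\<^sub>F h in at x. v h = v1 h"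
    proof -
      have "\<forall>\<^sub>F h in at x. h \<noteq> \<alpha>" "\<forall>\<^sub>F h in at x. h \<noteq> \<beta>"
        by (metis (mono_tags) eventually_neq_at_within)+
      thus ?thesis by eventually_elim (auto simp: v1_def)
    qed
    hence "(v1 \<longlongrightarrow> 0) (at x)" using lim[OF True] by (simp add: filterlim_cong)
    moreover have "v1 x = 0" using True by (simp add: v1_def)
    ultimately have "isCont v1 x" by (simp add: isCont_def)
    thus ?thesis by (rule continuous_at_imp_continuous_at_within)
  next
    case False
    hence x: "\<alpha> < x" "x < \<beta>" using that by auto
    have "isCont v x" using Dv[OF x] DERIV_isCont by blast
    moreover have "\<forall>\<^sub>F h in nhds x. v1 h = v h"
      by (rule eventually_nhds_in_open[of "{\<alpha><..<\<beta>}", THEN eventually_mono]) (use x in \<open>auto simp: v1_def\<close>)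
    ultimately have "isCont v1 x" using isCont_cong by blast
    thus ?thesis by (rule continuous_at_imp_continuous_at_within)
  qed
  hence cv1: "continuous_on {\<alpha>..\<beta>} v1" by (simp add: continuous_on_eq_continuous_within)
  have altv1: "alternates v1 \<alpha> \<beta> k"
    by (rule alternates_mult_pos[OF altv, of "\<lambda>_. 1"]) (auto simp: v1_def)
  have Dv1: "(v1 has_real_derivative (y x / (w x)^2)) (at x)" if x: "\<alpha> < x" "x < \<beta>" for x
  proof -
    have "\<forall>\<^sub>F h in nhds x. v h = v1 h"
      by (rule eventually_nhds_in_open[of "{\<alpha><..<\<beta>}", THEN eventually_mono]) (use x in \<open>auto simp: v1_def\<close>)
    thus ?thesis using Dv[OF x] DERIV_cong_ev by blast
  qed
  have "alternates y \<alpha> \<beta> (Suc k)"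
    by (intro altyI alternates_deriv_zero_ends[OF Dv1 cv1 _ _ altv1]) (use k in \<open>auto simp: v1_def\<close>)
  hence "alternates (\<lambda>x. w x * e x * q x) \<alpha> \<beta> (Suc (Suc k))"
    by (intro alternates_deriv_zero_ends[OF Dy conty]) (use g0 g'0 in \<open>auto simp: y_def\<close>)
  thus "alternates (\<lambda>x. u'' x - 2 * a * u' x + (a^2 + b^2) * u x) \<alpha> (\<alpha> + 2 * pi) (Suc (Suc k))"
    unfolding q_def \<beta>_def using altqI[unfolded q_def \<beta>_def] by blast
qed

section \<open>Differential operators on trigonometric polynomials\<close>

abbreviation cpoly :: "real poly \<Rightarrow> complex poly" where
  "cpoly p \<equiv> map_poly complex_of_real p"

lemma cpoly_mult: "cpoly (p * q) = cpoly p * cpoly q"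
  by (rule poly_eqI) (simp add: coeff_map_poly coeff_mult)

lemma cpoly_add: "cpoly (p + q) = cpoly p + cpoly q"
  by (rule poly_eqI) (simp add: coeff_map_poly)

lemma cpoly_smult: "cpoly (smult c p) = smult (of_real c) (cpoly p)"
  by (rule poly_eqI) (simp add: coeff_map_poly)

lemma cpoly_of_real: "poly (cpoly p) (of_real x) = of_real (poly p x)"
  by (induction p) (auto simp: map_poly_pCons)

lemma cpoly_eq_0_iff: "cpoly p = 0 \<longleftrightarrow> p = 0"
  by (simp add: map_poly_eq_0_iff)

lemma degree_cpoly: "degree (cpoly p) = degree p"
  by (rule degree_map_poly) auto

definition strip_poly :: "real poly \<Rightarrow> bool" where
  "strip_poly p \<longleftrightarrow> p \<noteq> 0 \<and> (\<forall>z. poly (cpoly p) z = 0 \<longrightarrow> \<bar>Im z\<bar> \<le> 1/2)"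

text \<open>The remainder modulo the quadratic with zeros z and its conjugate is c + d X with real c
  and d; it vanishes at a nonreal point only if c = d = 0.\<close>

lemma quadratic_dvd_if_root:
  assumes z: "poly (cpoly p) z = 0" "Im z \<noteq> 0"
  shows "[:(Re z)^2 + (Im z)^2, -2 * Re z, 1:] dvd p"
proof -
  define q where "q = [:(Re z)^2 + (Im z)^2, -2 * Re z, 1:]"
  have q: "degree q = 2" "q \<noteq> 0" by (auto simp: q_def)
  have qz: "poly (cpoly q) z = 0"
    by (simp add: q_def map_poly_pCons complex_eq_iff power2_eq_square algebra_simps)
  define r where "r = p mod q"
  have "degree r < 2" using degree_mod_less'[OF q(2), of p] q unfolding r_def
    by (cases "p mod q = 0") auto
  then obtain c d where r: "r = [:c, d:]"
    by (metis degree_pCons_eq_if less_2_cases_iff pCons_cases degree_eq_zeroE less_Suc0 Suc_less_eq numeral_2_eq_2 pCons_0_0)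
  have "p = q * (p div q) + r" by (simp add: r_def)
  hence "poly (cpoly r) z = 0" using z(1) qz by (metis cpoly_add cpoly_mult poly_add poly_mult mult_zero_left add.left_neutral)
  hence "of_real c + z * of_real d = 0" by (simp add: r map_poly_pCons)
  hence "d = 0" "c = 0" using z(2) by (auto simp: complex_eq_iff)
  hence "r = 0" by (simp add: r)
  thus ?thesis by (simp add: r_def q_def mod_eq_0_iff_dvd)
qed

lemma strip_poly_multD:
  assumes "strip_poly (q * p)" shows "strip_poly p" "strip_poly q"
  using assms by (auto simp: strip_poly_def cpoly_mult)

text \<open>Real zeros are peeled off singly and nonreal ones in conjugate pairs, so the factors are
  exactly the first and second order operators covered by the two Rolle lemmas.\<close>

lemma strip_poly_induct [consumes 1, case_names const linear quadratic]:
  assumes "strip_poly p"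
    and const: "\<And>c. c \<noteq> 0 \<Longrightarrow> P [:c:]"
    and linear: "\<And>c p. strip_poly p \<Longrightarrow> P p \<Longrightarrow> P ([:-c, 1:] * p)"
    and quadratic: "\<And>c b p. strip_poly p \<Longrightarrow> \<bar>b\<bar> \<le> 1/2 \<Longrightarrow> P p \<Longrightarrow> P ([:c^2 + b^2, -2 * c, 1:] * p)"
  shows "P p"
  using assms(1)
proof (induction "degree p" arbitrary: p rule: less_induct)
  case less
  have p0: "p \<noteq> 0" using less.prems by (simp add: strip_poly_def)
  show ?case
  proof (cases "degree p = 0")
    case True
    thus ?thesis using const p0 by (metis degree_eq_zeroE pCons_eq_0_iff)
  next
    case False
    hence "\<not> constant (poly (cpoly p))"
      by (simp add: constant_degree degree_cpoly)
    then obtain z where z: "poly (cpoly p) z = 0" using fundamental_theorem_of_algebra by blast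
    show ?thesis
    proof (cases "Im z = 0")
      case True
      hence "of_real (Re z) = z" by (simp add: complex_eq_iff)
      hence "poly p (Re z) = 0" using z cpoly_of_real[of p "Re z"] by simp
      then obtain q where q: "p = [:- Re z, 1:] * q" using poly_eq_0_iff_dvd by blast
      have sq: "strip_poly q" using strip_poly_multD less.prems q by blast
      have "degree p = 1 + degree q" using q sq
        by (simp add: degree_mult_eq strip_poly_def del: mult_pCons_left)
      thus ?thesis using less.hyps[of q] sq linear q by simp
    next
      case False
      then obtain q where q: "p = [:(Re z)^2 + (Im z)^2, -2 * Re z, 1:] * q"
        using quadratic_dvd_if_root[OF z] by blast
      have sq: "strip_poly q" using strip_poly_multD less.prems q by blast
      have "degree p = 2 + degree q" using q sq
        by (simp add: degree_mult_eq strip_poly_def del: mult_pCons_left)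
      moreover have "\<bar>Im z\<bar> \<le> 1/2" using less.prems z by (simp add: strip_poly_def)
      ultimately show ?thesis using less.hyps[of q] sq quadratic q by simp
    qed
  qed
qed

text \<open>For odd \<open>N\<close> these are the half-odd integers from -N/2 to N/2, which is why
  the functions below change sign under a shift by 2 pi.\<close>

definition freq :: "nat \<Rightarrow> nat \<Rightarrow> real" where
  "freq N j = real j - real N / 2"

definition trig :: "nat \<Rightarrow> (nat \<Rightarrow> complex) \<Rightarrow> real \<Rightarrow> real" where
  "trig N a x = Re (\<Sum>j\<le>N. a j * cis (freq N j * x))"

text \<open>The operator p(d/dx) in terms of coefficients: exp(i \<omega> x) is an eigenfunction
  with eigenvalue p(i \<omega>).\<close>

definition diff_op :: "nat \<Rightarrow> real poly \<Rightarrow> (nat \<Rightarrow> complex) \<Rightarrow> nat \<Rightarrow> complex" where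
  "diff_op N p a j = poly (cpoly p) (\<i> * freq N j) * a j"

lemma diff_op_mult: "diff_op N (p * q) a = diff_op N p (diff_op N q a)"
  by (simp add: diff_op_def fun_eq_iff cpoly_mult)

lemma diff_op_mult': "diff_op N (p * q) a = diff_op N q (diff_op N p a)"
  by (simp add: diff_op_def fun_eq_iff cpoly_mult)

lemma trig_add: "trig N (\<lambda>j. a j + b j) x = trig N a x + trig N b x"
  by (simp add: trig_def algebra_simps sum.distrib)

lemma trig_scale: "trig N (\<lambda>j. of_real c * a j) x = c * trig N a x"
  by (simp add: trig_def mult.assoc flip: sum_distrib_left)

lemma trig_const: "trig N (diff_op N [:c:] a) x = c * trig N a x"
proof -
  have "diff_op N [:c:] a = (\<lambda>j. of_real c * a j)" by (simp add: diff_op_def fun_eq_iff map_poly_pCons)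
  thus ?thesis by (simp only: trig_scale)
qed

lemma trig_has_derivative:
  "(trig N a has_real_derivative trig N (diff_op N [:0, 1:] a) x) (at x)"
proof -
  have eq: "trig N a = (\<lambda>x. \<Sum>j\<le>N. Re (a j) * cos (freq N j * x) - Im (a j) * sin (freq N j * x))" for a
    by (simp add: trig_def fun_eq_iff)
  have "trig N (diff_op N [:0, 1:] a) x =
    (\<Sum>j\<le>N. Re (a j) * (- sin (freq N j * x) * freq N j) - Im (a j) * (cos (freq N j * x) * freq N j))"
    unfolding eq by (intro sum.cong) (auto simp: diff_op_def map_poly_pCons algebra_simps)
  thus ?thesis unfolding eq[of a] by (auto intro!: derivative_eq_intros sum.cong)
qed

lemma trig_linear:
  "trig N (diff_op N [:-c, 1:] a) x = trig N (diff_op N [:0, 1:] a) x - c * trig N a x"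
proof -
  have "diff_op N [:-c, 1:] a = (\<lambda>j. diff_op N [:0, 1:] a j + of_real (-c) * a j)"
    by (simp add: diff_op_def fun_eq_iff map_poly_pCons algebra_simps)
  thus ?thesis by (simp only: trig_add trig_scale)
qed

lemma trig_quadratic:
  "trig N (diff_op N [:c^2 + b^2, -2 * c, 1:] a) x = trig N (diff_op N [:0, 1:] (diff_op N [:0, 1:] a)) x
     - 2 * c * trig N (diff_op N [:0, 1:] a) x + (c^2 + b^2) * trig N a x"
proof -
  have "diff_op N [:c^2 + b^2, -2 * c, 1:] a = (\<lambda>j. (diff_op N [:0, 1:] (diff_op N [:0, 1:] a) j
     + of_real (- 2 * c) * diff_op N [:0, 1:] a j) + of_real (c^2 + b^2) * a j)"
    by (simp add: diff_op_def fun_eq_iff map_poly_pCons algebra_simps)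
  thus ?thesis by (simp only: trig_add trig_scale)
qed

lemma trig_antiperiodic:
  assumes "odd N" shows "trig N a (x + 2 * pi) = - trig N a x"
proof -
  have "cis (freq N j * (x + 2 * pi)) = - cis (freq N j * x)" for j
  proof -
    obtain l where l: "N = 2 * l + 1" using assms oddE by blast
    have "freq N j * (x + 2 * pi) = (freq N j * x + pi) + 2 * pi * of_int (int j - int l - 1)"
      by (simp add: freq_def l field_simps)
    thus ?thesis by (simp flip: cis_mult add: cis_multiple_2pi)
  qed
  thus ?thesis by (simp add: trig_def sum_negf)
qed

lemma trig_continuous: "continuous_on A (trig N a)"
  by (rule DERIV_continuous_on[OF has_field_derivative_at_within[OF trig_has_derivative]])

text \<open>A cyclic count of alternations: the window is one full antiperiod beginning at a zero,
  so that its right end is a zero as well. The window is existentially quantified because applying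
  an operator moves the zeros.\<close>

definition cyc :: "nat \<Rightarrow> (nat \<Rightarrow> complex) \<Rightarrow> nat \<Rightarrow> bool" where
  "cyc N a k \<longleftrightarrow> (\<exists>\<alpha>. trig N a \<alpha> = 0 \<and> alternates (trig N a) \<alpha> (\<alpha> + 2 * pi) k)"

text \<open>Parity makes the count independent of the window. For odd \<open>k\<close> the first and
  last alternation point have the same sign, while the first one shifted by 2 pi has the opposite
  sign; so a zero lies between the last point and that shifted point, and a new window can start
  there, one antiperiod earlier, still containing all \<open>k\<close> points.\<close>

lemma cyc_if_alternates:
  assumes N: "odd N" and alt: "alternates (trig N a) x (x + 2 * pi) k'" and k: "odd k" "k \<le> k'"
  shows "cyc N a k"
proof -
  have "alternates (trig N a) x (x + 2 * pi) k" using alternates_mono alt k by blast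
  then obtain p s where *: "s = 1 \<or> s = -1" "\<And>i. i < k \<Longrightarrow> x < p i" "\<And>i. i < k \<Longrightarrow> p i < x + 2 * pi"
    "\<And>i. i < k \<Longrightarrow> s * (-1) ^ i * trig N a (p i) > 0" "\<And>i. Suc i < k \<Longrightarrow> p i < p (Suc i)"
    unfolding alternates_def by blast
  have mono: "p i \<le> p j" if "i \<le> j" "j < k" for i j
    using that by (induction rule: dec_induct) (use *(5) in force)+
  have k0: "k > 0" using k by (auto elim: oddE)
  have s1: "s * trig N a (p 0) > 0" using *(4)[of 0] k0 by simp
  have s2: "s * trig N a (p (k - 1)) > 0" using *(4)[of "k - 1"] k0 k(1) by simp
  have lt: "p (k - 1) < p 0 + 2 * pi" using *(3)[of "k - 1"] *(2)[of 0] k0 by simp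
  have "\<exists>\<beta>\<ge>p (k - 1). \<beta> \<le> p 0 + 2 * pi \<and> - (s * trig N a \<beta>) = 0"
    by (rule IVT') (use s1 s2 lt trig_antiperiodic[OF N, of a "p 0"] in
        \<open>auto intro!: continuous_intros trig_continuous\<close>)
  then obtain \<beta> where \<beta>: "p (k - 1) \<le> \<beta>" "\<beta> \<le> p 0 + 2 * pi" "trig N a \<beta> = 0"
    using *(1) by auto
  have "\<beta> \<noteq> p (k - 1)" using s2 \<beta>(3) by auto
  moreover have "\<beta> \<noteq> p 0 + 2 * pi" using s1 \<beta>(3) trig_antiperiodic[OF N, of a "p 0"] by auto
  ultimately have \<beta>': "p (k - 1) < \<beta>" "\<beta> < p 0 + 2 * pi" using \<beta> by auto
  have "trig N a (\<beta> - 2 * pi) = 0" using trig_antiperiodic[OF N, of a "\<beta> - 2 * pi"] \<beta>(3) by simp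
  moreover have "alternates (trig N a) (\<beta> - 2 * pi) (\<beta> - 2 * pi + 2 * pi) k"
  proof (rule alternatesI[of s _ _ p])
    fix i assume i: "i < k"
    show "\<beta> - 2 * pi < p i" using mono[of 0 i] i \<beta>' by auto
    show "p i < \<beta> - 2 * pi + 2 * pi" using mono[of i "k - 1"] i \<beta>' k0 by (simp add: Suc_leI le_diff_conv2)
  qed (use * in auto)
  ultimately show ?thesis unfolding cyc_def by blast
qed

text \<open>In the current window a linear factor yields \<open>k + 1\<close> alternations and a
  quadratic factor yields \<open>k\<close>; \<open>cyc_if_alternates\<close> then provides a window
  with zero ends for the next factor.\<close>

lemma cyc_diff_op:
  assumes "strip_poly p" "odd N" "odd k" "k \<ge> 3" "cyc N a k"
  shows "cyc N (diff_op N p a) k"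
  using assms(1,5)
proof (induction p arbitrary: a rule: strip_poly_induct)
  case (const c)
  then obtain \<alpha> where "trig N a \<alpha> = 0" "alternates (trig N a) \<alpha> (\<alpha> + 2 * pi) k" by (auto simp: cyc_def)
  hence "alternates (trig N (diff_op N [:c:] a)) \<alpha> (\<alpha> + 2 * pi) k"
    unfolding trig_const using alternates_scale const.hyps by blast
  thus ?case using cyc_if_alternates assms by blast
next
  case (linear c p)
  obtain \<alpha> where \<alpha>: "trig N a \<alpha> = 0" "alternates (trig N a) \<alpha> (\<alpha> + 2 * pi) k"
    using linear.prems by (auto simp: cyc_def)
  have "alternates (trig N (diff_op N [:-c, 1:] a)) \<alpha> (\<alpha> + 2 * pi) (Suc k)"
    unfolding trig_linear
    by (rule alternates_first_order[OF trig_has_derivative \<alpha>(1) _ \<alpha>(2)])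
       (use \<alpha> assms trig_antiperiodic[of N a \<alpha>] in auto)
  hence "cyc N (diff_op N [:-c, 1:] a) k" using cyc_if_alternates assms by (meson le_Suc_eq order_refl)
  thus ?case using linear.IH diff_op_mult' by metis
next
  case (quadratic c b p)
  obtain \<alpha> where \<alpha>: "trig N a \<alpha> = 0" "alternates (trig N a) \<alpha> (\<alpha> + 2 * pi) k"
    using quadratic.prems by (auto simp: cyc_def)
  have "alternates (trig N (diff_op N [:c^2+b^2, -2*c, 1:] a)) \<alpha> (\<alpha> + 2 * pi) k"
    unfolding trig_quadratic
    by (rule alternates_second_order(1)[OF trig_has_derivative trig_has_derivative quadratic.hyps(2) \<alpha>(1) _ \<alpha>(2)])
       (use \<alpha> assms trig_antiperiodic[of N a \<alpha>] in auto)
  hence "cyc N (diff_op N [:c^2+b^2, -2*c, 1:] a) k" using cyc_if_alternates assms by blast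
  thus ?case using quadratic.IH diff_op_mult' by metis
qed

text \<open>A zero of order at least \<open>m\<close>, expressed through all operators of degree
  below \<open>m\<close>, so that applying an operator visibly lowers the order by at most its
  degree.\<close>

definition vanishes :: "nat \<Rightarrow> (nat \<Rightarrow> complex) \<Rightarrow> real \<Rightarrow> nat \<Rightarrow> bool" where
  "vanishes N a \<alpha> m \<longleftrightarrow> (\<forall>p. degree p < m \<longrightarrow> trig N (diff_op N p a) \<alpha> = 0)"

lemma vanishes_diff_op:
  assumes "vanishes N a \<alpha> m" "m' + degree q \<le> m"
  shows "vanishes N (diff_op N q a) \<alpha> m'"
  unfolding vanishes_def
proof (intro allI impI)
  fix p :: "real poly" assume "degree p < m'"
  hence "degree (p * q) < m" using degree_mult_le[of p q] assms(2) by linarith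
  thus "trig N (diff_op N p (diff_op N q a)) \<alpha> = 0"
    using assms(1) unfolding vanishes_def diff_op_mult[symmetric] by blast
qed

lemma vanishes_0:
  assumes "vanishes N a \<alpha> m" "m \<ge> 1"
  shows "trig N a \<alpha> = 0"
proof -
  have "trig N (diff_op N [:1:] a) \<alpha> = 0" using assms unfolding vanishes_def by auto
  thus ?thesis by (simp add: trig_const)
qed

lemma vanishes_1:
  assumes "vanishes N a \<alpha> m" "m \<ge> 2"
  shows "trig N (diff_op N [:0, 1:] a) \<alpha> = 0"
proof -
  have "degree [:0, 1::real:] < m" using assms by simp
  thus ?thesis using assms(1) unfolding vanishes_def by blast
qed

text \<open>As long as the order \<open>m\<close> is large enough for the next factor, the window
  stays at \<alpha> and a factor of degree d turns d orders of vanishing into d alternations;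
  \<open>k + m\<close> is invariant. When \<open>m\<close> has become too small for the next factor,
  \<open>k\<close> alone is at least \<open>K\<close> and \<open>cyc_diff_op\<close> takes over. The
  bound \<open>degree p \<ge> m\<close> says that there are enough factors to use up the whole
  order.\<close>

lemma cyc_diff_op_vanishes:
  assumes "strip_poly p" "odd N" "odd K" "K \<ge> 3" "k \<ge> 1" "alternates (trig N a) \<alpha> (\<alpha> + 2 * pi) k"
    "vanishes N a \<alpha> m" "k + m \<ge> K + 1" "degree p \<ge> m"
  shows "cyc N (diff_op N p a) K"
  using assms(1,5-9)
proof (induction p arbitrary: a k m rule: strip_poly_induct)
  case (const c)
  hence "cyc N a K" using cyc_if_alternates assms by simp
  thus ?case using cyc_diff_op[of "[:c:]"] assms const by (auto simp: strip_poly_def map_poly_pCons)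
next
  case (linear c p)
  have "strip_poly ([:-c,1:])" by (auto simp: strip_poly_def map_poly_pCons)
  hence st: "strip_poly ([:-c,1:] * p)" using linear.hyps
    by (auto simp: strip_poly_def cpoly_mult simp del: mult_pCons_left)
  show ?case
  proof (cases "m = 0")
    case True
    hence "cyc N a K" using cyc_if_alternates assms linear.prems by auto
    thus ?thesis using cyc_diff_op[OF st] assms by blast
  next
    case False
    have z: "trig N a \<alpha> = 0" using vanishes_0[OF linear.prems(3)] False by simp
    have "alternates (trig N (diff_op N [:-c, 1:] a)) \<alpha> (\<alpha> + 2 * pi) (Suc k)"
      unfolding trig_linear
      by (rule alternates_first_order[OF trig_has_derivative z _ linear.prems(2)])
         (use z assms linear.prems trig_antiperiodic[of N a \<alpha>] in auto)
    moreover have "vanishes N (diff_op N [:-c, 1:] a) \<alpha> (m - 1)"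
      by (rule vanishes_diff_op[OF linear.prems(3)]) (use False in auto)
    moreover have "degree ([:-c,1:] * p) = 1 + degree p"
      using linear.hyps by (simp add: degree_mult_eq strip_poly_def del: mult_pCons_left)
    ultimately have "cyc N (diff_op N p (diff_op N [:-c, 1:] a)) K"
      using linear.prems False by (intro linear.IH[where k = "Suc k" and m = "m - 1"]) auto
    thus ?thesis unfolding diff_op_mult' .
  qed
next
  case (quadratic c b p)
  have st0: "strip_poly [:c^2+b^2, -2*c, 1:]"
    unfolding strip_poly_def
  proof (intro conjI allI impI)
    fix z assume "poly (cpoly [:c^2+b^2, -2*c, 1:]) z = 0"
    hence "(z - of_real c)^2 = - (of_real b^2)" by (simp add: map_poly_pCons power2_eq_square algebra_simps)
    hence "(z - of_real c)^2 = (\<i> * of_real b)^2" by (simp add: power_mult_distrib)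
    hence "z - of_real c = \<i> * of_real b \<or> z - of_real c = - (\<i> * of_real b)" using power2_eq_iff by blast
    hence "z = of_real c + \<i> * of_real b \<or> z = of_real c - \<i> * of_real b" by (auto simp: algebra_simps)
    thus "\<bar>Im z\<bar> \<le> 1/2" using quadratic.hyps(2) by auto
  qed simp
  hence st: "strip_poly ([:c^2+b^2, -2*c, 1:] * p)" using quadratic.hyps
    by (auto simp: strip_poly_def cpoly_mult simp del: mult_pCons_left)
  show ?case
  proof (cases "m \<ge> 2")
    case False
    have "cyc N a K" using cyc_if_alternates[OF assms(2) quadratic.prems(2) assms(3)] False quadratic.prems by auto
    thus ?thesis using cyc_diff_op[OF st] assms by blast
  next
    case True
    have z: "trig N a \<alpha> = 0" using vanishes_0[OF quadratic.prems(3)] True by simp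
    have z': "trig N (diff_op N [:0,1:] a) \<alpha> = 0" by (rule vanishes_1[OF quadratic.prems(3) True])
    have "alternates (trig N (diff_op N [:c^2+b^2, -2*c, 1:] a)) \<alpha> (\<alpha> + 2 * pi) (Suc (Suc k))"
      unfolding trig_quadratic
      by (rule alternates_second_order(2)[OF trig_has_derivative trig_has_derivative quadratic.hyps(2) z _ quadratic.prems(2)])
         (use z z' assms quadratic.prems trig_antiperiodic[of N _ \<alpha>] in auto)
    moreover have "vanishes N (diff_op N [:c^2+b^2, -2*c, 1:] a) \<alpha> (m - 2)"
      by (rule vanishes_diff_op[OF quadratic.prems(3)]) (use True in auto)
    moreover have "degree ([:c^2+b^2, -2*c, 1:] * p) = 2 + degree p"
      using quadratic.hyps by (simp add: degree_mult_eq strip_poly_def del: mult_pCons_left)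
    ultimately have "cyc N (diff_op N p (diff_op N [:c^2+b^2, -2*c, 1:] a)) K"
      using quadratic.prems True by (intro quadratic.IH[where k = "Suc (Suc k)" and m = "m - 2"]) auto
    thus ?thesis unfolding diff_op_mult' .
  qed
qed

text \<open>Only finitely many strict inequalities are involved, with smallest margin \<mu>;
  changing each of the \<open>N + 1\<close> coefficients by less than \<mu> / (N + 1) changes all
  values by less than \<mu>. The zero at the left end may move, but \<open>cyc_if_alternates\<close>
  finds a new one.\<close>

lemma cyc_open:
  assumes N: "odd N" and k: "odd k" and "cyc N a k"
  obtains \<epsilon> where "\<epsilon> > 0" "\<And>b. (\<And>j. j \<le> N \<Longrightarrow> norm (b j - a j) < \<epsilon>) \<Longrightarrow> cyc N b k"
proof -
  obtain \<alpha> where \<alpha>: "trig N a \<alpha> = 0" "alternates (trig N a) \<alpha> (\<alpha> + 2 * pi) k"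
    using assms by (auto simp: cyc_def)
  obtain p s where *: "s = 1 \<or> s = -1" "\<And>i. i < k \<Longrightarrow> \<alpha> < p i" "\<And>i. i < k \<Longrightarrow> p i < \<alpha> + 2 * pi"
    "\<And>i. i < k \<Longrightarrow> s * (-1) ^ i * trig N a (p i) > 0" "\<And>i. Suc i < k \<Longrightarrow> p i < p (Suc i)"
    using \<alpha>(2) unfolding alternates_def by blast
  have k0: "k > 0" using k by (auto elim: oddE)
  define \<mu> where "\<mu> = Min ((\<lambda>i. s * (-1) ^ i * trig N a (p i)) ` {..<k})"
  have \<mu>: "\<mu> > 0" unfolding \<mu>_def using k0 *(4) by (subst Min_gr_iff) auto
  have \<mu>_le: "\<mu> \<le> s * (-1) ^ i * trig N a (p i)" if "i < k" for i
    unfolding \<mu>_def using that by (intro Min_le) auto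
  show ?thesis
  proof (rule that[of "\<mu> / (real N + 1)"])
    show "\<mu> / (real N + 1) > 0" using \<mu> by simp
    fix b assume b: "\<And>j. j \<le> N \<Longrightarrow> norm (b j - a j) < \<mu> / (real N + 1)"
    have close: "\<bar>trig N b x - trig N a x\<bar> < \<mu>" for x
    proof -
      have "trig N b x - trig N a x = Re (\<Sum>j\<le>N. (b j - a j) * cis (freq N j * x))"
        by (simp add: trig_def algebra_simps sum_subtractf)
      hence "\<bar>trig N b x - trig N a x\<bar> \<le> norm (\<Sum>j\<le>N. (b j - a j) * cis (freq N j * x))"
        using abs_Re_le_cmod by metis
      also have "\<dots> \<le> (\<Sum>j\<le>N. norm (b j - a j))"
        by (rule order.trans[OF norm_sum]) (simp add: norm_mult)
      also have "\<dots> < (\<Sum>j\<le>N. \<mu> / (real N + 1))" using b by (intro sum_strict_mono) auto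
      also have "\<dots> = \<mu>" by (simp add: field_simps)
      finally show ?thesis .
    qed
    have "s * (-1) ^ i * trig N b (p i) > 0" if "i < k" for i
    proof -
      have "s * (-1) ^ i = 1 \<or> s * (-1) ^ i = -1" using *(1) by (cases "even i") auto
      thus ?thesis using \<mu>_le[OF that] close[of "p i"] by auto
    qed
    hence "alternates (trig N b) \<alpha> (\<alpha> + 2 * pi) k"
      using * by (intro alternatesI[of s _ _ p]) auto
    thus "cyc N b k" using cyc_if_alternates N k by blast
  qed
qed

text \<open>The target \<open>t = G c + \<eta> e\<close> is exactly the image of \<open>t / P l\<close> under the differential operator
  \<open>P l\<close>, and \<open>t / P l\<close> is close to \<open>q c\<close>, which alternates strictly; so no limit of zeros is taken.\<close>

lemma cyc_perturbed:
  fixes G G0 :: "nat \<Rightarrow> complex" and P :: "nat \<Rightarrow> real poly"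
  assumes N: "odd N" and K: "odd K" "K \<ge> 3" and q: "strip_poly q" "degree q \<ge> K"
    and G: "\<And>j. j \<le> N \<Longrightarrow> G j = poly (cpoly q) (\<i> * freq N j) * G0 j" "\<And>j. j \<le> N \<Longrightarrow> G0 j \<noteq> 0"
    and P: "\<And>l. strip_poly (P l)"
      "\<And>j. j \<le> N \<Longrightarrow> (\<lambda>l. poly (cpoly (P l)) (\<i> * freq N j)) \<longlonglongrightarrow> G0 j"
    and c: "vanishes N c \<alpha> K" "\<alpha> < x" "x < \<alpha> + 2 * pi" "trig N c x \<noteq> 0"
  obtains \<eta>0 where "\<eta>0 > 0" "\<And>\<eta>. 0 \<le> \<eta> \<Longrightarrow> \<eta> < \<eta>0 \<Longrightarrow> cyc N (\<lambda>j. G j * c j + of_real \<eta> * e j) K"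
proof -
  have "alternates (trig N c) \<alpha> (\<alpha> + 2 * pi) 1"
    by (rule alternatesI[of "sgn (trig N c x)" _ _ "\<lambda>_. x"]) (use c in \<open>auto simp: sgn_if\<close>)
  hence "cyc N (diff_op N q c) K"
    using cyc_diff_op_vanishes[OF q(1) N K, of 1 c \<alpha> K] c(1) q by simp
  then obtain \<epsilon> where \<epsilon>: "\<epsilon> > 0"
    "\<And>b. (\<And>j. j \<le> N \<Longrightarrow> norm (b j - diff_op N q c j) < \<epsilon>) \<Longrightarrow> cyc N b K"
    using cyc_open[OF N K(1)] by blast
  define Pv where "Pv = (\<lambda>l j. poly (cpoly (P l)) (\<i> * freq N j))"
  have ev: "\<forall>\<^sub>F l in sequentially. Pv l j \<noteq> 0 \<and> norm (G j * c j / Pv l j - diff_op N q c j) < \<epsilon> / 2"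
    if j: "j \<le> N" for j
  proof (rule eventually_conj)
    show "\<forall>\<^sub>F l in sequentially. Pv l j \<noteq> 0"
      unfolding Pv_def by (rule tendsto_imp_eventually_ne[OF P(2)[OF j] G(2)[OF j]])
    have "(\<lambda>l. G j * c j / Pv l j) \<longlonglongrightarrow> G j * c j / G0 j"
      unfolding Pv_def by (intro tendsto_intros P(2) j G(2))
    moreover have "G j * c j / G0 j = diff_op N q c j" using G[OF j] by (simp add: diff_op_def)
    ultimately have "(\<lambda>l. G j * c j / Pv l j) \<longlonglongrightarrow> diff_op N q c j" by simp
    from tendstoD[OF this half_gt_zero[OF \<epsilon>(1)]]
    show "\<forall>\<^sub>F l in sequentially. norm (G j * c j / Pv l j - diff_op N q c j) < \<epsilon> / 2"
      by (simp only: dist_norm)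
  qed
  have "\<forall>\<^sub>F l in sequentially. \<forall>j\<in>{..N}. Pv l j \<noteq> 0 \<and> norm (G j * c j / Pv l j - diff_op N q c j) < \<epsilon> / 2"
    by (rule eventually_ball_finite) (use ev in auto)
  then obtain l where l: "\<And>j. j \<le> N \<Longrightarrow> Pv l j \<noteq> 0"
    "\<And>j. j \<le> N \<Longrightarrow> norm (G j * c j / Pv l j - diff_op N q c j) < \<epsilon> / 2"
    using eventually_sequentially by fastforce
  define B where "B = (\<Sum>j\<le>N. norm (e j / Pv l j))"
  have B: "norm (e j / Pv l j) \<le> B" if "j \<le> N" for j
    unfolding B_def by (rule member_le_sum) (use that in auto)
  have B0: "B \<ge> 0" unfolding B_def by (intro sum_nonneg) auto
  show ?thesis
  \<comment> \<open>The index \<open>l\<close> was fixed before \<eta>, so \<open>B\<close> is a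
    constant: half of \<epsilon> pays for replacing \<open>G0\<close> by \<open>P l\<close>, the
    other half for the perturbation \<open>e\<close>.\<close>
  proof (rule that[of "\<epsilon> / (2 * (B + 1))"])
    show "\<epsilon> / (2 * (B + 1)) > 0" using \<epsilon>(1) B0 by simp
    fix \<eta> :: real assume \<eta>: "0 \<le> \<eta>" "\<eta> < \<epsilon> / (2 * (B + 1))"
    define t where "t = (\<lambda>j. G j * c j + of_real \<eta> * e j)"
    define b where "b = (\<lambda>j. t j / Pv l j)"
    have "norm (b j - diff_op N q c j) < \<epsilon>" if j: "j \<le> N" for j
    proof -
      have "b j - diff_op N q c j = (G j * c j / Pv l j - diff_op N q c j) + of_real \<eta> * (e j / Pv l j)"
        by (simp add: b_def t_def add_divide_distrib)
      hence "norm (b j - diff_op N q c j) \<le> norm (G j * c j / Pv l j - diff_op N q c j) + \<eta> * norm (e j / Pv l j)"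
        using norm_triangle_ineq[of "G j * c j / Pv l j - diff_op N q c j" "of_real \<eta> * (e j / Pv l j)"] \<eta>(1)
        by (simp only: norm_mult norm_of_real abs_of_nonneg)
      also have "\<eta> * norm (e j / Pv l j) \<le> \<eta> * (B + 1)" using B[OF j] \<eta>(1) by (intro mult_left_mono) auto
      also have "\<eta> * (B + 1) < \<epsilon> / 2" using \<eta>(2) B0 by (simp add: field_simps)
      finally show ?thesis using l(2)[OF j] by simp
    qed
    hence "cyc N b K" using \<epsilon>(2) by blast
    hence "cyc N (diff_op N (P l) b) K" using cyc_diff_op P(1) N K by blast
    moreover have "diff_op N (P l) b j = t j" if "j \<le> N" for j
      using l(1)[OF that] by (simp add: diff_op_def b_def Pv_def)
    hence "trig N (diff_op N (P l) b) = trig N t" unfolding trig_def by (intro ext) simp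
    ultimately have "cyc N t K" unfolding cyc_def by simp
    thus "cyc N (\<lambda>j. G j * c j + of_real \<eta> * e j) K" unfolding t_def .
  qed
qed

section \<open>Entire functions with zeros in a strip\<close>

lemma real_poly_if_cnj:
  fixes p :: "complex poly"
  assumes "\<And>z. poly p (cnj z) = cnj (poly p z)"
  obtains q where "p = cpoly q"
proof -
  have "poly (map_poly cnj p) (cnj z) = cnj (poly p z)" for z
    by (induction p) (auto simp: map_poly_pCons)
  hence "poly (map_poly cnj p) z = poly p z" for z by (metis assms complex_cnj_cnj)
  hence "map_poly cnj p = p" by (simp add: poly_eq_poly_eq_iff[symmetric] fun_eq_iff)
  hence "cnj (coeff p n) = coeff p n" for n by (metis coeff_map_poly complex_cnj_zero)
  hence "of_real (Re (coeff p n)) = coeff p n" for n by (simp add: complex_eq_iff)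
  hence "p = cpoly (map_poly Re p)" by (intro poly_eqI) (simp add: coeff_map_poly)
  thus ?thesis using that by blast
qed

section \<open>Splitting off the zeros of an entire function\<close>

lemma entire_divide_power:
  fixes G :: "complex \<Rightarrow> complex"
  assumes holo: "G holomorphic_on UNIV" and nz: "G w0 \<noteq> 0"
  obtains H where "H holomorphic_on UNIV" "H z \<noteq> 0" "\<And>w. G w = (w - z) ^ nat (zorder G z) * H w"
proof -
  define m where "m = nat (zorder G z)"
  define g where "g = zor_poly G z"
  obtain r where r: "r > 0" "g holomorphic_on cball z r"
    "\<And>w. w \<in> cball z r \<Longrightarrow> G w = g w * (w - z) ^ m \<and> g w \<noteq> 0"
    using zorder_exist_zero[OF holo open_UNIV connected_UNIV UNIV_I[of z]] nz unfolding m_def g_def by blast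
  define H where "H = (\<lambda>w. if w \<in> ball z r then g w else G w / (w - z) ^ m)"
  have "H holomorphic_on (ball z r \<union> (- {z}))"
  proof (rule holomorphic_on_Un)
    have "g holomorphic_on ball z r" using r(2) holomorphic_on_subset ball_subset_cball by blast
    thus "H holomorphic_on ball z r" by (rule holomorphic_transform) (simp add: H_def)
    have "(\<lambda>w. G w / (w - z) ^ m) holomorphic_on - {z}"
      using holo by (intro holomorphic_intros) (auto intro: holomorphic_on_subset)
    thus "H holomorphic_on - {z}"
      by (rule holomorphic_transform) (use r(3) in \<open>auto simp: H_def\<close>)
  qed auto
  moreover have "ball z r \<union> (- {z}) = UNIV" using r(1) by auto
  ultimately have "H holomorphic_on UNIV" by simp
  moreover have "H z \<noteq> 0" using r(1) r(3)[of z] by (simp add: H_def)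
  moreover have "G w = (w - z) ^ m * H w" for w
    using r(3)[of w] r(1) by (auto simp: H_def)
  ultimately show ?thesis using that unfolding m_def by blast
qed

lemma zorder_eq_if_factor:
  assumes "H holomorphic_on UNIV" "H z \<noteq> 0" "\<And>w. G w = (w - z) ^ m * H w"
  shows "zorder G z = int m"
  by (rule zorder_eqI[of UNIV z H]) (use assms in auto)

text \<open>The local factorization is carried along by conjugation and reflection. Symmetric zeros
  thus have equal multiplicities, which makes the product over all zeros in a disc inherit the
  symmetries.\<close>

lemma zorder_symmetries:
  fixes G :: "complex \<Rightarrow> complex"
  assumes holo: "G holomorphic_on UNIV" and nz: "G w0 \<noteq> 0"
  shows "(\<And>z. G (cnj z) = cnj (G z)) \<Longrightarrow> zorder G (cnj z) = zorder G z"
    and "(\<And>z. G (-z) = \<kappa> * G z) \<Longrightarrow> zorder G (-z) = zorder G z"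
proof -
  define m where "m = nat (zorder G z)"
  obtain H where H: "H holomorphic_on UNIV" "H z \<noteq> 0" "\<And>w. G w = (w - z) ^ m * H w"
    using entire_divide_power[OF holo nz] unfolding m_def by metis
  have m: "zorder G z = int m" by (rule zorder_eq_if_factor[OF H])
  {
    assume c: "\<And>z. G (cnj z) = cnj (G z)"
    have "zorder G (cnj z) = int m"
    proof (rule zorder_eq_if_factor)
      show "(cnj \<circ> H \<circ> cnj) holomorphic_on UNIV"
        by (rule holomorphic_on_compose_cnj_cnj) (auto intro: holomorphic_on_subset[OF H(1)])
      show "(cnj \<circ> H \<circ> cnj) (cnj z) \<noteq> 0" using H(2) by simp
      show "G w = (w - cnj z) ^ m * (cnj \<circ> H \<circ> cnj) w" for w
        using c[of "cnj w"] H(3)[of "cnj w"] by simp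
    qed
    thus "zorder G (cnj z) = zorder G z" using m by simp
  }
  {
    assume c: "\<And>z. G (-z) = \<kappa> * G z"
    have k: "\<kappa> \<noteq> 0" using c[of "-w0"] nz by auto
    have "zorder G (- z) = int m"
    proof (rule zorder_eq_if_factor[where H = "\<lambda>w. (-1) ^ m / \<kappa> * H (-w)"])
      show "(\<lambda>w. (-1) ^ m / \<kappa> * H (-w)) holomorphic_on UNIV"
        using k by (intro holomorphic_intros holomorphic_on_compose[OF _ holomorphic_on_subset[OF H(1)], unfolded o_def]) auto
      show "(- 1) ^ m / \<kappa> * H (- (- z)) \<noteq> 0" using H(2) k by simp
      show "G w = (w - (- z)) ^ m * ((-1) ^ m / \<kappa> * H (-w))" for w
      proof -
        have "\<kappa> * G w = (- w - z) ^ m * H (- w)" using c[of w] H(3)[of "- w"] by simp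
        also have "(- w - z) ^ m = (-1) ^ m * (w + z) ^ m"
          by (metis minus_add_distrib power_minus uminus_add_conv_diff add.commute)
        finally show ?thesis using k by (simp add: field_simps)
      qed
    qed
    thus "zorder G (-z) = zorder G z" using m by simp
  }
qed

definition zero_poly :: "(complex \<Rightarrow> complex) \<Rightarrow> complex set \<Rightarrow> complex poly" where
  "zero_poly G Z = (\<Prod>\<rho>\<in>Z. [:-\<rho>, 1:] ^ nat (zorder G \<rho>))"

lemma poly_zero_poly: "poly (zero_poly G Z) w = (\<Prod>\<rho>\<in>Z. (w - \<rho>) ^ nat (zorder G \<rho>))"
  by (simp add: zero_poly_def poly_prod poly_power)

lemma zero_poly_factor:
  assumes holo: "G holomorphic_on UNIV" and nz: "G w0 \<noteq> 0" and fin: "finite Z"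
  shows "\<exists>H. H holomorphic_on UNIV \<and> (\<forall>\<rho>\<in>Z. H \<rho> \<noteq> 0) \<and> (\<forall>w. G w = poly (zero_poly G Z) w * H w)"
  using fin
proof (induction Z rule: finite_induct)
  case empty
  thus ?case using holo by (intro exI[of _ G]) (simp add: zero_poly_def)
next
  case (insert \<rho> Z)
  then obtain H where H: "H holomorphic_on UNIV" "\<And>\<rho>. \<rho> \<in> Z \<Longrightarrow> H \<rho> \<noteq> 0"
    "\<And>w. G w = poly (zero_poly G Z) w * H w" by blast
  have "H w0 \<noteq> 0" using nz H(3) by auto
  define m where "m = nat (zorder H \<rho>)"
  obtain K where K: "K holomorphic_on UNIV" "K \<rho> \<noteq> 0" "\<And>w. H w = (w - \<rho>) ^ m * K w"
    using entire_divide_power[OF H(1) \<open>H w0 \<noteq> 0\<close>] unfolding m_def by metis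
  \<comment> \<open>The factors already split off do not vanish at \<rho>, so the multiplicity
    measured in the quotient \<open>H\<close> is the one measured in \<open>G\<close>.\<close>
  have "zorder G \<rho> = int m"
  proof (rule zorder_eq_if_factor)
    show "(\<lambda>w. poly (zero_poly G Z) w * K w) holomorphic_on UNIV"
      by (intro holomorphic_intros K(1))
    show "poly (zero_poly G Z) \<rho> * K \<rho> \<noteq> 0"
      using insert.hyps K(2) by (auto simp: poly_zero_poly)
    show "G w = (w - \<rho>) ^ m * (poly (zero_poly G Z) w * K w)" for w by (simp add: H(3) K(3))
  qed
  hence eq: "poly (zero_poly G (insert \<rho> Z)) w = (w - \<rho>) ^ m * poly (zero_poly G Z) w" for w
    using insert.hyps by (simp add: poly_zero_poly)
  have "K \<rho>' \<noteq> 0" if "\<rho>' \<in> insert \<rho> Z" for \<rho>'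
    using that K(2) H(2)[of \<rho>'] K(3)[of \<rho>'] by auto
  moreover have "G w = poly (zero_poly G (insert \<rho> Z)) w * K w" for w
    using H(3)[of w] K(3)[of w] eq[of w] by (simp only: mult_ac)
  ultimately show ?case using K(1) by blast
qed

text \<open>Were f - g nonzero at one point, it would be nonzero on a ball around it, and the ball
  would consist of roots of \<open>p\<close>.\<close>

lemma entire_eqI_except_roots:
  fixes p :: "complex poly"
  assumes "f holomorphic_on UNIV" "g holomorphic_on UNIV" "p \<noteq> 0"
    "\<And>z. poly p z * f z = poly p z * g z"
  shows "f z = g z"
proof (rule ccontr)
  assume ne: "f z \<noteq> g z"
  have c: "continuous_on UNIV (\<lambda>z. f z - g z)"
    using assms by (intro continuous_intros holomorphic_on_imp_continuous_on)
  have "open ((\<lambda>z. f z - g z) -` (- {0}))" using c by (intro open_vimage) auto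
  moreover have "z \<in> (\<lambda>z. f z - g z) -` (- {0})" using ne by simp
  ultimately obtain e where e: "e > 0" "ball z e \<subseteq> (\<lambda>z. f z - g z) -` (- {0})"
    using open_contains_ball by blast
  have "ball z e \<subseteq> {w. poly p w = 0}" using e(2) assms(4) by force
  hence "finite (ball z e)" using poly_roots_finite[OF assms(3)] finite_subset by blast
  thus False using uncountable_ball[OF e(1), of z] countable_finite by blast
qed

text \<open>The monic polynomial carrying the zeros of \<open>G\<close> in the disc of radius \<open>R\<close>; it inherits the
  symmetries of \<open>G\<close>, and so does the quotient.\<close>

lemma entire_factor_zeros:
  fixes G :: "complex \<Rightarrow> complex" and \<kappa> :: complex
  assumes holo: "G holomorphic_on UNIV" and nz: "G w0 \<noteq> 0" and R: "R \<ge> 0"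
    and par: "\<And>z. G (-z) = \<kappa> * G z" and re: "\<And>z. G (cnj z) = cnj (G z)"
  obtains p H where "p \<noteq> 0" "H holomorphic_on UNIV" "\<And>z. G z = poly (cpoly p) z * H z"
    "\<And>z. norm z \<le> R \<Longrightarrow> H z \<noteq> 0" "\<And>z. poly (cpoly p) z = 0 \<longleftrightarrow> G z = 0 \<and> norm z \<le> R"
    "\<And>z. H (-z) = H z" "\<And>z. H (cnj z) = cnj (H z)"
    "\<And>z. norm z \<ge> 2 * R \<Longrightarrow> norm (poly (cpoly p) z) \<ge> norm (poly (cpoly p) 0)"
    "\<And>z. norm z \<ge> R + 1 \<Longrightarrow> norm (poly (cpoly p) z) \<ge> 1"
proof -
  define Z where "Z = {z \<in> cball 0 R. G z = 0}"
  define m where "m = (\<lambda>\<rho>. nat (zorder G \<rho>))"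
  have fin: "finite Z"
  proof (cases "G constant_on UNIV")
    case True
    hence "Z = {}" using nz unfolding constant_on_def Z_def by (metis (mono_tags, lifting) UNIV_I empty_Collect_eq)
    thus ?thesis by simp
  next
    case False
    show ?thesis unfolding Z_def
      by (rule holomorphic_compact_finite_zeros[OF holo _ _ _ _ False]) auto
  qed
  obtain H where H: "H holomorphic_on UNIV" "\<And>\<rho>. \<rho> \<in> Z \<Longrightarrow> H \<rho> \<noteq> 0"
    "\<And>w. G w = poly (zero_poly G Z) w * H w" using zero_poly_factor[OF holo nz fin] by blast
  define P where "P = zero_poly G Z"
  have P: "poly P w = (\<Prod>\<rho>\<in>Z. (w - \<rho>) ^ m \<rho>)" for w unfolding P_def m_def by (rule poly_zero_poly)
  have P0: "P \<noteq> 0" using H(3)[of w0] nz unfolding P_def by auto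
  have kap: "\<kappa> \<noteq> 0" using par[of "-w0"] nz by auto
  have Hnz: "H z \<noteq> 0" if "norm z \<le> R" for z
  proof
    assume "H z = 0"
    hence "z \<in> Z" using that H(3)[of z] by (auto simp: Z_def)
    thus False using H(2) \<open>H z = 0\<close> by blast
  qed
  have Pcnj: "poly P (cnj w) = cnj (poly P w)" for w
  proof -
    have "poly P (cnj w) = (\<Prod>\<rho>\<in>Z. (cnj w - cnj \<rho>) ^ m (cnj \<rho>))" unfolding P
      by (rule prod.reindex_bij_witness[of _ cnj cnj]) (auto simp: Z_def re)
    also have "\<dots> = (\<Prod>\<rho>\<in>Z. cnj ((w - \<rho>) ^ m \<rho>))"
      using zorder_symmetries(1)[OF holo nz re] by (simp add: m_def)
    finally show ?thesis by (simp add: P)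
  qed
  then obtain p where p: "P = cpoly p" using real_poly_if_cnj by blast
  have Pneg: "poly P (-w) = (\<Prod>\<rho>\<in>Z. (-1) ^ m \<rho>) * poly P w" for w
  proof -
    have "poly P (-w) = (\<Prod>\<rho>\<in>Z. (- w - (-\<rho>)) ^ m (-\<rho>))" unfolding P
      by (rule prod.reindex_bij_witness[of _ uminus uminus]) (auto simp: Z_def par kap)
    also have "\<dots> = (\<Prod>\<rho>\<in>Z. (-1) ^ m \<rho> * (w - \<rho>) ^ m \<rho>)"
    proof (intro prod.cong refl)
      fix \<rho>
      have "(- w - (-\<rho>)) ^ m \<rho> = (-1) ^ m \<rho> * (w - \<rho>) ^ m \<rho>"
        by (metis minus_diff_commute minus_diff_eq diff_minus_eq_add power_minus uminus_add_conv_diff)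
      thus "(- w - (-\<rho>)) ^ m (-\<rho>) = (-1) ^ m \<rho> * (w - \<rho>) ^ m \<rho>"
        using zorder_symmetries(2)[OF holo nz par] by (simp add: m_def)
    qed
    finally show ?thesis by (simp add: P prod.distrib)
  qed
  define \<sigma> where "\<sigma> = (\<Prod>\<rho>\<in>Z. (-1::complex) ^ m \<rho>)"
  have sig: "\<sigma> * \<sigma> = 1" unfolding \<sigma>_def
    by (simp add: prod.distrib[symmetric] power_mult_distrib[symmetric])
  have hol': "(\<lambda>z. H (-z)) holomorphic_on UNIV"
    by (intro holomorphic_on_compose[OF _ holomorphic_on_subset[OF H(1)], unfolded o_def] holomorphic_intros) auto
  have Hneg: "H (-z) = (\<kappa> * \<sigma>) * H z" for z
  proof (rule entire_eqI_except_roots[OF hol' _ P0])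
    show "(\<lambda>a. \<kappa> * \<sigma> * H a) holomorphic_on UNIV" by (intro holomorphic_intros H(1))
    show "poly P z * H (- z) = poly P z * (\<kappa> * \<sigma> * H z)" for z
    proof -
      have "\<sigma> * poly P z * H (- z) = \<kappa> * (poly P z * H z)"
        using H(3)[of "-z"] H(3)[of z] par[of z] Pneg[of z] unfolding P_def[symmetric] \<sigma>_def by metis
      hence "\<sigma> * \<sigma> * poly P z * H (- z) = \<sigma> * \<kappa> * (poly P z * H z)" by (metis mult.assoc)
      thus ?thesis by (simp add: sig mult_ac)
    qed
  qed
  \<comment> \<open>The quotient is even or odd and does not vanish at 0, so it is even; the parity
    of \<open>G\<close> is carried entirely by the polynomial.\<close>
  have "\<kappa> * \<sigma> = 1" using Hneg[of 0] Hnz[of 0] R by simp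
  hence Heven: "H (-z) = H z" for z using Hneg[of z] by simp
  have Hre: "H (cnj z) = cnj (H z)" for z
  proof -
    have "(cnj \<circ> H \<circ> cnj) z = H z"
    proof (rule entire_eqI_except_roots[OF _ H(1) P0])
      show "(cnj \<circ> H \<circ> cnj) holomorphic_on UNIV"
        by (rule holomorphic_on_compose_cnj_cnj) (auto intro: holomorphic_on_subset[OF H(1)])
      show "poly P z * (cnj \<circ> H \<circ> cnj) z = poly P z * H z" for z
        using H(3)[of "cnj z"] H(3)[of z] re[of z] Pcnj[of z] unfolding P_def[symmetric]
        by simp (metis complex_cnj_cnj)
    qed
    thus ?thesis by (metis comp_apply complex_cnj_cnj)
  qed
  have roots: "poly P z = 0 \<longleftrightarrow> G z = 0 \<and> norm z \<le> R" for z
  proof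
    assume "poly P z = 0"
    hence "z \<in> Z" using fin by (auto simp: P)
    thus "G z = 0 \<and> norm z \<le> R" by (simp add: Z_def)
  next
    assume "G z = 0 \<and> norm z \<le> R"
    thus "poly P z = 0" using H(3)[of z] Hnz[of z] unfolding P_def[symmetric] by auto
  qed
  have big: "norm (poly P 0) \<le> norm (poly P z)" if z: "norm z \<ge> 2 * R" for z
    unfolding P prod_norm[symmetric] norm_power
  proof (intro prod_mono conjI power_mono)
    fix \<rho> assume "\<rho> \<in> Z"
    thus "norm (0 - \<rho>) \<le> norm (z - \<rho>)" using z norm_triangle_ineq2[of z \<rho>] by (simp add: Z_def)
  qed auto
  have big1: "1 \<le> norm (poly P z)" if z: "norm z \<ge> R + 1" for z
    unfolding P prod_norm[symmetric] norm_power
  proof (intro prod_ge_1 one_le_power)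
    fix \<rho> assume "\<rho> \<in> Z"
    thus "1 \<le> norm (z - \<rho>)" using z norm_triangle_ineq2[of z \<rho>] by (simp add: Z_def)
  qed
  show ?thesis
    by (rule that[of p H, folded p])
       (use P0 p H(1) H(3)[folded P_def] Hnz roots Heven Hre big big1 in \<open>auto simp: cpoly_eq_0_iff\<close>)
qed

text \<open>Borel--Caratheodory, improved by one order because \<open>K\<close> is even.\<close>

lemma even_log_bound:
  fixes K :: "complex \<Rightarrow> complex"
  assumes holo: "K holomorphic_on UNIV" and even: "\<And>z. K (-z) = K z" and K0: "K 0 = 1"
    and R: "R > 0" and A: "A > 0" and nz: "\<And>z. norm z < R \<Longrightarrow> K z \<noteq> 0"
    and bd: "\<And>z. norm z < R \<Longrightarrow> norm (K z) \<le> exp A"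
  obtains g where "g holomorphic_on ball 0 R" "\<And>z. norm z < R \<Longrightarrow> K z = exp (g z)"
    "\<And>z. norm z < R / 4 \<Longrightarrow> norm (g z) \<le> 128 * A / R\<^sup>2 * (norm z)\<^sup>2"
proof -
  have "K holomorphic_on ball 0 R" using holo by (rule holomorphic_on_subset) auto
  then obtain g0 where g0: "g0 holomorphic_on ball 0 R" "\<And>z. z \<in> ball 0 R \<Longrightarrow> exp (g0 z) = K z"
    using holomorphic_logarithm_exists[of "ball 0 R" K 0] nz R by (auto simp: convex_ball)
  define g where "g = (\<lambda>z. g0 z - g0 0)"
  have hg: "g holomorphic_on ball 0 R" unfolding g_def by (intro holomorphic_intros g0(1))
  have e0: "exp (g0 0) = 1" using g0(2)[of 0] K0 R by simp
  have Kg: "K z = exp (g z)" if "norm z < R" for z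
    using g0(2)[of z] that e0 by (simp add: g_def exp_diff)
  have g00: "g 0 = 0" by (simp add: g_def)
  have Re: "Re (g z) \<le> A" if "norm z < R" for z
    using bd[OF that] Kg[OF that] by simp
  have dK: "(K has_field_derivative deriv K 0) (at 0)"
    using holo by (auto intro!: holomorphic_derivI[of K UNIV])
  have dn: "((\<lambda>z. - z) has_field_derivative - 1) (at (0::complex))"
    by (auto intro!: derivative_eq_intros)
  have "((\<lambda>z. K (- z)) has_field_derivative deriv K 0 * - 1) (at 0)"
    by (rule DERIV_chain2[OF _ dn]) (simp only: minus_zero dK)
  moreover have "(\<lambda>z. K (- z)) = K" using even by (simp only:)
  ultimately have "(K has_field_derivative deriv K 0 * - 1) (at 0)" by (simp only:)
  from DERIV_unique[OF this dK] have "deriv K 0 * - 1 = deriv K 0" .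
  hence dK0: "deriv K 0 = 0" by (simp add: minus_equation_iff)
  have dg: "(g has_field_derivative deriv g z) (at z)" if "norm z < R" for z
    using hg that by (auto intro!: holomorphic_derivI[of g "ball 0 R"])
  have dg0: "deriv g 0 = 0"
  proof -
    have "((\<lambda>z. exp (g z)) has_field_derivative exp (g 0) * deriv g 0) (at 0)"
      using dg[of 0] R by (auto intro!: derivative_eq_intros)
    hence "(K has_field_derivative exp (g 0) * deriv g 0) (at 0)"
      by (rule has_field_derivative_transform_within_open[of _ _ _ "ball 0 R"]) (use R Kg in auto)
    thus ?thesis using dK dK0 DERIV_unique g00 by fastforce
  qed
  \<comment> \<open>The map g -> g / (4 A - g) sends the half plane Re g < 2 A into the unit disc.
    As Re g \<le> A, the Schwarz lemma applies; at half the radius it gives |g| \<le> (4 A + |g|) /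
    2, that is |g| \<le> 4 A.\<close>
  define \<psi> where "\<psi> = (\<lambda>z. g (of_real R * z) / (4 * of_real A - g (of_real R * z)))"
  have Rz: "norm (of_real R * z) < R" if "norm z < 1" for z :: complex
    using that R by (simp add: norm_mult)
  have den: "4 * of_real A - g z \<noteq> 0" "norm (g z) < norm (4 * of_real A - g z)" if z: "norm z < R" for z
  proof -
    have r: "Re (4 * of_real A - g z) > 0" using Re[OF z] A by simp
    show "4 * of_real A - g z \<noteq> 0"
    proof
      assume "4 * of_real A - g z = 0"
      thus False using r by simp
    qed
    have "(norm (4 * of_real A - g z))\<^sup>2 = (norm (g z))\<^sup>2 + 8 * A * (2 * A - Re (g z))"
      unfolding cmod_power2 by (simp add: power2_eq_square algebra_simps)
    moreover have "8 * A * (2 * A - Re (g z)) > 0" using A Re[OF z] by simp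
    ultimately show "norm (g z) < norm (4 * of_real A - g z)"
      by (intro power2_less_imp_less[of _ "norm (4 * of_real A - g z)"]) auto
  qed
  have h\<psi>: "\<psi> holomorphic_on ball 0 1"
  proof -
    have "(\<lambda>z. g (of_real R * z)) holomorphic_on ball 0 1"
      by (rule holomorphic_on_compose[of "\<lambda>z. of_real R * z" _ g, unfolded o_def])
         (use Rz in \<open>auto intro!: holomorphic_intros holomorphic_on_subset[OF hg]\<close>)
    thus ?thesis unfolding \<psi>_def using den(1) Rz by (intro holomorphic_intros) auto
  qed
  have b4: "norm (g z) \<le> 4 * A" if z: "norm z \<le> R / 2" for z
  proof -
    have zR: "norm z < R" using z R by simp
    have n: "norm (z / of_real R) \<le> 1/2" using z R by (simp add: norm_divide field_simps)
    have "norm (\<psi> (z / of_real R)) \<le> norm (z / of_real R)"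
    proof (rule Schwarz_Lemma(1)[OF h\<psi>])
      show "\<psi> 0 = 0" by (simp add: \<psi>_def g00)
      show "norm (\<psi> w) < 1" if "norm w < 1" for w
        using den[OF Rz[OF that]] by (simp add: \<psi>_def norm_divide)
    qed (use n in simp)
    hence "norm (\<psi> (z / of_real R)) \<le> 1/2" using n by linarith
    moreover have "\<psi> (z / of_real R) = g z / (4 * of_real A - g z)" using R by (simp add: \<psi>_def)
    ultimately have "norm (g z) \<le> 1/2 * norm (4 * of_real A - g z)"
      using den(1)[OF zR] by (simp add: norm_divide divide_le_eq)
    also have "norm (4 * of_real A - g z) \<le> 4 * A + norm (g z)"
      using norm_triangle_ineq4[of "4 * of_real A" "g z"] A by (simp add: norm_mult)
    finally show ?thesis by simp
  qed
  have "norm (g z) \<le> 128 * A / R\<^sup>2 * (norm z)\<^sup>2" if z: "norm z < R / 4" for z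
  proof -
    have "norm ((deriv ^^ 0) g z - (\<Sum>i\<le>1. (deriv ^^ i) g 0 * (z - 0) ^ i / fact i)) \<le>
        (128 * A / R\<^sup>2) * norm (z - 0) ^ Suc 1 / fact 1"
    proof (rule complex_Taylor[of "ball 0 (R/4)"])
      fix i :: nat and x :: complex assume x: "x \<in> ball 0 (R / 4)"
      have "(deriv ^^ i) g holomorphic_on ball 0 R" by (intro holomorphic_higher_deriv hg) auto
      hence "((deriv ^^ i) g has_field_derivative deriv ((deriv ^^ i) g) x) (at x)"
        using x R by (auto intro!: holomorphic_derivI[of _ "ball 0 R"])
      thus "((deriv ^^ i) g has_field_derivative (deriv ^^ Suc i) g x) (at x within ball 0 (R / 4))"
        using has_field_derivative_at_within by auto
    next
      fix x :: complex assume x: "x \<in> ball 0 (R / 4)"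
      have sub: "cball x (R/4) \<subseteq> ball 0 R"
      proof
        fix y assume "y \<in> cball x (R/4)"
        hence "norm (y - x) \<le> R / 4" by (simp add: dist_norm norm_minus_commute)
        thus "y \<in> ball 0 R" using x R norm_triangle_sub[of y x] by simp
      qed
      \<comment> \<open>Discs of radius R/4 around these points stay inside |y| \<le> R/2, where |g|
        \<le> 4 A; thus 2 * 4 A * 16 = 128 A. Since g and g' vanish at 0, Taylor's formula leaves
        only this second order term.\<close>
      have "norm ((deriv ^^ 2) g x) \<le> fact 2 * (4 * A) / (R/4) ^ 2"
      proof (rule Cauchy_inequality)
        show "g holomorphic_on ball x (R/4)"
          by (rule holomorphic_on_subset[OF hg]) (use sub ball_subset_cball in blast)
        show "continuous_on (cball x (R/4)) g"
          by (rule continuous_on_subset[OF holomorphic_on_imp_continuous_on[OF hg] sub])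
        fix y assume "norm (x - y) = R / 4"
        hence "norm y \<le> R / 2" using x norm_triangle_sub[of y x] by (simp add: norm_minus_commute)
        thus "norm (g y) \<le> 4 * A" by (rule b4)
      qed (use R in auto)
      also have "fact 2 * (4 * A) / (R/4) ^ 2 = 128 * A / R\<^sup>2" by (simp add: power2_eq_square)
      finally show "norm ((deriv ^^ Suc 1) g x) \<le> 128 * A / R\<^sup>2" by (simp add: numeral_2_eq_2)
    qed (use z R in auto)
    thus ?thesis by (simp add: g00 dg0 power2_eq_square)
  qed
  thus ?thesis using that[of g] hg Kg by blast
qed

text \<open>Growth of order at most two and minimal type. The arbitrary \<epsilon> is what makes the
  quotient A / R^2 in the preceding estimate small for large R.\<close>

definition subgaussian :: "(complex \<Rightarrow> complex) \<Rightarrow> bool" where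
  "subgaussian G \<longleftrightarrow> (\<forall>\<epsilon>>0. \<exists>C. \<forall>z. norm (G z) \<le> C * exp (\<epsilon> * (norm z)\<^sup>2))"

text \<open>Order less than two is enough for an even function to be approximated by the polynomials of
  its zeros without exponential factors.\<close>

lemma even_entire_approx:
  fixes G :: "complex \<Rightarrow> complex"
  assumes holo: "G holomorphic_on UNIV" and G0: "G 0 \<noteq> 0" and growth: "subgaussian G"
    and even: "\<And>z. G (-z) = G z" and re: "\<And>z. G (cnj z) = cnj (G z)"
    and \<eta>: "\<eta> > 0" and r: "r > 0"
  obtains p g where "p \<noteq> 0" "\<And>z. poly (cpoly p) z = 0 \<Longrightarrow> G z = 0"
    "g holomorphic_on ball 0 r" "\<And>z. norm z < r \<Longrightarrow> G z = poly (cpoly p) z * exp (g z)"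
    "\<And>z. norm z < r \<Longrightarrow> norm (g z) \<le> \<eta>"
proof -
  \<comment> \<open>The final bound 128 A r^2 / R^2 with A = ln C + 4 \<epsilon> R^2 splits into 128
    r^2 ln C / R^2 and 512 \<epsilon> r^2. This \<epsilon> makes the second term \<eta>/2, and the
    choice of \<open>R\<close> below makes the first at most \<eta>/2.\<close>
  define \<epsilon> where "\<epsilon> = \<eta> / (1024 * r\<^sup>2)"
  have \<epsilon>: "\<epsilon> > 0" using \<eta> r by (simp add: \<epsilon>_def)
  obtain C0 where C0: "\<And>z. norm (G z) \<le> C0 * exp (\<epsilon> * (norm z)\<^sup>2)"
    using growth \<epsilon> unfolding subgaussian_def by blast
  define C where "C = max (C0 / norm (G 0)) (exp 1)"
  have C: "C > 0" "ln C > 0"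
  proof -
    have "exp 1 \<le> C" by (simp add: C_def)
    thus "C > 0" by (smt (verit) exp_gt_zero)
    thus "ln C > 0" using \<open>exp 1 \<le> C\<close> by (smt (verit) ln_exp ln_le_cancel_iff exp_gt_zero)
  qed
  have CG: "norm (G z) / norm (G 0) \<le> C * exp (\<epsilon> * (norm z)\<^sup>2)" for z
  proof -
    have "norm (G z) / norm (G 0) \<le> (C0 * exp (\<epsilon> * (norm z)\<^sup>2)) / norm (G 0)"
      using C0[of z] G0 by (intro divide_right_mono) auto
    also have "\<dots> = (C0 / norm (G 0)) * exp (\<epsilon> * (norm z)\<^sup>2)" by simp
    also have "\<dots> \<le> C * exp (\<epsilon> * (norm z)\<^sup>2)" by (intro mult_right_mono) (auto simp: C_def)
    finally show ?thesis .
  qed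
  define R where "R = max (4 * r) (sqrt (256 * r\<^sup>2 * ln C / \<eta>))"
  have R: "R \<ge> 4 * r" "R > 0" using r by (auto simp: R_def)
  have "sqrt (256 * r\<^sup>2 * ln C / \<eta>) \<le> R" by (simp add: R_def)
  hence "256 * r\<^sup>2 * ln C / \<eta> \<le> R\<^sup>2" by (metis real_sqrt_le_iff real_sqrt_pow2_iff real_sqrt_unique R(2) less_imp_le real_sqrt_power real_sqrt_abs2 power2_eq_square abs_of_pos)
  hence R2: "256 * r\<^sup>2 * ln C \<le> \<eta> * R\<^sup>2" using \<eta> by (simp add: field_simps)
  have even1: "G (-z) = 1 * G z" for z using even by simp
  obtain p0 H where H: "p0 \<noteq> 0" "H holomorphic_on UNIV" "\<And>z. G z = poly (cpoly p0) z * H z"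
    "\<And>z. norm z \<le> R \<Longrightarrow> H z \<noteq> 0" "\<And>z. poly (cpoly p0) z = 0 \<longleftrightarrow> G z = 0 \<and> norm z \<le> R"
    "\<And>z. H (-z) = H z" "\<And>z. H (cnj z) = cnj (H z)"
    "\<And>z. norm z \<ge> 2 * R \<Longrightarrow> norm (poly (cpoly p0) z) \<ge> norm (poly (cpoly p0) 0)"
    by (rule entire_factor_zeros[OF holo G0 less_imp_le[OF R(2)] even1 re]) blast
  have H0: "H 0 \<noteq> 0" using H(4) R by simp
  define K where "K = (\<lambda>z. H z / H 0)"
  define A where "A = ln C + 4 * \<epsilon> * R\<^sup>2"
  have A: "A > 0" unfolding A_def using C \<epsilon> by (intro add_pos_nonneg) auto
  have hK: "K holomorphic_on S" for S
    unfolding K_def using H0 H(2) holomorphic_on_subset by (intro holomorphic_intros) auto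
  have Kbd: "norm (K z) \<le> exp A" if z: "norm z < R" for z
  \<comment> \<open>The estimate is made on the circle of radius 2 R, where the polynomial factor is
    at least as large as at 0, and carried inside by the maximum principle.\<close>
  proof (rule maximum_modulus_frontier[of K "ball 0 (2 * R)"])
    show "continuous_on (closure (ball 0 (2 * R))) K" by (rule holomorphic_on_imp_continuous_on[OF hK])
    fix w :: complex assume "w \<in> frontier (ball 0 (2 * R))"
    hence w: "norm w = 2 * R" using R by simp
    have p00: "poly (cpoly p0) 0 \<noteq> 0" using H(3)[of 0] G0 by auto
    have pw: "norm (poly (cpoly p0) w) \<ge> norm (poly (cpoly p0) 0)" using H(8) w by simp
    have "norm (K w) = (norm (G w) / norm (poly (cpoly p0) w)) * (norm (poly (cpoly p0) 0) / norm (G 0))"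
      using H(3)[of w] H(3)[of 0] p00 pw by (auto simp: K_def norm_mult norm_divide)
    also have "\<dots> \<le> (norm (G w) / norm (poly (cpoly p0) 0)) * (norm (poly (cpoly p0) 0) / norm (G 0))"
      using pw p00 by (intro mult_right_mono divide_left_mono mult_pos_pos) auto
    also have "\<dots> = norm (G w) / norm (G 0)" using p00 by simp
    also have "\<dots> \<le> C * exp (\<epsilon> * (norm w)\<^sup>2)" by (rule CG)
    also have "\<dots> = exp A" using C by (simp add: A_def exp_add w power_mult_distrib mult_ac)
    finally show "norm (K w) \<le> exp A" .
  qed (use hK z R in auto)
  obtain g where g: "g holomorphic_on ball 0 R" "\<And>z. norm z < R \<Longrightarrow> K z = exp (g z)"
    "\<And>z. norm z < R / 4 \<Longrightarrow> norm (g z) \<le> 128 * A / R\<^sup>2 * (norm z)\<^sup>2"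
    by (rule even_log_bound[of K R A]) (use hK R A Kbd H0 H(4,6) in \<open>auto simp: K_def\<close>)
  have "cnj (H 0) = H 0" using H(7)[of 0] by simp
  hence h0: "of_real (Re (H 0)) = H 0" by (simp add: complex_eq_iff)
  define p where "p = smult (Re (H 0)) p0"
  have rH0: "Re (H 0) \<noteq> 0" using h0 H0 by (metis of_real_0)
  show ?thesis
  proof (rule that[of p g])
    show "p \<noteq> 0" using H(1) rH0 by (simp add: p_def)
    show "G z = 0" if "poly (cpoly p) z = 0" for z
      using that H(5)[of z] H0 by (simp add: p_def cpoly_smult h0)
    show "g holomorphic_on ball 0 r" using R r by (intro holomorphic_on_subset[OF g(1)]) auto
    fix z :: complex assume z: "norm z < r"
    have "K z = exp (g z)" using g(2)[of z] z R r by auto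
    thus "G z = poly (cpoly p) z * exp (g z)"
      using H(3)[of z] H0 by (simp add: p_def cpoly_smult h0 K_def field_simps)
    have "norm (g z) \<le> 128 * A / R\<^sup>2 * (norm z)\<^sup>2" using g(3)[of z] z R by simp
    also have "\<dots> \<le> 128 * A / R\<^sup>2 * r\<^sup>2" using A z r by (intro mult_left_mono power_mono) auto
    also have "\<dots> = (256 * r\<^sup>2 * ln C) / (2 * R\<^sup>2) + 512 * \<epsilon> * r\<^sup>2"
      using R(2) by (simp add: A_def field_simps)
    also have "512 * \<epsilon> * r\<^sup>2 = \<eta> / 2" using r by (simp add: \<epsilon>_def)
    also have "(256 * r\<^sup>2 * ln C) / (2 * R\<^sup>2) \<le> (\<eta> * R\<^sup>2) / (2 * R\<^sup>2)"
      using R2 by (intro divide_right_mono) auto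
    also have "(\<eta> * R\<^sup>2) / (2 * R\<^sup>2) = \<eta> / 2" using R(2) by simp
    finally show "norm (g z) \<le> \<eta>" by simp
  qed
qed

text \<open>\<kappa> is the parity. The last clause says that \<open>G\<close> is no polynomial, in
  a form that passes to derivatives.\<close>

definition strip_entire :: "real \<Rightarrow> (complex \<Rightarrow> complex) \<Rightarrow> bool" where
  "strip_entire \<kappa> G \<longleftrightarrow> G holomorphic_on UNIV \<and> (\<kappa> = 1 \<or> \<kappa> = -1) \<and>
     (\<forall>z. G (-z) = of_real \<kappa> * G z) \<and> (\<forall>z. G (cnj z) = cnj (G z)) \<and>
     (\<forall>z. G z = 0 \<longrightarrow> \<bar>Im z\<bar> \<le> 1/2) \<and> subgaussian G \<and> (\<forall>d. \<exists>z. (deriv ^^ d) G z \<noteq> 0)"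

lemma subgaussian_quotient:
  fixes G H p :: "complex \<Rightarrow> complex"
  assumes "subgaussian G" "H holomorphic_on UNIV" "\<And>z. G z = p z * H z" "\<And>z. norm z \<ge> B \<Longrightarrow> norm (p z) \<ge> 1"
  shows "subgaussian H"
  unfolding subgaussian_def
proof (intro allI impI)
  fix \<epsilon> :: real assume \<epsilon>: "\<epsilon> > 0"
  then obtain C where C: "\<And>z. norm (G z) \<le> C * exp (\<epsilon> * (norm z)\<^sup>2)"
    using assms(1) unfolding subgaussian_def by metis
  have "compact (H ` cball 0 B)"
    by (intro compact_continuous_image continuous_on_subset[OF holomorphic_on_imp_continuous_on[OF assms(2)]]) auto
  hence "bounded (H ` cball 0 B)" by (rule compact_imp_bounded)
  then obtain D where "\<forall>y\<in>H ` cball 0 B. norm y \<le> D" unfolding bounded_iff ..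
  hence D: "\<And>z. z \<in> cball 0 B \<Longrightarrow> norm (H z) \<le> D" by simp
  have "norm (H z) \<le> (\<bar>C\<bar> + \<bar>D\<bar>) * exp (\<epsilon> * (norm z)\<^sup>2)" for z
  proof (cases "norm z \<le> B")
    case True
    have "norm (H z) \<le> (\<bar>C\<bar> + \<bar>D\<bar>) * 1" using D[of z] True by simp
    also have "\<dots> \<le> (\<bar>C\<bar> + \<bar>D\<bar>) * exp (\<epsilon> * (norm z)\<^sup>2)" using \<epsilon> by (intro mult_left_mono) auto
    finally show ?thesis .
  next
    case False
    have "1 \<le> norm (p z)" using assms(4)[of z] False by linarith
    hence "norm (H z) \<le> norm (p z) * norm (H z)" using mult_right_mono[of 1 "norm (p z)" "norm (H z)"] by simp
    also have "\<dots> = norm (G z)" unfolding assms(3) by (rule norm_mult[symmetric])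
    also have "\<dots> \<le> C * exp (\<epsilon> * (norm z)\<^sup>2)" by (rule C)
    also have "\<dots> \<le> (\<bar>C\<bar> + \<bar>D\<bar>) * exp (\<epsilon> * (norm z)\<^sup>2)" by (intro mult_right_mono) auto
    finally show ?thesis .
  qed
  thus "\<exists>C. \<forall>z. norm (H z) \<le> C * exp (\<epsilon> * (norm z)\<^sup>2)" by blast
qed

lemma strip_entire_factor:
  assumes "strip_entire \<kappa> G" and R: "R \<ge> 0"
  obtains p H where "strip_poly p" "H holomorphic_on UNIV" "\<And>z. G z = poly (cpoly p) z * H z"
    "\<And>z. norm z \<le> R \<Longrightarrow> H z \<noteq> 0" "\<And>z. poly (cpoly p) z = 0 \<longleftrightarrow> G z = 0 \<and> norm z \<le> R"
    "\<And>z. H (-z) = H z" "\<And>z. H (cnj z) = cnj (H z)" "subgaussian H"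
proof -
  note G = assms(1)[unfolded strip_entire_def]
  have hol: "G holomorphic_on UNIV" and par: "\<And>z. G (-z) = of_real \<kappa> * G z"
    and re: "\<And>z. G (cnj z) = cnj (G z)" using G by auto
  have "\<exists>z. (deriv ^^ 0) G z \<noteq> 0" using G by blast
  then obtain w0 where w0: "G w0 \<noteq> 0" by auto
  obtain p H where H: "p \<noteq> 0" "H holomorphic_on UNIV" "\<And>z. G z = poly (cpoly p) z * H z"
    "\<And>z. norm z \<le> R \<Longrightarrow> H z \<noteq> 0" "\<And>z. poly (cpoly p) z = 0 \<longleftrightarrow> G z = 0 \<and> norm z \<le> R"
    "\<And>z. H (-z) = H z" "\<And>z. H (cnj z) = cnj (H z)"
    "\<And>z. norm z \<ge> R + 1 \<Longrightarrow> norm (poly (cpoly p) z) \<ge> 1"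
    by (rule entire_factor_zeros[OF hol w0 R par re]) blast
  have "strip_poly p" using G H(1,5) by (auto simp: strip_poly_def)
  moreover have "subgaussian H" using subgaussian_quotient[OF _ H(2,3,8)] G by blast
  ultimately show ?thesis using that H by blast
qed

lemma higher_pderiv_eq_0: "degree p < d \<Longrightarrow> (pderiv ^^ d) p = (0 :: complex poly)"
proof (induction d arbitrary: p)
  case (Suc d)
  show ?case
  proof (cases "degree p = 0")
    case True
    hence "pderiv p = 0" by (simp add: pderiv_eq_0_iff)
    thus ?thesis by (induction d) auto
  next
    case False
    hence "degree (pderiv p) < d" using Suc.prems by (simp add: degree_pderiv)
    thus ?thesis using Suc.IH by (simp add: funpow_swap1)
  qed
qed simp

lemma higher_deriv_poly: "(deriv ^^ d) (poly p) = poly ((pderiv ^^ d) (p :: complex poly))"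
proof (induction d)
  case (Suc d)
  have "deriv (poly q) = poly (pderiv q)" for q :: "complex poly"
    by (intro ext DERIV_imp_deriv poly_DERIV)
  thus ?case using Suc by simp
qed simp

text \<open>Splitting off finitely many zeros would leave an even zero-free function
  \<open>H\<close>. The polynomials approximating it have no zeros either, so they are constant, and
  H(z)/H(0) is exp(w) with arbitrarily small w. Then \<open>H\<close> is constant and
  \<open>G\<close> a polynomial.\<close>

lemma strip_entire_infinite_zeros:
  assumes "strip_entire \<kappa> G"
  shows "infinite {z. G z = 0}"
proof
  assume fin: "finite {z. G z = 0}"
  obtain B where B: "\<forall>z\<in>{z. G z = 0}. norm z \<le> B"
    using finite_imp_bounded[OF fin] unfolding bounded_iff by blast
  define R where "R = max B 0"
  have R: "R \<ge> 0" "norm z \<le> R" if "G z = 0" for z using B that by (auto simp: R_def)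
  have R0: "R \<ge> 0" by (simp add: R_def)
  obtain p H where H: "H holomorphic_on UNIV" "\<And>z. G z = poly (cpoly p) z * H z"
    "\<And>z. norm z \<le> R \<Longrightarrow> H z \<noteq> 0" "\<And>z. H (-z) = H z" "\<And>z. H (cnj z) = cnj (H z)" "subgaussian H"
    by (rule strip_entire_factor[OF assms R0]) blast
  have Hnz: "H z \<noteq> 0" for z using H(2)[of z] H(3)[of z] R(2)[of z] by auto
  have Hconst: "H z = H 0" for z
  proof -
    have "\<exists>w. norm w \<le> 2 * inverse (real (Suc n)) \<and> H z / H 0 = exp w" for n
    proof -
      have r: "norm z + 1 > 0" by (simp add: add_nonneg_pos)
      obtain q g where q: "q \<noteq> 0" "\<And>z. poly (cpoly q) z = 0 \<Longrightarrow> H z = 0"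
        "\<And>u. norm u < norm z + 1 \<Longrightarrow> H u = poly (cpoly q) u * exp (g u)"
        "\<And>u. norm u < norm z + 1 \<Longrightarrow> norm (g u) \<le> inverse (real (Suc n))"
        by (rule even_entire_approx[OF H(1) Hnz H(6) H(4) H(5) _ r, of "inverse (real (Suc n))"]) (simp, blast)
      have "constant (poly (cpoly q))" using q(2) Hnz fundamental_theorem_of_algebra by blast
      hence c: "poly (cpoly q) z = poly (cpoly q) 0" unfolding constant_def by blast
      have nz: "poly (cpoly q) 0 \<noteq> 0" using q(2) Hnz by blast
      have "H z / H 0 = exp (g z - g 0)" using q(3)[of z] q(3)[of 0] c r nz by (simp add: exp_diff)
      moreover have "norm (g z - g 0) \<le> 2 * inverse (real (Suc n))"
        using q(4)[of z] q(4)[of 0] r norm_triangle_ineq4[of "g z" "g 0"] by simp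
      ultimately show ?thesis by blast
    qed
    then obtain w where w: "\<And>n. norm (w n) \<le> 2 * inverse (real (Suc n))" "\<And>n. H z / H 0 = exp (w n)"
      by metis
    have "(\<lambda>n. 2 * inverse (real (Suc n))) \<longlonglongrightarrow> 2 * 0"
      by (intro tendsto_mult_left LIMSEQ_inverse_real_of_nat)
    hence "w \<longlonglongrightarrow> 0" by (intro Lim_null_comparison[of w "\<lambda>n. 2 * inverse (real (Suc n))"])
      (use w(1) in simp_all)
    hence "(\<lambda>n. exp (w n)) \<longlonglongrightarrow> exp 0" by (intro tendsto_exp)
    hence "(\<lambda>n::nat. H z / H 0) \<longlonglongrightarrow> 1" using w(2) by simp
    hence "H z / H 0 = 1" by (simp add: LIMSEQ_const_iff)
    thus ?thesis using Hnz[of 0] by simp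
  qed
  define P where "P = smult (H 0) (cpoly p)"
  have "G = poly P" using H(2) Hconst by (simp add: P_def fun_eq_iff)
  hence "(deriv ^^ Suc (degree P)) G = (\<lambda>_. 0)"
    using higher_pderiv_eq_0[of P "Suc (degree P)"] by (simp only: higher_deriv_poly) auto
  thus False using assms unfolding strip_entire_def by metis
qed

text \<open>\<open>q\<close> absorbs at least \<open>K\<close> zeros, the supply needed to convert
  orders of vanishing into alternations. The cofactor must not vanish on the imaginary axis, because
  values at the frequencies will be divided by it.\<close>

lemma strip_entire_decomposition:
  assumes "strip_entire \<kappa> G"
  obtains q G0 P where "strip_poly q" "degree q \<ge> K" "\<And>z. G z = poly (cpoly q) z * G0 z"
    "\<And>\<omega>. G0 (\<i> * of_real \<omega>) \<noteq> 0" "\<And>l. strip_poly (P l)"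
    "\<And>z. (\<lambda>l. poly (cpoly (P l)) z) \<longlonglongrightarrow> G0 z"
proof -
  obtain S where S: "finite S" "card S = K" "S \<subseteq> {z. G z = 0}"
    using infinite_arbitrarily_large[OF strip_entire_infinite_zeros[OF assms]] by blast
  obtain R0 where R0: "\<forall>z\<in>S. norm z \<le> R0"
    using finite_imp_bounded[OF S(1)] unfolding bounded_iff by blast
  \<comment> \<open>A zero on the imaginary axis has modulus at most 1/2 by the strip condition, so
    any radius \<ge> 1 puts it into \<open>q\<close>.\<close>
  define R where "R = max R0 1"
  have R: "R \<ge> 1" "\<And>z. z \<in> S \<Longrightarrow> norm z \<le> R" using R0 by (force simp: R_def)+
  obtain q H where H: "strip_poly q" "H holomorphic_on UNIV" "\<And>z. G z = poly (cpoly q) z * H z"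
    "\<And>z. norm z \<le> R \<Longrightarrow> H z \<noteq> 0" "\<And>z. poly (cpoly q) z = 0 \<longleftrightarrow> G z = 0 \<and> norm z \<le> R"
    "\<And>z. H (-z) = H z" "\<And>z. H (cnj z) = cnj (H z)" "subgaussian H"
    by (rule strip_entire_factor[OF assms order.trans[OF zero_le_one R(1)]]) blast
  have strip: "\<bar>Im z\<bar> \<le> 1/2" if "H z = 0" for z
    using assms that H(3)[of z] unfolding strip_entire_def by auto
  have H0: "H 0 \<noteq> 0" using H(4) R(1) by simp
  have "card S \<le> degree q"
  proof -
    have q0: "cpoly q \<noteq> 0" using H(1) by (simp add: strip_poly_def cpoly_eq_0_iff)
    have "card S \<le> card {z. poly (cpoly q) z = 0}"
      using S R(2) H(5) poly_roots_finite[OF q0] by (intro card_mono) auto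
    also have "\<dots> \<le> degree (cpoly q)" by (rule card_poly_roots_bound[OF q0])
    finally show ?thesis by (simp add: degree_cpoly)
  qed
  define Q where "Q = (\<lambda>(l::nat) (p::real poly) (g::complex \<Rightarrow> complex). p \<noteq> 0 \<and> (\<forall>z. poly (cpoly p) z = 0 \<longrightarrow> H z = 0) \<and>
      (\<forall>z::complex. norm z < real (Suc l) \<longrightarrow> H z = poly (cpoly p) z * exp (g z)) \<and>
      (\<forall>z::complex. norm z < real (Suc l) \<longrightarrow> norm (g z) \<le> inverse (real (Suc l))))"
  have "\<exists>p g. Q l p g" for l
  proof -
    obtain p g where "p \<noteq> 0" "\<And>z. poly (cpoly p) z = 0 \<Longrightarrow> H z = 0"
      "\<And>z. norm z < real (Suc l) \<Longrightarrow> H z = poly (cpoly p) z * exp (g z)"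
      "\<And>z. norm z < real (Suc l) \<Longrightarrow> norm (g z) \<le> inverse (real (Suc l))"
      by (rule even_entire_approx[OF H(2) H0 H(8) H(6) H(7), of "inverse (real (Suc l))" "real (Suc l)"])
         (simp, simp, blast)
    thus ?thesis unfolding Q_def by blast
  qed
  then obtain P and g :: "nat \<Rightarrow> complex \<Rightarrow> complex" where "\<And>l. Q l (P l) (g l)" by metis
  hence P: "\<And>l. P l \<noteq> 0" "\<And>l z. poly (cpoly (P l)) z = 0 \<Longrightarrow> H z = 0"
    "\<And>l (z::complex). norm z < real (Suc l) \<Longrightarrow> H z = poly (cpoly (P l)) z * exp (g l z)"
    "\<And>l (z::complex). norm z < real (Suc l) \<Longrightarrow> norm (g l z) \<le> inverse (real (Suc l))"
    unfolding Q_def by blast+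
  show ?thesis
  proof (rule that[of q H P])
    show "H (\<i> * of_real \<omega>) \<noteq> 0" for \<omega>
    proof
      assume z: "H (\<i> * of_real \<omega>) = 0"
      hence "\<bar>\<omega>\<bar> \<le> 1/2" using strip by force
      thus False using H(4)[of "\<i> * of_real \<omega>"] z R(1) by (simp add: norm_mult)
    qed
    show "strip_poly (P l)" for l using P(1,2) strip unfolding strip_poly_def by blast
    fix z :: complex
    obtain L where L: "norm z < real (Suc L)" by (meson less_trans lessI of_nat_less_iff reals_Archimedean2)
    have ev: "\<forall>\<^sub>F l in sequentially. norm z < real (Suc l)"
      using eventually_ge_at_top[of L] by eventually_elim (use L in auto)
    have "(\<lambda>l. g l z) \<longlonglongrightarrow> 0"
      by (rule Lim_null_comparison[OF _ LIMSEQ_inverse_real_of_nat])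
         (use ev P(4) in \<open>auto elim: eventually_mono\<close>)
    hence "(\<lambda>l. H z * exp (- g l z)) \<longlonglongrightarrow> H z * exp (- 0)" by (intro tendsto_intros)
    moreover have "\<forall>\<^sub>F l in sequentially. H z * exp (- g l z) = poly (cpoly (P l)) z"
      using ev by eventually_elim (use P(3) in \<open>simp add: exp_minus\<close>)
    ultimately show "(\<lambda>l. poly (cpoly (P l)) z) \<longlonglongrightarrow> H z" by (simp add: filterlim_cong)
  qed (use H S \<open>card S \<le> degree q\<close> in auto)
qed

text \<open>Gauss--Lucas: p'/p is the sum of 1/(z - \<rho>) over the zeros, and each summand has
  negative imaginary part when z lies above \<rho>.\<close>

lemma Im_logderiv_poly:
  fixes p :: "complex poly"
  assumes "p \<noteq> 0" "\<And>w. poly p w = 0 \<Longrightarrow> Im w \<le> c" "Im z > c"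
  shows "Im (poly (pderiv p) z / poly p z) \<le> 0 \<and> (degree p > 0 \<longrightarrow> Im (poly (pderiv p) z / poly p z) < 0)"
  using assms(1,2)
proof (induction "degree p" arbitrary: p rule: less_induct)
  case less
  show ?case
  proof (cases "degree p = 0")
    case True
    hence "pderiv p = 0" by (simp add: pderiv_eq_0_iff)
    thus ?thesis using True by simp
  next
    case False
    hence "\<not> constant (poly p)" by (simp add: constant_degree)
    then obtain \<rho> where \<rho>: "poly p \<rho> = 0" using fundamental_theorem_of_algebra by blast
    then obtain q where q: "p = [:-\<rho>, 1:] * q" using poly_eq_0_iff_dvd by blast
    have q0: "q \<noteq> 0" using less.prems q by auto
    have "degree p = 1 + degree q" using q q0 by (simp add: degree_mult_eq del: mult_pCons_left)
    hence IH: "Im (poly (pderiv q) z / poly q z) \<le> 0"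
      using less.hyps[of q] q0 less.prems(2) q by auto
    have qz: "poly q z \<noteq> 0" using less.prems(2)[of z] q assms(3) by auto
    have zr: "Im (z - \<rho>) > 0" using less.prems(2)[OF \<rho>] assms(3) by simp
    hence zr0: "z - \<rho> \<noteq> 0" by auto
    have "poly (pderiv p) z = poly q z + (z - \<rho>) * poly (pderiv q) z"
      unfolding q pderiv_mult by (simp add: pderiv_pCons del: mult_pCons_left)
    hence "poly (pderiv p) z / poly p z = inverse (z - \<rho>) + poly (pderiv q) z / poly q z"
      using qz zr0 by (simp add: q field_simps)
    moreover have "Im (inverse (z - \<rho>)) < 0"
      using zr zr0 by (simp add: divide_less_0_iff sum_power2_gt_zero_iff complex_eq_iff)
    ultimately show ?thesis using IH by simp
  qed
qed

text \<open>Cauchy's estimate on the unit circle around z, where |x|^2 \<le> 2 |z|^2 + 2; this is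
  why \<open>G\<close> is bounded with \<epsilon>/2.\<close>

lemma subgaussian_deriv:
  assumes holo: "G holomorphic_on UNIV" and "subgaussian G"
  shows "subgaussian (deriv G)"
  unfolding subgaussian_def
proof (intro allI impI)
  fix \<epsilon> :: real assume \<epsilon>: "\<epsilon> > 0"
  hence "\<epsilon> / 2 > 0" by simp
  then obtain C where C: "\<And>z. norm (G z) \<le> C * exp (\<epsilon> / 2 * (norm z)\<^sup>2)"
    using assms(2) unfolding subgaussian_def by metis
  have "C * exp (\<epsilon> / 2 * (norm (0::complex))\<^sup>2) \<ge> 0" by (rule order.trans[OF norm_ge_zero C])
  hence C0: "C \<ge> 0" by simp
  have "norm (deriv G z) \<le> (C * exp \<epsilon>) * exp (\<epsilon> * (norm z)\<^sup>2)" for z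
  proof -
    have "norm ((deriv ^^ 1) G z) \<le> fact 1 * (C * exp \<epsilon> * exp (\<epsilon> * (norm z)\<^sup>2)) / 1 ^ 1"
    proof (rule Cauchy_inequality)
      show "G holomorphic_on ball z 1" using holo holomorphic_on_subset by blast
      show "continuous_on (cball z 1) G"
        using holomorphic_on_imp_continuous_on[OF holo] continuous_on_subset by blast
      fix x assume x: "norm (z - x) = 1"
      have "norm x \<le> norm z + 1" using norm_triangle_sub[of x z] x by (simp add: norm_minus_commute)
      hence "(norm x)\<^sup>2 \<le> (norm z + 1)\<^sup>2" by (intro power_mono) auto
      also have "\<dots> \<le> 2 * (norm z)\<^sup>2 + 2"
        using zero_le_power2[of "norm z - 1"] by (simp add: power2_eq_square algebra_simps)
      finally have "\<epsilon> / 2 * (norm x)\<^sup>2 \<le> \<epsilon> / 2 * (2 * (norm z)\<^sup>2 + 2)"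
        using \<epsilon> by (intro mult_left_mono) auto
      hence "exp (\<epsilon> / 2 * (norm x)\<^sup>2) \<le> exp \<epsilon> * exp (\<epsilon> * (norm z)\<^sup>2)"
        by (simp add: exp_add[symmetric] algebra_simps)
      hence "C * exp (\<epsilon> / 2 * (norm x)\<^sup>2) \<le> C * (exp \<epsilon> * exp (\<epsilon> * (norm z)\<^sup>2))"
        using C0 by (rule mult_left_mono)
      thus "norm (G x) \<le> C * exp \<epsilon> * exp (\<epsilon> * (norm z)\<^sup>2)" using C[of x] by (simp add: mult.assoc)
    qed auto
    thus ?thesis by simp
  qed
  thus "\<exists>C. \<forall>z. norm (deriv G z) \<le> C * exp (\<epsilon> * (norm z)\<^sup>2)" by blast
qed

text \<open>A limit of polynomials would only give Im (G'/G) \<le> 0. To obtain a strict inequality,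
  a factor \<open>p\<close> with at least one zero is split off; it contributes a fixed negative
  amount \<open>a\<close>, and the rest is approximated so closely that its contribution cannot
  cancel \<open>a\<close>.\<close>

lemma strip_entire_deriv_nonzero:
  assumes G: "strip_entire \<kappa> G" and z: "Im z > 1/2"
  shows "deriv G z \<noteq> 0"
proof
  assume d0: "deriv G z = 0"
  have "{z. G z = 0} \<noteq> {}" using strip_entire_infinite_zeros[OF G] by (metis finite.emptyI)
  then obtain \<rho> where \<rho>: "G \<rho> = 0" by blast
  obtain p H where H: "strip_poly p" "H holomorphic_on UNIV" "\<And>z. G z = poly (cpoly p) z * H z"
    "\<And>z. norm z \<le> norm \<rho> \<Longrightarrow> H z \<noteq> 0"
    "\<And>z. poly (cpoly p) z = 0 \<longleftrightarrow> G z = 0 \<and> norm z \<le> norm \<rho>"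
    "\<And>z. H (-z) = H z" "\<And>z. H (cnj z) = cnj (H z)" "subgaussian H"
    by (rule strip_entire_factor[OF G norm_ge_zero[of \<rho>]]) blast
  have p0: "cpoly p \<noteq> 0" using H(1) by (simp add: strip_poly_def cpoly_eq_0_iff)
  have pz: "poly (cpoly p) z \<noteq> 0" using H(1) z unfolding strip_poly_def by force
  have Gz: "G z \<noteq> 0" using G z unfolding strip_entire_def by force
  hence Hz: "H z \<noteq> 0" using H(3) by auto
  have deg: "degree (cpoly p) > 0"
  proof (rule ccontr)
    assume "\<not> degree (cpoly p) > 0"
    then obtain c where c: "cpoly p = [:c:]" by (metis degree_eq_zeroE not_gr_zero)
    have "poly (cpoly p) \<rho> = 0" using H(5) \<rho> by simp
    thus False using c p0 by simp
  qed
  define a where "a = Im (poly (pderiv (cpoly p)) z / poly (cpoly p) z)"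
  have a: "a < 0" unfolding a_def
    using Im_logderiv_poly[OF p0, of "1/2" z] deg H(1) z unfolding strip_poly_def by force
  have dH: "(H has_field_derivative deriv H z) (at z)"
    using H(2) by (auto intro!: holomorphic_derivI[of H UNIV])
  have "((\<lambda>z. poly (cpoly p) z * H z) has_field_derivative
      (poly (pderiv (cpoly p)) z * H z + deriv H z * poly (cpoly p) z)) (at z)"
    by (rule DERIV_mult[OF poly_DERIV dH])
  moreover have "(\<lambda>z. poly (cpoly p) z * H z) = G" using H(3) by auto
  ultimately have "deriv G z = poly (pderiv (cpoly p)) z * H z + deriv H z * poly (cpoly p) z"
    using DERIV_imp_deriv by metis
  hence "deriv H z / H z = - (poly (pderiv (cpoly p)) z / poly (cpoly p) z)"
    using d0 pz Hz by (simp add: field_simps add_eq_0_iff)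
  hence b: "Im (deriv H z / H z) = - a" by (simp add: a_def)
  define r where "r = norm z + 1"
  have r: "r > 0" by (simp add: r_def add_nonneg_pos)
  have H0: "H 0 \<noteq> 0" using H(4)[of 0] by simp
  obtain q g where q: "q \<noteq> 0" "\<And>z. poly (cpoly q) z = 0 \<Longrightarrow> H z = 0" "g holomorphic_on ball 0 r"
    "\<And>z. norm z < r \<Longrightarrow> H z = poly (cpoly q) z * exp (g z)" "\<And>z. norm z < r \<Longrightarrow> norm (g z) \<le> - a / 4"
    \<comment> \<open>On the disc of radius 1/2 around z Cauchy's estimate turns |g| \<le> -a/4 into
      |g'| \<le> -a/2, which is smaller than the gap -a.\<close>
    by (rule even_entire_approx[OF H(2) H0 H(8) H(6) H(7) _ r, of "- a / 4"]) (use a in simp, blast)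
  have zr: "norm z < r" by (simp add: r_def)
  have dg: "(g has_field_derivative deriv g z) (at z)"
    using q(3) zr by (auto intro!: holomorphic_derivI[of g "ball 0 r"])
  have "((\<lambda>z. poly (cpoly q) z * exp (g z)) has_field_derivative
     (poly (pderiv (cpoly q)) z * exp (g z) + (exp (g z) * deriv g z) * poly (cpoly q) z)) (at z)"
    by (rule DERIV_mult[OF poly_DERIV DERIV_fun_exp[OF dg]])
  hence "(H has_field_derivative
     (poly (pderiv (cpoly q)) z * exp (g z) + (exp (g z) * deriv g z) * poly (cpoly q) z)) (at z)"
    by (rule has_field_derivative_transform_within_open[of _ _ _ "ball 0 r"]) (use zr q(4) in auto)
  hence "deriv H z = poly (pderiv (cpoly q)) z * exp (g z) + (exp (g z) * deriv g z) * poly (cpoly q) z"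
    by (rule DERIV_imp_deriv)
  moreover have qz: "poly (cpoly q) z \<noteq> 0" using q(2) Hz by blast
  ultimately have "deriv H z / H z = poly (pderiv (cpoly q)) z / poly (cpoly q) z + deriv g z"
    using q(4)[OF zr] by (simp add: field_simps)
  moreover have "Im (poly (pderiv (cpoly q)) z / poly (cpoly q) z) \<le> 0"
  proof -
    have "Im w \<le> 1/2" if "poly (cpoly q) w = 0" for w
      using G q(2)[OF that] H(3)[of w] unfolding strip_entire_def by force
    thus ?thesis using Im_logderiv_poly[of "cpoly q" "1/2" z] q(1) z by (simp add: cpoly_eq_0_iff)
  qed
  ultimately have "- a \<le> Im (deriv g z)" using b by simp
  also have "\<dots> \<le> norm (deriv g z)" using abs_Im_le_cmod[of "deriv g z"] by linarith
  also have "norm ((deriv ^^ 1) g z) \<le> fact 1 * (- a / 4) / (1/2) ^ 1"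
  proof (rule Cauchy_inequality)
    have sub: "cball z (1/2) \<subseteq> ball 0 r"
    proof
      fix y assume "y \<in> cball z (1/2)"
      thus "y \<in> ball 0 r" using norm_triangle_sub[of y z] by (simp add: r_def dist_norm norm_minus_commute)
    qed
    show "g holomorphic_on ball z (1/2)"
      by (rule holomorphic_on_subset[OF q(3)]) (use sub ball_subset_cball in blast)
    show "continuous_on (cball z (1/2)) g"
      by (rule continuous_on_subset[OF holomorphic_on_imp_continuous_on[OF q(3)] sub])
    fix y assume "norm (z - y) = 1/2"
    hence "y \<in> cball z (1/2)" by (simp add: dist_norm)
    thus "norm (g y) \<le> - a / 4" using sub q(5) by force
  qed auto
  hence "norm (deriv g z) \<le> - a / 2" by simp
  finally show False using a by simp
qed

lemma strip_entire_deriv: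
  assumes "strip_entire \<kappa> G"
  shows "strip_entire (- \<kappa>) (deriv G)"
proof -
  have holo: "G holomorphic_on UNIV" and par: "\<And>z. G (-z) = of_real \<kappa> * G z"
    and re: "\<And>z. G (cnj z) = cnj (G z)" and sg: "subgaussian G" and k: "\<kappa> = 1 \<or> \<kappa> = -1"
    and nz: "\<And>d. \<exists>z. (deriv ^^ d) G z \<noteq> 0"
    using assms unfolding strip_entire_def by blast+
  have dG: "(G has_field_derivative deriv G z) (at z)" for z
    using holo by (auto intro!: holomorphic_derivI[of G UNIV])
  have par': "deriv G (-z) = of_real (- \<kappa>) * deriv G z" for z
  proof -
    have dn: "((\<lambda>z. - z) has_field_derivative - 1) (at z)"
      by (auto intro!: derivative_eq_intros)
    have "((\<lambda>z. G (- z)) has_field_derivative deriv G (- z) * - 1) (at z)"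
      by (rule DERIV_chain2[OF dG dn])
    moreover have "(\<lambda>z. G (- z)) = (\<lambda>z. of_real \<kappa> * G z)" using par by (simp only:)
    ultimately have "((\<lambda>z. of_real \<kappa> * G z) has_field_derivative deriv G (- z) * - 1) (at z)" by (simp only:)
    from DERIV_unique[OF this DERIV_cmult[OF dG]] show ?thesis by simp (metis minus_minus)
  qed
  have re': "deriv G (cnj z) = cnj (deriv G z)" for z
  proof -
    have "((cnj \<circ> G \<circ> cnj) has_field_derivative cnj (deriv G z)) (at (cnj z))"
      using has_field_derivative_cnj_cnj[of G "deriv G z" "cnj z"] dG by simp
    moreover have "cnj \<circ> G \<circ> cnj = G" using re by (simp add: fun_eq_iff)
    ultimately show ?thesis using DERIV_imp_deriv by metis
  qed
  have "\<bar>Im z\<bar> \<le> 1/2" if z: "deriv G z = 0" for z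
  proof (rule ccontr)
    assume "\<not> \<bar>Im z\<bar> \<le> 1/2"
    hence "Im z > 1/2 \<or> Im (-z) > 1/2" by auto
    moreover have "deriv G (-z) = 0" using par' z by simp
    ultimately show False using strip_entire_deriv_nonzero[OF assms] z by blast
  qed
  moreover have "\<exists>z. (deriv ^^ d) (deriv G) z \<noteq> 0" for d
    using nz[of "Suc d"] by (simp add: funpow_swap1)
  moreover have "deriv G holomorphic_on UNIV" using holo by (intro holomorphic_deriv) auto
  moreover have "- \<kappa> = 1 \<or> - \<kappa> = -1" using k by auto
  ultimately show ?thesis
    unfolding strip_entire_def using par' re' subgaussian_deriv[OF holo sg] by blast
qed

lemma strip_entire_higher_deriv:
  assumes "strip_entire \<kappa> G"
  shows "strip_entire (\<kappa> * (-1) ^ m) ((deriv ^^ m) G)"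
  using assms by (induction m) (auto dest: strip_entire_deriv)

section \<open>Interlacing zeros\<close>

text \<open>\<open>d\<close> distinct real zeros exhaust the degree; a further complex zero or a
  multiple one would exceed it.\<close>

lemma simple_zeros_in_if_card:
  assumes p: "p \<noteq> 0" "degree p \<le> d" and X: "finite X" "card X \<ge> d" "X \<subseteq> S" "\<And>x. x \<in> X \<Longrightarrow> poly p x = 0"
  shows "simple_zeros_in S p" "degree p = d" "{x. poly p x = 0} \<subseteq> S"
proof -
  define P where "P = cpoly p"
  have P0: "P \<noteq> 0" and degP: "degree P \<le> d" using p by (auto simp: P_def cpoly_eq_0_iff degree_cpoly)
  have rootX: "poly P (of_real x) = 0" if "x \<in> X" for x using X(4)[OF that] by (simp add: P_def cpoly_of_real)
  have cardX: "card (complex_of_real ` X) = card X" by (intro card_image) (simp add: inj_on_def)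
  have bound: "card X \<le> card {z. poly Q z = 0}" if "Q \<noteq> 0" "\<And>x. x \<in> X \<Longrightarrow> poly Q (of_real x) = 0" for Q :: "complex poly"
    unfolding cardX[symmetric] using that poly_roots_finite[OF that(1)] by (intro card_mono) auto
  show "degree p = d"
    using bound[OF P0 rootX] card_poly_roots_bound[OF P0] X(2) degP by (simp add: P_def degree_cpoly)
  have mem: "w \<in> complex_of_real ` X" if w: "poly P w = 0" for w
  proof (rule ccontr)
    assume "w \<notin> complex_of_real ` X"
    hence "card (insert w (complex_of_real ` X)) = Suc (card X)" using X(1) cardX by simp
    moreover have "card (insert w (complex_of_real ` X)) \<le> card {z. poly P z = 0}"
      using w rootX poly_roots_finite[OF P0] by (intro card_mono) auto
    ultimately show False using card_poly_roots_bound[OF P0] degP X(2) by linarith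
  qed
  have "order w P = 1" if w: "poly P w = 0" for w
  proof (rule ccontr)
    assume "order w P \<noteq> 1"
    moreover have "order w P \<noteq> 0" using w P0 order_root by blast
    ultimately have "2 \<le> order w P" by linarith
    hence "[:-w, 1:] ^ 2 dvd P" using order_divides by blast
    then obtain r where r: "P = [:-w, 1:] ^ 2 * r" by blast
    hence r0: "r \<noteq> 0" using P0 by auto
    have deg: "degree P = 2 + degree r" unfolding r using r0
      by (subst degree_mult_eq) (auto simp: degree_power_eq)
    have "card X \<le> card (insert w {z. poly r z = 0})"
      unfolding cardX[symmetric] using rootX r poly_roots_finite[OF r0] by (intro card_mono) auto
    also have "\<dots> \<le> Suc (degree r)"
      using card_poly_roots_bound[OF r0] poly_roots_finite[OF r0] by (simp add: card_insert_if)
    finally show False using deg degP X(2) by linarith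
  qed
  thus "simple_zeros_in S p" using mem X(3) unfolding simple_zeros_in_def P_def by blast
  show "{x. poly p x = 0} \<subseteq> S"
  proof
    fix x assume "x \<in> {x. poly p x = 0}"
    hence "poly P (of_real x) = 0" by (simp add: P_def cpoly_of_real)
    hence "complex_of_real x \<in> complex_of_real ` X" by (rule mem)
    hence "x \<in> X" by auto
    thus "x \<in> S" using X(3) by blast
  qed
qed

text \<open>The Wronskian is the numerator of the derivative of p/q. If \<open>q\<close> had no zero
  on the interval, Rolle's theorem for p/q would produce a zero of it.\<close>

lemma no_two_zeros_between:
  fixes p q :: "real poly"
  assumes W: "\<And>x. x \<in> {u..v} \<Longrightarrow> poly (pderiv p) x * poly q x - poly p x * poly (pderiv q) x \<noteq> 0"
    and uv: "u < v" "poly p u = 0" "poly p v = 0"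
  shows "\<exists>x. u < x \<and> x < v \<and> poly q x = 0"
proof (rule ccontr)
  assume "\<not> ?thesis"
  moreover have "poly q u \<noteq> 0" "poly q v \<noteq> 0" using W[of u] W[of v] uv by auto
  ultimately have q: "poly q x \<noteq> 0" if "x \<in> {u..v}" for x
    using that by (cases "x = u"; cases "x = v") auto
  have D: "((\<lambda>x. poly p x / poly q x) has_real_derivative
      (poly (pderiv p) x * poly q x - poly p x * poly (pderiv q) x) / (poly q x * poly q x)) (at x)"
    if "x \<in> {u..v}" for x by (rule DERIV_divide[OF poly_DERIV poly_DERIV q[OF that]])
  have "\<exists>z. u < z \<and> z < v \<and> DERIV (\<lambda>x. poly p x / poly q x) z :> 0"
  proof (rule Rolle)
    show "continuous_on {u..v} (\<lambda>x. poly p x / poly q x)"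
      using q by (intro continuous_intros) auto
    show "(\<lambda>x. poly p x / poly q x) differentiable (at x)" if "u < x" "x < v" for x
      using D[of x] that real_differentiable_def by (metis atLeastAtMost_iff less_imp_le)
  qed (use uv in auto)
  then obtain z where z: "u < z" "z < v" "DERIV (\<lambda>x. poly p x / poly q x) z :> 0" by blast
  have "z \<in> {u..v}" using z by auto
  from DERIV_unique[OF D[OF this] z(3)] W[OF this] q[OF this] show False by simp
qed

text \<open>Neighbours in the sorted union cannot be zeros of the same polynomial, since a zero of
  the other one would lie strictly between them.\<close>

lemma strictly_interlace_sets_if_wronskian:
  fixes p q :: "real poly"
  assumes W: "\<And>x. x \<in> S \<Longrightarrow> poly (pderiv p) x * poly q x - poly p x * poly (pderiv q) x \<noteq> 0"
    and S: "\<And>u v. u \<in> S \<Longrightarrow> v \<in> S \<Longrightarrow> {u..v} \<subseteq> S"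
    and nz: "p \<noteq> 0" "q \<noteq> 0" and sub: "{x. poly p x = 0} \<subseteq> S" "{x. poly q x = 0} \<subseteq> S"
  shows "strictly_interlace_sets {x. poly p x = 0} {x. poly q x = 0}"
proof -
  define A where "A = {x. poly p x = 0}"
  define B where "B = {x. poly q x = 0}"
  have fin: "finite A" "finite B" using nz poly_roots_finite by (auto simp: A_def B_def)
  have disj: "A \<inter> B = {}" using W sub unfolding A_def B_def by force
  define xs where "xs = sorted_list_of_set (A \<union> B)"
  have set: "set xs = A \<union> B" using fin by (simp add: xs_def)
  have sorted: "sorted_wrt (<) xs" unfolding xs_def by (rule strict_sorted_list_of_set)
  have "xs ! i \<in> A \<longleftrightarrow> xs ! Suc i \<in> B" if i: "Suc i < length xs" for i
  proof -
    define u v where "u = xs ! i" and "v = xs ! Suc i"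
    have uv: "u < v" using sorted_wrt_nth_less[OF sorted, of i "Suc i"] i
      unfolding u_def v_def by simp
    have mem: "u \<in> A \<union> B" "v \<in> A \<union> B" using i set unfolding u_def v_def by (metis Suc_lessD nth_mem)+
    have none: "\<not> (u < x \<and> x < v)" if x: "x \<in> A \<union> B" for x
    proof
      assume *: "u < x \<and> x < v"
      obtain j where j: "j < length xs" "xs ! j = x" using x set by (metis in_set_conv_nth)
      have "i < j" using * j i sorted unfolding u_def by (metis linorder_neqE_nat order.asym less_irrefl sorted_wrt_nth_less Suc_lessD)
      moreover have "j < Suc i" using * j i sorted unfolding v_def by (metis linorder_neqE_nat order.asym less_irrefl sorted_wrt_nth_less)
      ultimately show False by simp
    qed
    have sS: "{u..v} \<subseteq> S" using S mem sub unfolding A_def B_def by blast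
    have "\<not> (u \<in> A \<and> v \<in> A)"
      using no_two_zeros_between[of u v p q] W sS uv none unfolding A_def B_def by blast
    moreover have "\<not> (u \<in> B \<and> v \<in> B)"
    proof
      assume "u \<in> B \<and> v \<in> B"
      hence "\<exists>x. u < x \<and> x < v \<and> poly p x = 0"
        using W sS uv by (intro no_two_zeros_between) (auto simp: B_def mult.commute, metis (no_types, lifting) subsetD atLeastAtMost_iff mult.commute)
      thus False using none unfolding A_def by blast
    qed
    ultimately show ?thesis using mem disj unfolding u_def v_def by blast
  qed
  thus ?thesis using fin disj unfolding strictly_interlace_sets_def A_def B_def xs_def Let_def by blast
qed

text \<open>A combination with a double zero at x has the form (y - x)^2 r(y), and the perturbation
  is taken in the direction of \<open>r\<close> itself: ((y - x)^2 + \<eta>) r(y) has only the zeros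
  of \<open>r\<close>, at most n - 1, against the \<open>n\<close> guaranteed by
  \<open>stable\<close>.\<close>

lemma wronskian_nonzero:
  fixes A B :: "real poly"
  assumes stable: "\<And>a b r. (a, b) \<noteq> (0, 0) \<Longrightarrow> degree r \<le> Suc n \<Longrightarrow>
      \<exists>\<eta>>0. card {x. x \<in> {-2<..<2} \<and> poly (smult a B + smult b A + smult \<eta> r) x = 0} \<ge> n"
    and nz: "\<And>a b. (a, b) \<noteq> (0, 0) \<Longrightarrow> smult a B + smult b A \<noteq> 0"
    and deg: "degree A \<le> Suc n" "degree B \<le> Suc n" and n: "n \<ge> 1"
  shows "poly (pderiv A) x * poly B x - poly A x * poly (pderiv B) x \<noteq> 0"
proof
  assume W: "poly (pderiv A) x * poly B x - poly A x * poly (pderiv B) x = 0"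
  \<comment> \<open>A nontrivial kernel vector of the singular matrix with rows (B, A) and (B', A')
    at x, read off from whichever row is nonzero.\<close>
  have "\<exists>a b. (a, b) \<noteq> (0, 0) \<and> a * poly B x + b * poly A x = 0 \<and> a * poly (pderiv B) x + b * poly (pderiv A) x = 0"
  proof (cases "poly B x = 0 \<and> poly A x = 0")
    case True
    show ?thesis
    proof (cases "poly (pderiv A) x = 0 \<and> poly (pderiv B) x = 0")
      case False
      thus ?thesis using True
        by (intro exI[of _ "poly (pderiv A) x"] exI[of _ "- poly (pderiv B) x"]) auto
    qed (use True in \<open>auto intro: exI[of _ 1]\<close>)
  next
    case False
    thus ?thesis using W by (intro exI[of _ "poly A x"] exI[of _ "- poly B x"]) (auto simp: mult.commute)
  qed
  then obtain a b where ab: "(a, b) \<noteq> (0, 0)" "a * poly B x + b * poly A x = 0"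
    "a * poly (pderiv B) x + b * poly (pderiv A) x = 0" by blast
  define p where "p = smult a B + smult b A"
  have p0: "p \<noteq> 0" unfolding p_def by (rule nz[OF ab(1)])
  have "poly p x = 0" using ab by (simp add: p_def)
  then obtain q where q: "p = [:-x, 1:] * q" using poly_eq_0_iff_dvd by blast
  have "poly (pderiv p) x = 0" using ab by (simp add: p_def pderiv_add pderiv_smult)
  hence "poly q x = 0" unfolding q pderiv_mult by (simp add: pderiv_pCons del: mult_pCons_left)
  then obtain r where r: "q = [:-x, 1:] * r" using poly_eq_0_iff_dvd by blast
  have r0: "r \<noteq> 0" using p0 q r by auto
  have "degree p = 2 + degree r" unfolding q r using r0 by (simp add: degree_mult_eq del: mult_pCons_left)
  moreover have "degree p \<le> Suc n" unfolding p_def using deg by (intro degree_add_le) (auto intro: order.trans[OF degree_smult_le])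
  ultimately have degr: "degree r + 1 \<le> n" by simp
  obtain \<eta> where \<eta>: "\<eta> > 0" "card {y. y \<in> {-2<..<2} \<and> poly (smult a B + smult b A + smult \<eta> r) y = 0} \<ge> n"
    using stable[OF ab(1), of r] degr by auto
  have "poly (p + smult \<eta> r) y = ((y - x)^2 + \<eta>) * poly r y" for y
    unfolding q r by (simp add: power2_eq_square algebra_simps)
  moreover have "(y - x)^2 + \<eta> \<noteq> 0" for y using \<eta>(1) zero_le_power2[of "y - x"] by linarith
  ultimately have "{y. y \<in> {-2<..<2} \<and> poly (smult a B + smult b A + smult \<eta> r) y = 0} \<subseteq> {y. poly r y = 0}"
    by (auto simp: p_def)
  hence "n \<le> card {y. poly r y = 0}" using \<eta>(2) poly_roots_finite[OF r0] card_mono order.trans by blast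
  also have "\<dots> \<le> degree r" by (rule card_poly_roots_bound[OF r0])
  finally show False using degr by simp
qed

text \<open>The window has 2 n + 1 zeros, its left end and one between any two neighbouring
  alternation points, and they are distinct on the unit circle. At most two of them are 1 or -1, the
  only points where \<open>b\<close> may vanish. The others project injectively from each open half
  circle to zeros of \<open>s\<close>, so 2 n + 1 \<le> 2 + 2 card X, that is n \<le> card
  X.\<close>

lemma card_zeros_if_cyc:
  fixes s :: "real poly"
  assumes cyc: "cyc N a (2 * n + 1)" and eq: "\<And>\<phi>. trig N a \<phi> = b \<phi> * poly s (2 * cos \<phi>)"
    and b: "\<And>\<phi>. b \<phi> = 0 \<Longrightarrow> sin \<phi> = 0"
  shows "s \<noteq> 0" "card {x. x \<in> {-2<..<2} \<and> poly s x = 0} \<ge> n"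
proof -
  obtain \<alpha> where \<alpha>: "trig N a \<alpha> = 0" "alternates (trig N a) \<alpha> (\<alpha> + 2 * pi) (2 * n + 1)"
    using cyc by (auto simp: cyc_def)
  obtain p \<sigma> where p: "\<sigma> = 1 \<or> \<sigma> = -1" "\<And>i. i < 2*n+1 \<Longrightarrow> \<alpha> < p i" "\<And>i. i < 2*n+1 \<Longrightarrow> p i < \<alpha> + 2 * pi"
    "\<And>i. i < 2*n+1 \<Longrightarrow> \<sigma> * (-1) ^ i * trig N a (p i) > 0" "\<And>i. Suc i < 2*n+1 \<Longrightarrow> p i < p (Suc i)"
    using \<alpha>(2) unfolding alternates_def by blast
  have "trig N a (p 0) \<noteq> 0" using p(4)[of 0] by auto
  thus s0: "s \<noteq> 0" using eq by auto
  have "\<exists>x. p i < x \<and> x < p (Suc i) \<and> trig N a x = 0" if i: "i < 2 * n" for i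
  proof -
    have lt: "p i < p (Suc i)" using p(5)[of i] i by simp
    have s1: "\<sigma> * (-1) ^ i * trig N a (p i) > 0" "\<sigma> * (-1) ^ i * trig N a (p (Suc i)) < 0"
      using p(4)[of i] p(4)[of "Suc i"] i by auto
    have "\<exists>x\<ge>p i. x \<le> p (Suc i) \<and> \<sigma> * (-1) ^ i * trig N a x = 0"
      by (rule IVT2') (use s1 lt in \<open>auto intro!: continuous_intros trig_continuous\<close>)
    then obtain x where x: "p i \<le> x" "x \<le> p (Suc i)" "\<sigma> * (-1) ^ i * trig N a x = 0" by blast
    have "x \<noteq> p i" "x \<noteq> p (Suc i)" using s1 x(3) by auto
    moreover have "trig N a x = 0" using x(3) p(1) by auto
    ultimately show ?thesis using x by (intro exI[of _ x]) auto
  qed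
  then obtain \<xi> where \<xi>: "\<And>i. i < 2*n \<Longrightarrow> p i < \<xi> i" "\<And>i. i < 2*n \<Longrightarrow> \<xi> i < p (Suc i)" "\<And>i. i < 2*n \<Longrightarrow> trig N a (\<xi> i) = 0"
    by metis
  define t where "t = (\<lambda>i. case i of 0 \<Rightarrow> \<alpha> | Suc j \<Rightarrow> \<xi> j)"
  have tz: "trig N a (t i) = 0" if "i < 2*n+1" for i
    using that \<alpha>(1) \<xi>(3) by (auto simp: t_def split: nat.splits)
  have trange: "\<alpha> \<le> t i \<and> t i < \<alpha> + 2 * pi" if "i < 2*n+1" for i
  proof (cases i)
    case (Suc j)
    thus ?thesis using that \<xi>(1,2)[of j] p(2)[of j] p(3)[of "Suc j"] by (auto simp: t_def)
  qed (simp add: t_def)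
  have tstep: "t i < t (Suc i)" if "Suc i < 2*n+1" for i
  proof (cases i)
    case 0
    thus ?thesis using that \<xi>(1)[of 0] p(2)[of 0] by (auto simp: t_def)
  next
    case (Suc j)
    thus ?thesis using that \<xi>(2)[of j] \<xi>(1)[of "Suc j"] by (auto simp: t_def)
  qed
  have tmono: "t i < t j" if "i < j" "j < 2*n+1" for i j
    using that
  proof (induction j)
    case (Suc j)
    thus ?case using tstep[of j] by (cases "i = j") force+
  qed simp
  define S where "S = (\<lambda>i. cis (t i)) ` {..<2*n+1}"
  have "inj_on (\<lambda>i. cis (t i)) {..<2*n+1}"
  proof (rule inj_onI)
    fix i j assume ij: "i \<in> {..<2*n+1}" "j \<in> {..<2*n+1}" "cis (t i) = cis (t j)"
    have "cis (t i - t j) = 1" using ij(3) by (simp add: cis_divide[symmetric])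
    hence "cos (t i - t j) = 1" by (simp add: complex_eq_iff)
    then obtain m :: int where m: "t i - t j = of_int m * 2 * pi" using cos_one_2pi_int by auto
    have "\<bar>t i - t j\<bar> < 2 * pi" using trange[of i] trange[of j] ij by auto
    hence "\<bar>of_int m * (2 * pi)\<bar> < 1 * (2 * pi)" using m by (simp add: mult.assoc)
    hence "\<bar>real_of_int m\<bar> < 1" by (simp add: abs_mult)
    hence "m = 0" by linarith
    hence "t i = t j" using m by simp
    thus "i = j" using tmono ij by (metis lessThan_iff less_irrefl linorder_neqE_nat)
  qed
  hence cardS: "card S = 2*n+1" by (simp add: S_def card_image)
  have finS: "finite S" by (simp add: S_def)
  define X where "X = {x. x \<in> {-2<..<2} \<and> poly s x = 0}"
  have finX: "finite X" unfolding X_def using poly_roots_finite[OF s0] by (rule finite_subset[rotated]) auto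
  have SX: "2 * Re z \<in> X" if z: "z \<in> S" "Im z \<noteq> 0" for z
  proof -
    obtain i where i: "i < 2*n+1" "z = cis (t i)" using z by (auto simp: S_def)
    have "b (t i) \<noteq> 0" using b[of "t i"] z i by auto
    hence "poly s (2 * cos (t i)) = 0" using tz[OF i(1)] eq by simp
    moreover have "\<bar>cos (t i)\<bar> < 1"
    proof (rule ccontr)
      assume "\<not> \<bar>cos (t i)\<bar> < 1"
      hence "(cos (t i))\<^sup>2 \<ge> 1" by (metis abs_le_square_iff abs_one linorder_not_less one_power2)
      thus False using sin_cos_squared_add[of "t i"] z i by (smt (verit) zero_less_power2 cis.simps(2))
    qed
    ultimately show ?thesis using i by (auto simp: X_def)
  qed
  have half: "card {z \<in> S. c * Im z > 0} \<le> card X" if c: "c = 1 \<or> c = -1" for c :: real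
  proof (rule card_inj_on_le[of "\<lambda>z. 2 * Re z"])
    show "inj_on (\<lambda>z. 2 * Re z) {z \<in> S. c * Im z > 0}"
    proof (rule inj_onI)
      fix z w assume zw: "z \<in> {z \<in> S. c * Im z > 0}" "w \<in> {z \<in> S. c * Im z > 0}" "2 * Re z = 2 * Re w"
      have "norm z = 1" "norm w = 1" using zw by (auto simp: S_def)
      hence "(Re z)\<^sup>2 + (Im z)\<^sup>2 = 1" "(Re w)\<^sup>2 + (Im w)\<^sup>2 = 1" by (metis cmod_power2 one_power2)+
      hence "(Im z)\<^sup>2 = (Im w)\<^sup>2" using zw(3) by simp
      hence "Im z = Im w \<or> Im z = - Im w" by (rule power2_eq_iff[THEN iffD1])
      thus "z = w" using zw c by (auto simp: complex_eq_iff)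
    qed
  next
    show "(\<lambda>z. 2 * Re z) ` {z \<in> S. c * Im z > 0} \<subseteq> X" using SX by (metis (no_types, lifting) image_subsetI mem_Collect_eq mult_zero_right less_irrefl)
  qed (rule finX)
  have "S \<subseteq> {1, -1} \<union> ({z \<in> S. 1 * Im z > 0} \<union> {z \<in> S. -1 * Im z > 0})"
  proof
    fix z assume z: "z \<in> S"
    show "z \<in> {1, -1} \<union> ({z \<in> S. 1 * Im z > 0} \<union> {z \<in> S. -1 * Im z > 0})"
    proof (cases "Im z = 0")
      case True
      have "norm z = 1" using z by (auto simp: S_def)
      hence "(Re z)\<^sup>2 = 1" using True cmod_power2[of z] by simp
      hence "Re z = 1 \<or> Re z = -1" by (simp add: power2_eq_1_iff)
      thus ?thesis using True by (auto simp: complex_eq_iff)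
    qed (use z in auto)
  qed
  hence "card S \<le> card ({1, -1} \<union> ({z \<in> S. 1 * Im z > 0} \<union> {z \<in> S. -1 * Im z > 0}))"
    by (rule card_mono[rotated]) (use finS in auto)
  also have "\<dots> \<le> card {1, -1::complex} + (card {z \<in> S. 1 * Im z > 0} + card {z \<in> S. -1 * Im z > 0})"
    by (meson card_Un_le add_left_mono order.trans)
  also have "\<dots> \<le> 2 + (card X + card X)"
    using half[of 1] half[of "-1"] by (intro add_mono) (auto simp: card_insert_if)
  finally show "card {x. x \<in> {-2<..<2} \<and> poly s x = 0} \<ge> n" using cardS unfolding X_def by simp
qed

section \<open>Reciprocal polynomials\<close>

text \<open>At z = exp(i x) these are cos((l + 1/2) x) / cos(x/2) and sin((l + 1/2) x) / sin(x/2):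
  Chebyshev polynomials of the third and fourth kind in 2 cos x, with recursion V(l+2) = X V(l+1) -
  V(l).\<close>

lemma power_sum_reciprocal:
  fixes \<kappa> :: real
  assumes k: "\<kappa> = 1 \<or> \<kappa> = -1"
  shows "\<exists>V. degree V \<le> l \<and> (\<forall>z::complex. z \<noteq> 0 \<longrightarrow>
      z ^ Suc l + of_real \<kappa> * inverse z ^ l = (z + of_real \<kappa>) * poly (cpoly V) (z + inverse z))"
proof (induction l rule: induct_nat_012)
  case 0
  show ?case by (intro exI[of _ "[:1:]"]) (simp add: map_poly_pCons)
next
  case 1
  show ?case using k
    by (intro exI[of _ "[:-\<kappa>, 1:]"]) (auto simp: map_poly_pCons field_simps)
next
  case (ge2 l)
  obtain V where V: "degree V \<le> l" "\<And>z::complex. z \<noteq> 0 \<Longrightarrow>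
      z ^ Suc l + of_real \<kappa> * inverse z ^ l = (z + of_real \<kappa>) * poly (cpoly V) (z + inverse z)"
    using ge2(1) by blast
  obtain U where U: "degree U \<le> Suc l" "\<And>z::complex. z \<noteq> 0 \<Longrightarrow>
      z ^ Suc (Suc l) + of_real \<kappa> * inverse z ^ Suc l = (z + of_real \<kappa>) * poly (cpoly U) (z + inverse z)"
    using ge2(2) by blast
  define W where "W = [:0, 1:] * U - V"
  have "degree W \<le> Suc (Suc l)"
    unfolding W_def using U(1) V(1) degree_mult_le[of "[:0, 1:]" U] by (intro degree_diff_le) auto
  moreover have "z ^ Suc (Suc (Suc l)) + of_real \<kappa> * inverse z ^ Suc (Suc l)
      = (z + of_real \<kappa>) * poly (cpoly W) (z + inverse z)" if z: "z \<noteq> 0" for z :: complex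
  proof -
    have W: "cpoly W = [:0, 1:] * cpoly U - cpoly V"
      unfolding W_def by (rule poly_eqI) (simp add: coeff_map_poly coeff_pCons split: nat.splits)
    have zi: "z * inverse z = 1" using z by simp
    have "(z + of_real \<kappa>) * poly (cpoly W) (z + inverse z) =
       (z + inverse z) * ((z + of_real \<kappa>) * poly (cpoly U) (z + inverse z))
       - (z + of_real \<kappa>) * poly (cpoly V) (z + inverse z)"
      unfolding W by (simp add: algebra_simps)
    also have "\<dots> = (z + inverse z) * (z ^ Suc (Suc l) + of_real \<kappa> * inverse z ^ Suc l)
       - (z ^ Suc l + of_real \<kappa> * inverse z ^ l)" using U(2)[OF z] V(2)[OF z] by (simp only:)
    also have "\<dots> = z ^ Suc (Suc (Suc l)) + of_real \<kappa> * inverse z ^ Suc (Suc l)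
       + (z * inverse z - 1) * (z ^ Suc l + of_real \<kappa> * inverse z ^ l)"
      by (simp add: algebra_simps)
    finally show ?thesis using zi by simp
  qed
  ultimately show ?case by blast
qed

text \<open>The outermost pair of coefficients forms c (z^(2n+3) + \<kappa>), which is z^(n+1) times
  the expression treated in \<open>power_sum_reciprocal\<close>; the inner coefficients are covered
  by induction.\<close>

lemma reciprocal_poly_exists:
  fixes b :: "nat \<Rightarrow> real"
  assumes k: "\<kappa> = 1 \<or> \<kappa> = (-1::real)" and b: "\<And>j. j \<le> 2 * n + 1 \<Longrightarrow> b (2 * n + 1 - j) = \<kappa> * b j"
  shows "\<exists>Q. degree Q \<le> n \<and> (\<forall>z::complex. z \<noteq> 0 \<longrightarrow>
      (\<Sum>j\<le>2 * n + 1. of_real (b j) * z ^ j) = z ^ n * (z + of_real \<kappa>) * poly (cpoly Q) (z + inverse z))"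
  using b
proof (induction n arbitrary: b)
  case 0
  have "b 0 = \<kappa> * b 1" using 0[of 1] by simp
  thus ?case by (intro exI[of _ "[:b 1:]"]) (simp add: map_poly_pCons algebra_simps)
next
  case (Suc n)
  define b' where "b' = (\<lambda>j. b (Suc j))"
  have "b' (2 * n + 1 - j) = \<kappa> * b' j" if "j \<le> 2 * n + 1" for j
    using Suc.prems[of "Suc j"] that by (simp add: b'_def Suc_diff_le)
  from Suc.IH[of b', OF this] obtain Q where Q: "degree Q \<le> n" "\<And>z::complex. z \<noteq> 0 \<Longrightarrow>
      (\<Sum>j\<le>2 * n + 1. of_real (b' j) * z ^ j) = z ^ n * (z + of_real \<kappa>) * poly (cpoly Q) (z + inverse z)"
    by blast
  obtain V where V: "degree V \<le> Suc n" "\<And>z::complex. z \<noteq> 0 \<Longrightarrow>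
      z ^ Suc (Suc n) + of_real \<kappa> * inverse z ^ Suc n = (z + of_real \<kappa>) * poly (cpoly V) (z + inverse z)"
    using power_sum_reciprocal[OF k, of "Suc n"] by blast
  define c where "c = b (2 * n + 3)"
  have b0: "b 0 = \<kappa> * c" using Suc.prems[of "2 * n + 3"] k by (auto simp: c_def)
  have "degree (Q + smult c V) \<le> Suc n"
    using Q(1) V(1) degree_smult_le[of c V] by (intro degree_add_le) auto
  moreover have "(\<Sum>j\<le>2 * Suc n + 1. of_real (b j) * z ^ j) =
      z ^ Suc n * (z + of_real \<kappa>) * poly (cpoly (Q + smult c V)) (z + inverse z)" if z: "z \<noteq> 0" for z :: complex
  proof -
    have "(\<Sum>j\<le>2 * Suc n + 1. of_real (b j) * z ^ j)
        = (\<Sum>j\<le>Suc (2 * n + 1). of_real (b j) * z ^ j) + of_real c * z ^ (2 * n + 3)"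
      by (simp add: c_def eval_nat_numeral)
    also have "(\<Sum>j\<le>Suc (2 * n + 1). of_real (b j) * z ^ j)
        = of_real (b 0) + z * (\<Sum>j\<le>2 * n + 1. of_real (b' j) * z ^ j)"
      by (subst sum.atMost_Suc_shift) (simp add: b'_def sum_distrib_left mult_ac del: sum.atMost_Suc)
    also have "\<dots> + of_real c * z ^ (2 * n + 3) =
       z * (\<Sum>j\<le>2 * n + 1. of_real (b' j) * z ^ j) + of_real c * (z ^ (2 * n + 3) + of_real \<kappa>)"
      by (simp add: b0 algebra_simps)
    also have "z ^ (2 * n + 3) + of_real \<kappa> = z ^ Suc n * (z ^ Suc (Suc n) + of_real \<kappa> * inverse z ^ Suc n)"
    proof -
      have "z ^ Suc n * inverse z ^ Suc n = 1" using z by (simp add: power_mult_distrib[symmetric] del: power_Suc)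
      moreover have "z ^ (2 * n + 3) = z ^ Suc n * z ^ Suc (Suc n)" by (simp add: power_add[symmetric] mult_2 eval_nat_numeral)
      ultimately show ?thesis by (simp only: distrib_left mult.left_commute) (metis mult.right_neutral)
    qed
    finally show ?thesis unfolding Q(2)[OF z] V(2)[OF z]
      by (simp add: cpoly_add cpoly_smult algebra_simps)
  qed
  ultimately show ?case by blast
qed

lemma cis_plus_inverse: "cis x + inverse (cis x) = of_real (2 * cos x)"
  by (simp add: complex_eq_iff)

text \<open>On the unit circle z + 1/z runs through all of (-2,2), and z + \<kappa> is nonzero at
  the nonreal points; agreement on an interval suffices.\<close>

lemma reciprocal_poly_unique:
  assumes "\<And>z::complex. z \<noteq> 0 \<Longrightarrow> z ^ n * (z + of_real \<kappa>) * poly (cpoly Q) (z + inverse z)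
      = z ^ n * (z + of_real \<kappa>) * poly (cpoly Q') (z + inverse z)"
  shows "Q = Q'"
proof (rule ccontr)
  assume "Q \<noteq> Q'"
  hence fin: "finite {x. poly (Q - Q') x = 0}" by (intro poly_roots_finite) simp
  have "{-2<..<2} \<subseteq> {x. poly (Q - Q') x = 0}"
  proof
    fix x :: real assume x: "x \<in> {-2<..<2}"
    define t where "t = arccos (x / 2)"
    have ct: "2 * cos t = x" using x by (simp add: t_def)
    have "sin t \<noteq> 0" using x by (simp add: t_def sin_arccos_nonzero)
    hence "cis t + of_real \<kappa> \<noteq> 0" by (auto simp: complex_eq_iff)
    moreover have "cis t \<noteq> 0" by simp
    ultimately have "poly (cpoly Q) (cis t + inverse (cis t)) = poly (cpoly Q') (cis t + inverse (cis t))"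
      using assms[of "cis t"] by simp
    hence "poly Q x = poly Q' x" unfolding cis_plus_inverse ct cpoly_of_real of_real_eq_iff .
    thus "x \<in> {x. poly (Q - Q') x = 0}" by simp
  qed
  moreover have "infinite {-2<..<2::real}" by simp
  ultimately show False using fin finite_subset by blast
qed

section \<open>The elementary trigonometric polynomial and its zero at pi\<close>

lemma poly_eq_sum_atMost:
  fixes p :: "'a :: comm_semiring_1 poly"
  assumes "degree p \<le> N"
  shows "poly p x = (\<Sum>j\<le>N. coeff p j * x ^ j)"
  unfolding poly_altdef using assms by (intro sum.mono_neutral_left) (auto simp: coeff_eq_0)

text \<open>The Euler operator X d/dX multiplies the j-th coefficient by j and lowers the order of
  the zero at -1 by at most one. Writing \<open>q\<close> in Horner form, one such step is needed
  per degree.\<close>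

lemma alternating_moments_vanish:
  fixes W q :: "complex poly"
  assumes "[:1, 1:] ^ m dvd W" "degree q < m" "degree W \<le> N"
  shows "(\<Sum>j\<le>N. poly q (of_nat j) * coeff W j * (-1) ^ j) = 0"
  using assms
proof (induction q arbitrary: m W)
  case 0
  thus ?case by simp
next
  case (pCons c q)
  define \<theta> where "\<theta> = [:0, 1:] * pderiv W"
  have co: "coeff \<theta> j = of_nat j * coeff W j" for j
    by (cases j) (simp_all add: \<theta>_def coeff_pderiv)
  have "m > 0" using pCons.prems(2) by simp
  hence "[:1, 1:] dvd W" using dvd_trans[OF dvd_power[OF disjI1] pCons.prems(1)] by blast
  hence "poly W (-1) = 0" by auto
  hence W1: "(\<Sum>j\<le>N. coeff W j * (-1) ^ j) = 0"
    by (simp add: poly_eq_sum_atMost[OF pCons.prems(3)])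
  have "(\<Sum>j\<le>N. poly (pCons c q) (of_nat j) * coeff W j * (-1) ^ j)
      = c * (\<Sum>j\<le>N. coeff W j * (-1) ^ j) + (\<Sum>j\<le>N. poly q (of_nat j) * coeff \<theta> j * (-1) ^ j)"
    by (simp add: co sum_distrib_left sum.distrib[symmetric] algebra_simps)
  also have "(\<Sum>j\<le>N. poly q (of_nat j) * coeff \<theta> j * (-1) ^ j) = 0"
  proof (cases "q = 0")
    case False
    hence dq: "degree q < m - 1" using pCons.prems(2) by simp
    obtain U where U: "W = [:1, 1:] ^ m * U" using pCons.prems(1) by blast
    have "[:1, 1:] ^ (m - 1) dvd ([:1, 1:] ^ m :: complex poly)" by (rule le_imp_power_dvd) simp
    hence "[:1, 1:] ^ (m - 1) dvd pderiv W"
      unfolding U pderiv_mult pderiv_power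
      by (intro dvd_add dvd_mult[of _ _ U] dvd_smult dvd_mult2) auto
    hence "[:1, 1:] ^ (m - 1) dvd \<theta>" unfolding \<theta>_def by (rule dvd_mult)
    moreover have "degree \<theta> \<le> N"
      by (rule degree_le) (use pCons.prems(3) in \<open>auto simp: co coeff_eq_0\<close>)
    ultimately show ?thesis using pCons.IH dq by blast
  qed simp
  finally show ?case using W1 by simp
qed

text \<open>The coefficients of (1 + z)^(2n+1) (a (1 + z)^2 + b z). The index shift in the second
  summand aligns the frequencies of the two degrees, so that both polynomials of the theorem live in
  one space of trigonometric polynomials.\<close>

definition base_coeff :: "nat \<Rightarrow> real \<Rightarrow> real \<Rightarrow> nat \<Rightarrow> real" where
  "base_coeff n a b j = a * real ((2*n+3) choose j) + b * (if j = 0 then 0 else real ((2*n+1) choose (j - 1)))"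

lemma base_coeff_sum:
  fixes g :: "nat \<Rightarrow> complex"
  shows "(\<Sum>j\<le>2*n+3. of_real (base_coeff n a b j) * g j) =
    of_real a * (\<Sum>j\<le>2*n+3. of_nat ((2*n+3) choose j) * g j) +
    of_real b * (\<Sum>j\<le>2*n+1. of_nat ((2*n+1) choose j) * g (Suc j))"
proof -
  have "(\<Sum>j\<le>2*n+3. of_real (base_coeff n a b j) * g j) = of_real a * (\<Sum>j\<le>2*n+3. of_nat ((2*n+3) choose j) * g j)
     + of_real b * (\<Sum>j\<le>Suc (Suc (2*n+1)). (if j = 0 then 0 else of_nat ((2*n+1) choose (j - 1))) * g j)"
  proof -
    have e: "Suc (Suc (2*n+1)) = 2*n+3" by simp
    show ?thesis unfolding e sum_distrib_left sum.distrib[symmetric]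
      by (intro sum.cong refl) (simp add: base_coeff_def algebra_simps del: binomial_Suc_Suc)
  qed
  also have "(\<Sum>j\<le>Suc (Suc (2*n+1)). (if j = 0 then 0 else of_nat ((2*n+1) choose (j - 1))) * g j)
     = (\<Sum>j\<le>2*n+1. of_nat ((2*n+1) choose j) * g (Suc j))"
    by (subst sum.atMost_Suc_shift) (simp add: binomial_eq_0)
  finally show ?thesis .
qed

lemma binomial_sum: "(\<Sum>j\<le>N. of_nat (N choose j) * z ^ j) = (1 + z :: complex) ^ N"
  using binomial_ring[of z 1 N] by (simp add: add.commute)

lemma base_coeff_poly:
  "(\<Sum>j\<le>2*n+3. of_real (base_coeff n a b j) * z ^ j) =
     (1 + z) ^ (2*n+1) * (of_real a * (1 + z)\<^sup>2 + of_real b * (z :: complex))"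
proof -
  have "(\<Sum>j\<le>2*n+3. of_real (base_coeff n a b j) * z ^ j) = of_real a * (1 + z) ^ (2*n+3) +
      of_real b * (z * (\<Sum>j\<le>2*n+1. of_nat ((2*n+1) choose j) * z ^ j))"
  proof -
    have "(\<Sum>j\<le>2*n+1. of_nat ((2*n+1) choose j) * z ^ Suc j) = z * (\<Sum>j\<le>2*n+1. of_nat ((2*n+1) choose j) * z ^ j)"
      by (simp only: sum_distrib_left power_Suc mult.left_commute)
    thus ?thesis unfolding base_coeff_sum by (simp only: binomial_sum)
  qed
  also have "\<dots> = of_real a * (1 + z) ^ (2*n+3) + of_real b * (z * (1 + z) ^ (2*n+1))"
    unfolding binomial_sum ..
  also have "(1 + z) ^ (2*n+3) = (1 + z) ^ (2*n+1) * (1 + z)\<^sup>2"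
    unfolding power_add[symmetric] by (rule arg_cong[where f = "\<lambda>k. (1 + z) ^ k"]) simp
  finally show ?thesis by (simp add: algebra_simps)
qed

lemma trig_eq_poly:
  "trig N c x = Re (cis (- (real N / 2) * x) * (\<Sum>j\<le>N. c j * cis x ^ j))"
proof -
  have "cis (freq N j * x) = cis (- (real N / 2) * x) * cis x ^ j" for j
    by (simp add: Complex.DeMoivre cis_mult freq_def algebra_simps)
  hence "a * cis (freq N j * x) = cis (- (real N / 2) * x) * (a * cis x ^ j)" for a j
    by (simp only: mult_ac)
  thus ?thesis by (simp only: trig_def sum_distrib_left)
qed

text \<open>The factor (1 + z)^(2n+1) vanishes to that order at z = -1, which is exp(i pi);
  derivatives in x at pi are alternating moments of the coefficients.\<close>

lemma base_coeff_vanishes: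
  "vanishes (2*n+3) (\<lambda>j. of_real (base_coeff n a b j)) pi (2*n+1)"
  unfolding vanishes_def
proof (intro allI impI)
  fix p :: "real poly" assume p: "degree p < 2*n+1"
  define N where "N = 2*n+3"
  define W where "W = (\<Sum>j\<le>N. monom (complex_of_real (base_coeff n a b j)) j)"
  have coW: "coeff W j = of_real (base_coeff n a b j)" if "j \<le> N" for j
    using that by (simp add: W_def coeff_sum if_distrib cong: if_cong)
  have "poly W z = poly ([:1, 1:] ^ (2*n+1) * (smult (of_real a) ([:1, 1:]^2) + [:0, of_real b:])) z" for z
    using base_coeff_poly[of n a b z] by (simp add: W_def N_def poly_sum poly_monom mult.commute del: sum.atMost_Suc power_Suc)
  hence "W = [:1, 1:] ^ (2*n+1) * (smult (of_real a) ([:1, 1:]^2) + [:0, of_real b:])"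
    by (simp add: poly_eq_poly_eq_iff[symmetric] fun_eq_iff del: power_Suc)
  hence dvd: "[:1, 1:] ^ (2*n+1) dvd W" by (rule dvdI)
  have degW: "degree W \<le> N"
    unfolding W_def by (intro degree_sum_le) (auto intro: order.trans[OF degree_monom_le])
  \<comment> \<open>The substitution X -> i (X - N/2) turns the index j into i times its
    frequency.\<close>
  define q where "q = pcompose (cpoly p) [:- (\<i> * (real N / 2)), \<i>:]"
  have "degree q < 2*n+1" unfolding q_def using p by (simp add: degree_cpoly degree_pcompose)
  hence "(\<Sum>j\<le>N. poly q (of_nat j) * coeff W j * (-1) ^ j) = 0"
    by (rule alternating_moments_vanish[OF dvd _ degW])
  moreover have "poly q (of_nat j) = poly (cpoly p) (\<i> * freq N j)" for j
    by (simp add: q_def poly_pcompose freq_def algebra_simps)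
  ultimately have "(\<Sum>j\<le>N. diff_op N p (\<lambda>j. of_real (base_coeff n a b j)) j * cis pi ^ j) = 0"
    using coW by (simp add: diff_op_def)
  thus "trig (2*n+3) (diff_op (2*n+3) p (\<lambda>j. of_real (base_coeff n a b j))) pi = 0"
    unfolding trig_eq_poly N_def by simp
qed

lemma base_coeff_trig:
  "trig (2*n+3) (\<lambda>j. of_real (base_coeff n a b j)) x = (2 * cos (x / 2)) ^ (2*n+1) * (4 * a * (cos (x / 2))\<^sup>2 + b)"
proof -
  have c1: "cis (- x / 2) * (1 + cis x) = of_real (2 * cos (x / 2))"
  proof -
    have "cis (- x / 2) * (1 + cis x) = cis (- (x / 2)) + cis (x / 2)"
      by (simp add: distrib_left cis_mult)
    also have "\<dots> = of_real (2 * cos (x / 2))" by (simp add: complex_eq_iff)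
    finally show ?thesis .
  qed
  have c2: "cis (- (real (2*n+3) / 2) * x) = cis (- x / 2) ^ (2*n+1) * cis (- x / 2) ^ 2"
    unfolding power_add[symmetric] Complex.DeMoivre cis_mult by (intro arg_cong[of _ _ cis]) (simp add: field_simps)
  have c3: "cis (- x / 2) ^ 2 * cis x = 1" by (simp add: Complex.DeMoivre cis_mult)
  have "cis (- (real (2*n+3) / 2) * x) * (\<Sum>j\<le>2*n+3. of_real (base_coeff n a b j) * cis x ^ j) =
     (cis (- x / 2) * (1 + cis x)) ^ (2*n+1) * (of_real a * (cis (- x / 2) * (1 + cis x))\<^sup>2
       + of_real b * (cis (- x / 2) ^ 2 * cis x))"
    unfolding c2 base_coeff_poly by (simp only: power_mult_distrib distrib_left mult_ac)
  also have "\<dots> = of_real ((2 * cos (x / 2)) ^ (2*n+1) * (4 * a * (cos (x / 2))\<^sup>2 + b))"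
    unfolding c1 c3 by (simp add: power_mult_distrib)
  finally show ?thesis unfolding trig_eq_poly by (simp only: Re_complex_of_real)
qed

text \<open>The factor 4 a cos^2(x/2) + b is 4 a + b at 2 pi and 2 a + b at 3 pi/2; both vanish only
  for a = b = 0.\<close>

lemma base_coeff_trig_nonzero:
  assumes "(a, b) \<noteq> (0, 0)"
  obtains x where "pi < x" "x < pi + 2 * pi" "trig (2*n+3) (\<lambda>j. of_real (base_coeff n a b j)) x \<noteq> 0"
proof (cases "4 * a + b = 0")
  case False
  have "trig (2*n+3) (\<lambda>j. of_real (base_coeff n a b j)) (2 * pi) \<noteq> 0"
    unfolding base_coeff_trig using False by simp
  thus ?thesis using that[of "2 * pi"] by auto
next
  case True
  hence "2 * a + b \<noteq> 0" using assms by auto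
  moreover have c: "cos (3 * pi / 4) = - (sqrt 2 / 2)"
    using cos_pi_minus[of "pi / 4"] cos_45 by (simp add: field_simps)
  hence c2: "(cos (3 * pi / 4))\<^sup>2 = 1/2" by (simp add: power_divide)
  have half: "3 * pi / 2 / 2 = 3 * pi / 4" by simp
  have "4 * a * (cos (3 * pi / 4))\<^sup>2 + b = 2 * a + b" unfolding c2 by simp
  ultimately have "trig (2*n+3) (\<lambda>j. of_real (base_coeff n a b j)) (3 * pi / 2) \<noteq> 0"
    unfolding base_coeff_trig half by (simp only: c) simp
  thus ?thesis using that[of "3 * pi / 2"] by auto
qed

text \<open>This is \<gamma> (exp(i x/2) + \<kappa> exp(-i x/2)): up to a real constant cos(x/2) or
  sin(x/2), provided \<gamma> is real or imaginary according to \<kappa>.\<close>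

definition base_factor :: "complex \<Rightarrow> real \<Rightarrow> real \<Rightarrow> real" where
  "base_factor \<gamma> \<kappa> x = Re (\<gamma> * cis (- (x / 2)) * (cis x + of_real \<kappa>))"

lemma base_factor_real:
  assumes k: "\<kappa> = 1 \<or> \<kappa> = -1" and g: "cnj \<gamma> = of_real \<kappa> * \<gamma>"
  shows "of_real (base_factor \<gamma> \<kappa> x) = \<gamma> * cis (- (x / 2)) * (cis x + of_real \<kappa>)"
proof -
  define w where "w = \<gamma> * cis (- (x / 2)) * (cis x + of_real \<kappa>)"
  have w: "w = \<gamma> * (cis (x / 2) + of_real \<kappa> * cis (- (x / 2)))"
  proof -
    have "cis (- (x / 2)) * cis x = cis (x / 2)" by (simp add: cis_mult)
    thus ?thesis by (simp add: w_def algebra_simps)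
  qed
  have kk: "of_real \<kappa> * of_real \<kappa> = (1::complex)" using k by auto
  have "cnj w = of_real \<kappa> * \<gamma> * (cis (- (x / 2)) + of_real \<kappa> * cis (x / 2))"
    unfolding w by (simp add: cis_cnj g)
  also have "\<dots> = \<gamma> * (of_real \<kappa> * cis (- (x / 2)) + (of_real \<kappa> * of_real \<kappa>) * cis (x / 2))"
    by (simp add: algebra_simps)
  also have "\<dots> = w" unfolding w kk by (simp add: algebra_simps)
  finally have "cnj w = w" .
  hence "of_real (Re w) = w" by (simp add: complex_eq_iff)
  thus ?thesis unfolding base_factor_def w_def .
qed

lemma base_factor_eq_0D:
  assumes k: "\<kappa> = 1 \<or> \<kappa> = -1" and g: "cnj \<gamma> = of_real \<kappa> * \<gamma>" "\<gamma> \<noteq> 0" and "base_factor \<gamma> \<kappa> x = 0"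
  shows "sin x = 0"
proof -
  have "\<gamma> * cis (- (x / 2)) * (cis x + of_real \<kappa>) = 0"
    using base_factor_real[OF k g(1), of x] assms(4) by simp
  hence "cis x + of_real \<kappa> = 0" using g(2) by simp
  thus ?thesis by (simp add: complex_eq_iff)
qed

lemma cis_shift: "cis (- (real (2*n+3) / 2) * x) * cis x ^ Suc n = cis (- (x / 2))"
  unfolding Complex.DeMoivre cis_mult by (intro arg_cong[of _ _ cis]) (simp add: field_simps)

text \<open>A perturbation by \<open>r\<close> must be expressible by the same frequencies; the
  product has frequencies up to 1/2 + (n + 1), which is exactly half of 2 n + 3.\<close>

lemma base_factor_times_poly_is_trig:
  assumes k: "\<kappa> = 1 \<or> \<kappa> = -1" and g: "cnj \<gamma> = of_real \<kappa> * \<gamma>" and r: "degree r \<le> Suc n"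
  shows "\<exists>e. \<forall>x. trig (2*n+3) e x = base_factor \<gamma> \<kappa> x * poly r (2 * cos x)"
proof -
  \<comment> \<open>Negative powers are cleared by z^(n+1) (z + 1/z)^i = z^(n+1-i) (1 +
    z^2)^i.\<close>
  define E where "E = smult \<gamma> ([:of_real \<kappa>, 1:] *
      (\<Sum>i\<le>Suc n. smult (of_real (coeff r i)) (monom 1 (Suc n - i) * [:1, 0, 1:] ^ i)))"
  have pE: "poly E z = \<gamma> * (z + of_real \<kappa>) * z ^ Suc n * poly (cpoly r) (z + inverse z)" if z: "z \<noteq> 0" for z
  proof -
    have "z ^ (Suc n - i) * (1 + z * z) ^ i = z ^ Suc n * (z + inverse z) ^ i" if i: "i \<le> Suc n" for i
    proof -
      have "z ^ Suc n * (z + inverse z) ^ i = z ^ (Suc n - i) * (z ^ i * (z + inverse z) ^ i)"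
        using i by (metis le_add_diff_inverse2 mult.assoc power_add)
      also have "z ^ i * (z + inverse z) ^ i = (z * (z + inverse z)) ^ i" by (rule power_mult_distrib[symmetric])
      also have "z * (z + inverse z) = 1 + z * z" using z by (simp add: distrib_left add.commute)
      finally show ?thesis ..
    qed
    hence "(\<Sum>i\<le>Suc n. of_real (coeff r i) * (z ^ (Suc n - i) * (1 + z * z) ^ i))
       = z ^ Suc n * (\<Sum>i\<le>Suc n. of_real (coeff r i) * (z + inverse z) ^ i)"
      unfolding sum_distrib_left by (intro sum.cong) (simp_all only: mult.left_commute atMost_iff)
    also have "(\<Sum>i\<le>Suc n. of_real (coeff r i) * (z + inverse z) ^ i) = poly (cpoly r) (z + inverse z)"
      using poly_eq_sum_atMost[of "cpoly r" "Suc n"] r by (simp add: degree_cpoly coeff_map_poly del: sum.atMost_Suc)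
    finally show ?thesis
      by (simp add: E_def poly_sum poly_monom algebra_simps del: sum.atMost_Suc power_Suc)
  qed
  have "degree (smult (of_real (coeff r i)) (monom 1 (Suc n - i) * [:1, 0, 1:] ^ i :: complex poly)) \<le> 2*n+2"
    if i: "i \<le> Suc n" for i
  proof -
    have "degree (monom 1 (Suc n - i) * [:1, 0, 1:] ^ i :: complex poly) \<le> (Suc n - i) + 2 * i"
      by (rule order.trans[OF degree_mult_le add_mono]) (auto simp: degree_monom_le degree_power_eq)
    also have "\<dots> \<le> 2*n+2" using i by simp
    finally show ?thesis using degree_smult_le order.trans by blast
  qed
  hence "degree (\<Sum>i\<le>Suc n. smult (of_real (coeff r i)) (monom 1 (Suc n - i) * [:1, 0, 1:] ^ i :: complex poly)) \<le> 2*n+2"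
    by (intro degree_sum_le) auto
  hence dE: "degree E \<le> 2*n+3"
    unfolding E_def by (intro order.trans[OF degree_smult_le] order.trans[OF degree_mult_le])
      (auto simp del: sum.atMost_Suc)
  have "trig (2*n+3) (coeff E) x = base_factor \<gamma> \<kappa> x * poly r (2 * cos x)" for x
  proof -
    have "cis (- (real (2*n+3) / 2) * x) * poly E (cis x) =
       \<gamma> * (cis (- (real (2*n+3) / 2) * x) * cis x ^ Suc n) * (cis x + of_real \<kappa>) * poly (cpoly r) (of_real (2 * cos x))"
      unfolding pE[OF cis_neq_zero] cis_plus_inverse by (simp only: mult_ac)
    also have "\<dots> = of_real (base_factor \<gamma> \<kappa> x * poly r (2 * cos x))"
      unfolding cis_shift cpoly_of_real unfolding of_real_mult base_factor_real[OF k g] by (simp only: mult_ac)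
    finally show ?thesis
      unfolding trig_eq_poly poly_eq_sum_atMost[OF dE, symmetric] by (simp only: Re_complex_of_real)
  qed
  thus ?thesis by blast
qed

section \<open>Zeros of the polynomials formed from the values of a strip function on the imaginary
  axis\<close>

context
  fixes \<kappa> :: real and G :: "complex \<Rightarrow> complex" and \<gamma> :: complex and lam :: "real \<Rightarrow> real" and q :: "nat \<Rightarrow> real poly"
  assumes G: "strip_entire \<kappa> G" and \<gamma>: "\<gamma> \<noteq> 0" "cnj \<gamma> = of_real \<kappa> * \<gamma>"
    and Glam: "\<And>\<omega>. G (\<i> * of_real \<omega>) = \<gamma> * of_real (lam \<omega>)"
    and q_deg: "\<And>n. degree (q n) \<le> n"
    and q: "\<And>n z. z \<noteq> 0 \<Longrightarrow> (\<Sum>j\<le>2*n+1. of_real (real ((2*n+1) choose j) * lam (real j - real n - 1/2)) * z ^ j)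
      = z ^ n * (z + of_real \<kappa>) * poly (cpoly (q n)) (z + inverse z)"
begin

lemma kappa: "\<kappa> = 1 \<or> \<kappa> = -1"
  using G by (simp add: strip_entire_def)

text \<open>Multiplying the elementary coefficients by the values G(i \<omega>), which are \<gamma>
  times real numbers, yields the weighted binomial sums in \<open>q\<close>. Zeros of the
  combination in (-2,2) thus become zeros of the function G(d/dx) applied to the elementary
  one.\<close>

lemma combination_trig:
  "trig (2*n+3) (\<lambda>j. G (\<i> * freq (2*n+3) j) * of_real (base_coeff n a b j)) x
    = base_factor \<gamma> \<kappa> x * poly (smult a (q (Suc n)) + smult b (q n)) (2 * cos x)"
proof -
  define z where "z = cis x"
  have z: "z \<noteq> 0" by (simp add: z_def)
  have A: "(\<Sum>j\<le>2*n+3. of_nat ((2*n+3) choose j) * (of_real (lam (freq (2*n+3) j)) * z ^ j))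
      = z ^ Suc n * (z + of_real \<kappa>) * poly (cpoly (q (Suc n))) (z + inverse z)"
  proof -
    have e: "2 * Suc n + 1 = 2*n+3" by simp
    have f: "real j - real (Suc n) - 1/2 = freq (2*n+3) j" for j by (simp add: freq_def field_simps)
    show ?thesis using q[OF z, of "Suc n"] unfolding e f
      by (simp only: of_real_mult of_real_of_nat_eq mult.assoc)
  qed
  have B: "(\<Sum>j\<le>2*n+1. of_nat ((2*n+1) choose j) * (of_real (lam (freq (2*n+3) (Suc j))) * z ^ Suc j))
      = z ^ Suc n * (z + of_real \<kappa>) * poly (cpoly (q n)) (z + inverse z)"
  proof -
    have "freq (2*n+3) (Suc j) = real j - real n - 1/2" for j by (simp add: freq_def field_simps)
    hence "(\<Sum>j\<le>2*n+1. of_nat ((2*n+1) choose j) * (of_real (lam (freq (2*n+3) (Suc j))) * z ^ Suc j))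
       = z * (\<Sum>j\<le>2*n+1. of_real (real ((2*n+1) choose j) * lam (real j - real n - 1/2)) * z ^ j)"
      by (simp only: sum_distrib_left power_Suc of_real_mult of_real_of_nat_eq mult_ac)
    thus ?thesis unfolding q[OF z] by (simp only: power_Suc mult_ac)
  qed
  have "(\<Sum>j\<le>2*n+3. G (\<i> * freq (2*n+3) j) * of_real (base_coeff n a b j) * z ^ j)
     = \<gamma> * (\<Sum>j\<le>2*n+3. of_real (base_coeff n a b j) * (of_real (lam (freq (2*n+3) j)) * z ^ j))"
    by (simp only: Glam sum_distrib_left mult_ac)
  also have "\<dots> = \<gamma> * (z + of_real \<kappa>) * z ^ Suc n *
      poly (cpoly (smult a (q (Suc n)) + smult b (q n))) (z + inverse z)"
    unfolding base_coeff_sum A B by (simp add: cpoly_add cpoly_smult algebra_simps)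
  finally have sum: "(\<Sum>j\<le>2*n+3. G (\<i> * freq (2*n+3) j) * of_real (base_coeff n a b j) * cis x ^ j) = 
      \<gamma> * (cis x + of_real \<kappa>) * cis x ^ Suc n *
      poly (cpoly (smult a (q (Suc n)) + smult b (q n))) (of_real (2 * cos x))"
    unfolding z_def cis_plus_inverse .
  have "cis (- (real (2*n+3) / 2) * x) * (\<Sum>j\<le>2*n+3. G (\<i> * freq (2*n+3) j) * of_real (base_coeff n a b j) * cis x ^ j)
     = \<gamma> * (cis (- (real (2*n+3) / 2) * x) * cis x ^ Suc n) * (cis x + of_real \<kappa>) *
       poly (cpoly (smult a (q (Suc n)) + smult b (q n))) (of_real (2 * cos x))"
    unfolding sum by (simp only: mult_ac)
  also have "\<dots> = of_real (base_factor \<gamma> \<kappa> x * poly (smult a (q (Suc n)) + smult b (q n)) (2 * cos x))"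
    unfolding cis_shift cpoly_of_real unfolding of_real_mult base_factor_real[OF kappa \<gamma>(2)] by (simp only: mult_ac)
  finally show ?thesis unfolding trig_eq_poly by (simp only: Re_complex_of_real)
qed

text \<open>The value \<eta> = 0 counts the zeros of the combination itself, positive \<eta> serve
  the Wronskian argument. \<open>n \<ge> 1\<close> makes the number 2 n + 1 of alternations at least
  3, as the second order Rolle step requires.\<close>

lemma combination_stable:
  assumes ab: "(a, b) \<noteq> (0, 0)" and r: "degree r \<le> Suc n" and n: "n \<ge> 1"
  obtains \<eta>0 where "\<eta>0 > 0" "\<And>\<eta>. 0 \<le> \<eta> \<Longrightarrow> \<eta> < \<eta>0 \<Longrightarrow>
    smult a (q (Suc n)) + smult b (q n) + smult \<eta> r \<noteq> 0 \<and>
    card {x. x \<in> {-2<..<2} \<and> poly (smult a (q (Suc n)) + smult b (q n) + smult \<eta> r) x = 0} \<ge> n"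
proof -
  define N where "N = 2*n+3"
  define c where "c = (\<lambda>j. complex_of_real (base_coeff n a b j))"
  obtain Q G0 P where dec: "strip_poly Q" "degree Q \<ge> 2*n+1" "\<And>z. G z = poly (cpoly Q) z * G0 z"
    "\<And>\<omega>. G0 (\<i> * of_real \<omega>) \<noteq> 0" "\<And>l. strip_poly (P l)"
    "\<And>z. (\<lambda>l. poly (cpoly (P l)) z) \<longlonglongrightarrow> G0 z"
    by (rule strip_entire_decomposition[OF G]) blast
  obtain e where e: "\<And>x. trig N e x = base_factor \<gamma> \<kappa> x * poly r (2 * cos x)"
    using base_factor_times_poly_is_trig[OF kappa \<gamma>(2) r] unfolding N_def by blast
  obtain x where x: "pi < x" "x < pi + 2 * pi" "trig N c x \<noteq> 0"
    using base_coeff_trig_nonzero[OF ab, of n] unfolding N_def c_def by blast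
  have v: "vanishes N c pi (2*n+1)" unfolding N_def c_def by (rule base_coeff_vanishes)
  have odd: "odd N" "odd (2*n+1)" "2*n+1 \<ge> 3" using n by (auto simp: N_def)
  obtain \<eta>0 where \<eta>0: "\<eta>0 > 0" "\<And>\<eta>. 0 \<le> \<eta> \<Longrightarrow> \<eta> < \<eta>0 \<Longrightarrow>
      cyc N (\<lambda>j. G (\<i> * freq N j) * c j + of_real \<eta> * e j) (2*n+1)"
    by (rule cyc_perturbed[where G = "\<lambda>j. G (\<i> * freq N j)" and G0 = "\<lambda>j. G0 (\<i> * freq N j)"
        and e = e, OF odd dec(1,2) _ _ dec(5) _ v x]) (rule dec(3), rule dec(4), rule dec(6), blast)
  show ?thesis
  proof (rule that[OF \<eta>0(1)])
    fix \<eta> :: real assume \<eta>: "0 \<le> \<eta>" "\<eta> < \<eta>0"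
    define s where "s = smult a (q (Suc n)) + smult b (q n) + smult \<eta> r"
    have "trig N (\<lambda>j. G (\<i> * freq N j) * c j + of_real \<eta> * e j) x = base_factor \<gamma> \<kappa> x * poly s (2 * cos x)" for x
    proof -
      have "trig N (\<lambda>j. G (\<i> * freq N j) * c j + of_real \<eta> * e j) x =
          base_factor \<gamma> \<kappa> x * poly (smult a (q (Suc n)) + smult b (q n)) (2 * cos x)
           + \<eta> * (base_factor \<gamma> \<kappa> x * poly r (2 * cos x))"
        unfolding trig_add trig_scale e unfolding N_def c_def combination_trig ..
      thus ?thesis by (simp add: s_def algebra_simps)
    qed
    from card_zeros_if_cyc[OF \<eta>0(2)[OF \<eta>] this base_factor_eq_0D[OF kappa \<gamma>(2,1)]]
    show "s \<noteq> 0 \<and> card {x. x \<in> {-2<..<2} \<and> poly s x = 0} \<ge> n" by blast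
  qed
qed

lemma combination_nonzero:
  assumes "(a, b) \<noteq> (0, 0)" "n \<ge> 1"
  shows "smult a (q (Suc n)) + smult b (q n) \<noteq> 0"
proof -
  obtain \<eta>0 :: real where "\<eta>0 > 0" "\<And>\<eta>. 0 \<le> \<eta> \<Longrightarrow> \<eta> < \<eta>0 \<Longrightarrow>
    smult a (q (Suc n)) + smult b (q n) + smult \<eta> 0 \<noteq> 0 \<and>
    card {x. x \<in> {-2<..<2} \<and> poly (smult a (q (Suc n)) + smult b (q n) + smult \<eta> 0) x = 0} \<ge> n"
    by (rule combination_stable[OF assms(1) _ assms(2), of 0]) (simp, blast)
  from this(2)[of 0] this(1) show ?thesis by simp
qed

text \<open>The combination a = 0, b = 1 has at least \<open>n\<close> zeros in (-2,2), while its
  degree is at most \<open>n\<close>.\<close>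

lemma zeros_of_q:
  assumes "n \<ge> 1"
  shows "simple_zeros_in {-2<..<2} (q n)" "degree (q n) = n" "{x. poly (q n) x = 0} \<subseteq> {-2<..<2}" "q n \<noteq> 0"
proof -
  obtain \<eta>0 :: real where \<eta>0: "\<eta>0 > 0" "\<And>\<eta>. 0 \<le> \<eta> \<Longrightarrow> \<eta> < \<eta>0 \<Longrightarrow>
    smult 0 (q (Suc n)) + smult 1 (q n) + smult \<eta> 0 \<noteq> 0 \<and>
    card {x. x \<in> {-2<..<2} \<and> poly (smult 0 (q (Suc n)) + smult 1 (q n) + smult \<eta> 0) x = 0} \<ge> n"
    by (rule combination_stable[of 0 1 0 n]) (simp, simp, rule assms, blast)
  have nz: "q n \<noteq> 0" and card: "card {x. x \<in> {-2<..<2} \<and> poly (q n) x = 0} \<ge> n"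
    using \<eta>0(2)[of 0] \<eta>0(1) by auto
  have fin: "finite {x. x \<in> {-2<..<2} \<and> poly (q n) x = 0}"
    using poly_roots_finite[OF nz] by (rule finite_subset[rotated]) auto
  have sub: "{x. x \<in> {-2<..<2} \<and> poly (q n) x = 0} \<subseteq> {-2<..<2}"
    and root: "\<And>x. x \<in> {x. x \<in> {-2<..<2} \<and> poly (q n) x = 0} \<Longrightarrow> poly (q n) x = 0" by blast+
  note * = simple_zeros_in_if_card[OF nz q_deg fin card sub root]
  show "simple_zeros_in {-2<..<2} (q n)" "degree (q n) = n" "{x. poly (q n) x = 0} \<subseteq> {-2<..<2}" "q n \<noteq> 0"
    by (rule *(1), assumption) (rule *(2), assumption, rule *(3), assumption, rule nz)
qed

lemma q_strictly_interlace:
  assumes n: "n \<ge> 1"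
  shows "strictly_interlace (q n) (q (Suc n))"
proof -
  have n': "Suc n \<ge> 1" by simp
  have W: "poly (pderiv (q n)) x * poly (q (Suc n)) x - poly (q n) x * poly (pderiv (q (Suc n))) x \<noteq> 0" for x
  proof (rule wronskian_nonzero[of n "q (Suc n)" "q n"])
    fix a b :: real and r :: "real poly" assume ab: "(a, b) \<noteq> (0, 0)" and r: "degree r \<le> Suc n"
    obtain \<eta>0 where \<eta>0: "\<eta>0 > 0" "\<And>\<eta>. 0 \<le> \<eta> \<Longrightarrow> \<eta> < \<eta>0 \<Longrightarrow>
      smult a (q (Suc n)) + smult b (q n) + smult \<eta> r \<noteq> 0 \<and>
      card {x. x \<in> {-2<..<2} \<and> poly (smult a (q (Suc n)) + smult b (q n) + smult \<eta> r) x = 0} \<ge> n"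
      by (rule combination_stable[OF ab r n]) blast
    show "\<exists>\<eta>>0. card {x. x \<in> {-2<..<2} \<and> poly (smult a (q (Suc n)) + smult b (q n) + smult \<eta> r) x = 0} \<ge> n"
      using \<eta>0(2)[of "\<eta>0 / 2"] \<eta>0(1) by (intro exI[of _ "\<eta>0 / 2"]) auto
  next
    show "smult a (q (Suc n)) + smult b (q n) \<noteq> 0" if "(a, b) \<noteq> (0, 0)" for a b
      by (rule combination_nonzero[OF that n])
  qed (rule le_SucI[OF q_deg], rule q_deg, rule n)
  have "strictly_interlace_sets {x. poly (q n) x = 0} {x. poly (q (Suc n)) x = 0}"
    by (rule strictly_interlace_sets_if_wronskian[of "{-2<..<2}", OF W _ zeros_of_q(4)[OF n] zeros_of_q(4)[OF n']
          zeros_of_q(3)[OF n] zeros_of_q(3)[OF n']]) auto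
  moreover have "simple_zeros_in UNIV (q n)" "simple_zeros_in UNIV (q (Suc n))"
    using zeros_of_q(1)[OF n] zeros_of_q(1)[OF n'] unfolding simple_zeros_in_def by blast+
  ultimately show ?thesis unfolding strictly_interlace_def by blast
qed

end

section \<open>Fourier expansions and Dirichlet series\<close>

lemma periodic_int_multiple:
  fixes g :: "complex \<Rightarrow> complex" and h :: real
  assumes "\<And>z. Im z > 0 \<Longrightarrow> g (z + of_real h) = g z" "Im z > 0"
  shows "g (z + of_real (of_int m * h)) = g z"
proof -
  have nat: "g (z + of_real (real n * h)) = g z" if "Im z > 0" for n z
  proof (induction n)
    case (Suc n)
    have "g (z + of_real (real (Suc n) * h)) = g (z + of_real (real n * h) + of_real h)"
      by (simp add: algebra_simps)
    also have "\<dots> = g (z + of_real (real n * h))" by (rule assms(1)) (use that in simp)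
    finally show ?case using Suc by simp
  qed simp
  show ?thesis
  proof (cases "m \<ge> 0")
    case True
    thus ?thesis using nat[OF assms(2), of "nat m"] by simp
  next
    case False
    define w where "w = z + of_real (of_int m * h)"
    have "Im w > 0" using assms(2) by (simp add: w_def)
    from nat[OF this, of "nat (-m)"] False show ?thesis by (simp add: w_def)
  qed
qed

text \<open>Periodicity makes the composition with the logarithm independent of the branch. Two slit
  discs with suitable branches cover the punctured disc, and the decay at infinity makes 0 a
  removable singularity.\<close>

lemma q_expansion_exists:
  fixes g :: "complex \<Rightarrow> complex" and h :: real
  assumes holo: "g holomorphic_on {z. Im z > 0}" and h: "h > 0"
    and per: "\<And>z. Im z > 0 \<Longrightarrow> g (z + of_real h) = g z"
    and lim: "(g \<longlongrightarrow> 0) (filtercomap Im at_top)"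
  obtains G where "G holomorphic_on ball 0 1" "G 0 = 0"
    "\<And>z. Im z > 0 \<Longrightarrow> g z = G (exp (2 * of_real pi * \<i> * z / of_real h))"
proof -
  define \<tau> where "\<tau> = (\<lambda>l::complex. of_real h * l / (2 * of_real pi * \<i>))"
  have Im\<tau>: "Im (\<tau> l) = - h * Re l / (2 * pi)" for l
    by (simp add: \<tau>_def Im_divide power2_eq_square field_simps)
  define G where "G = (\<lambda>q. if q = 0 then 0 else g (\<tau> (Ln q)))"
  have ge: "g (\<tau> l) = g (\<tau> l')" if e: "exp l = exp l'" and r: "Re l < 0" for l l'
  proof -
    obtain n :: int where n: "l' = l + (of_int (2 * n) * pi) * \<i>" using exp_eq[of l' l] e[symmetric] by blast
    have "\<tau> l' = \<tau> l + of_real (of_int n * h)"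
      unfolding n \<tau>_def by (simp add: field_simps)
    thus ?thesis using periodic_int_multiple[of g h, OF per, of "\<tau> l" n] r h
      by (simp add: Im\<tau> divide_neg_pos mult_pos_neg)
  qed
  have gG: "g z = G (exp (2 * of_real pi * \<i> * z / of_real h))" if z: "Im z > 0" for z
  proof -
    define l where "l = 2 * of_real pi * \<i> * z / of_real h"
    have "\<tau> l = z" using h by (simp add: \<tau>_def l_def)
    moreover have "Re l < 0" using z h by (simp add: l_def)
    ultimately have "g z = g (\<tau> (Ln (exp l)))" using ge[of l "Ln (exp l)"] by simp
    thus ?thesis by (simp add: G_def l_def)
  qed
  have Re_lt: "Re l < 0" if "norm (exp l) < 1" for l :: complex using that by simp
  have pos: "Im (\<tau> l) > 0" if "Re l < 0" for l
    using that h by (simp add: Im\<tau> divide_neg_pos mult_pos_neg)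
  have local: "G holomorphic_on S" if S: "open S" "S \<subseteq> ball 0 1 - {0}" and L: "L holomorphic_on S"
    "\<And>q. q \<in> S \<Longrightarrow> exp (L q) = q" for S L
  proof (rule holomorphic_transform[of "\<lambda>q. g (\<tau> (L q))"])
    have n: "Re (L q) < 0" if "q \<in> S" for q
    proof -
      have "norm (exp (L q)) < 1" using L(2)[OF that] that S(2) by auto
      thus ?thesis by (rule Re_lt)
    qed
    have "(\<lambda>q. \<tau> (L q)) holomorphic_on S" unfolding \<tau>_def by (intro holomorphic_intros L(1)) auto
    thus "(\<lambda>q. g (\<tau> (L q))) holomorphic_on S"
      using holomorphic_on_compose_gen[of "\<lambda>q. \<tau> (L q)" S g, OF _ holo] n pos by (simp add: o_def image_subset_iff)
    fix q assume q: "q \<in> S"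
    hence "q \<noteq> 0" using S(2) by auto
    thus "g (\<tau> (L q)) = G q" using ge[of "L q" "Ln q"] L(2)[OF q] n[OF q] by (simp add: G_def)
  qed
  define S1 where "S1 = ball 0 1 - {z :: complex. z \<in> \<real>\<^sub>\<le>\<^sub>0}"
  define S2 where "S2 = ball 0 1 - {z :: complex. z \<in> \<real>\<^sub>\<ge>\<^sub>0}"
  have "G holomorphic_on S1"
  proof (rule local[of _ Ln])
    show "exp (Ln q) = q" if "q \<in> S1" for q using that by (cases "q = 0") (auto simp: S1_def)
  qed (auto simp: S1_def intro!: holomorphic_intros open_Diff)
  moreover have "G holomorphic_on S2"
  proof (rule local[of _ "\<lambda>q. Ln (- q) + \<i> * of_real pi"])
    show "open S2" unfolding S2_def by (intro open_Diff) auto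
    show "S2 \<subseteq> ball 0 1 - {0}" by (auto simp: S2_def)
    show "(\<lambda>q. Ln (- q) + \<i> * of_real pi) holomorphic_on S2"
      by (intro holomorphic_intros) (auto simp: S2_def complex_nonpos_Reals_iff complex_nonneg_Reals_iff)
    show "exp (Ln (- q) + \<i> * of_real pi) = q" if "q \<in> S2" for q
      using that by (cases "q = 0") (auto simp: S2_def exp_add)
  qed
  ultimately have "G holomorphic_on (S1 \<union> S2)"
    by (rule holomorphic_on_Un) (auto simp: S1_def S2_def intro!: open_Diff)
  moreover have "S1 \<union> S2 = ball 0 1 - {0}"
    by (auto simp: S1_def S2_def complex_nonpos_Reals_iff complex_nonneg_Reals_iff complex_eq_iff)
  ultimately have hG: "G holomorphic_on ball 0 1 - {0}" by simp
  have "G holomorphic_on ball 0 1"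
  proof (rule no_isolated_singularity'[OF _ hG])
    fix z :: complex assume "z \<in> {0}"
    have "(G \<longlongrightarrow> 0) (at 0)"
    proof (rule tendstoI)
      fix e :: real assume "e > 0"
      hence "\<forall>\<^sub>F z in filtercomap Im at_top. dist (g z) 0 < e" using lim by (rule tendstoD[rotated])
      then obtain P where P: "eventually P at_top" "\<And>z. P (Im z) \<Longrightarrow> dist (g z) 0 < e"
        unfolding eventually_filtercomap by blast
      then obtain Y where Y: "\<And>y. y \<ge> Y \<Longrightarrow> P y" unfolding eventually_at_top_linorder by blast
      define \<delta> where "\<delta> = min 1 (exp (- (2 * pi * Y / h)))"
      have "dist (G q) 0 < e" if q: "q \<noteq> 0" "norm q < \<delta>" for q
      proof -
        have "norm q < exp (- (2 * pi * Y / h))" using q by (simp add: \<delta>_def)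
        hence "ln (norm q) < - (2 * pi * Y / h)" using q(1) by (metis exp_less_cancel_iff exp_ln zero_less_norm_iff)
        hence "Im (\<tau> (Ln q)) \<ge> Y" using h q(1) by (simp add: Im\<tau> field_simps)
        thus ?thesis using P(2) Y q by (simp add: G_def)
      qed
      moreover have "\<delta> > 0" by (simp add: \<delta>_def)
      ultimately show "\<forall>\<^sub>F q in at 0. dist (G q) 0 < e"
        unfolding eventually_at by (auto intro!: exI[of _ \<delta>])
    qed
    thus "(G \<longlongrightarrow> G z) (at z within ball 0 1)"
      using \<open>z \<in> {0}\<close> tendsto_within_subset by (fastforce simp: G_def)
  qed auto
  thus ?thesis using that[of G] gG by (simp add: G_def)
qed

section \<open>Mean squares of power series coefficients and absolute convergence\<close>

lemma powser_coeffs_zero: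
  fixes c :: "nat \<Rightarrow> complex"
  assumes "\<And>q. q \<noteq> 0 \<Longrightarrow> norm q < r \<Longrightarrow> (\<lambda>n. c n * q ^ n) sums 0" "r > 0"
  shows "c n = 0"
  using assms(1)
proof (induction n arbitrary: c)
  case 0
  have "((\<lambda>_::complex. 0) \<longlongrightarrow> c 0) (at 0)"
    by (rule powser_limit_0_strong[OF assms(2) 0])
  thus ?case using tendsto_unique[OF _ tendsto_const] by (metis at_neq_bot)
next
  case (Suc n)
  have "((\<lambda>_::complex. 0) \<longlongrightarrow> c 0) (at 0)"
    by (rule powser_limit_0_strong[OF assms(2) Suc.prems])
  hence c0: "c 0 = 0" using tendsto_unique[OF _ tendsto_const] by (metis at_neq_bot)
  show ?case
  proof (rule Suc.IH[of "\<lambda>n. c (Suc n)"])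
    fix q :: complex assume q: "q \<noteq> 0" "norm q < r"
    have "(\<lambda>n. c (Suc n) * q ^ Suc n) sums (0 - c 0 * q ^ 0)"
      using Suc.prems[OF q] by (subst sums_Suc_iff) simp
    hence "(\<lambda>n. inverse q * (c (Suc n) * q ^ Suc n)) sums (inverse q * 0)"
      using c0 by (intro sums_mult) simp
    moreover have "inverse q * (c (Suc n) * q ^ Suc n) = c (Suc n) * q ^ n" for n using q(1) by simp
    ultimately show "(\<lambda>n. c (Suc n) * q ^ n) sums 0" by (simp only: mult_zero_right)
  qed
qed

text \<open>Averaging over the L-th roots of unity replaces integration over the circle; for
  polynomials of degree below L the identity is exact.\<close>

lemma discrete_Parseval:
  fixes c :: "nat \<Rightarrow> complex"
  assumes L: "L > 0"
  shows "(\<Sum>j<L. (norm (\<Sum>n<L. c n * cis (2 * pi * real j / real L) ^ n))\<^sup>2) = real L * (\<Sum>n<L. (norm (c n))\<^sup>2)"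
proof -
  define \<omega> where "\<omega> = (\<lambda>j. cis (2 * pi * real j / real L))"
  have orth: "(\<Sum>j<L. \<omega> j ^ n * cnj (\<omega> j ^ m)) = (if n = m then of_nat L else 0)" if nm: "n < L" "m < L" for n m
  proof -
    define \<zeta> where "\<zeta> = cis (2 * pi * (real n - real m) / real L)"
    have pow: "\<omega> j ^ n * cnj (\<omega> j ^ m) = \<zeta> ^ j" for j
    proof -
      have "\<omega> j ^ n * cnj (\<omega> j ^ m) = cis (real n * (2 * pi * real j / real L) + - (real m * (2 * pi * real j / real L)))"
        by (simp only: \<omega>_def Complex.DeMoivre cis_cnj cis_mult)
      also have "\<dots> = \<zeta> ^ j"
        unfolding \<zeta>_def Complex.DeMoivre by (intro arg_cong[of _ _ cis]) (simp add: algebra_simps diff_divide_distrib)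
      finally show ?thesis .
    qed
    show ?thesis
    proof (cases "n = m")
      case True
      thus ?thesis unfolding pow by (simp add: \<zeta>_def)
    next
      case False
      have "\<zeta> \<noteq> 1"
      proof
        assume "\<zeta> = 1"
        hence "cos (2 * pi * (real n - real m) / real L) = 1" by (simp add: \<zeta>_def complex_eq_iff)
        then obtain i :: int where "2 * pi * (real n - real m) / real L = of_int i * 2 * pi"
          using cos_one_2pi_int by auto
        hence "2 * pi * (real n - real m) = 2 * pi * (of_int i * real L)"
          using L by (simp only: divide_eq_eq of_nat_eq_0_iff) (simp add: mult_ac)
        hence "real n - real m = of_int i * real L" using pi_neq_zero by simp
        hence "of_int (int n - int m) = (of_int (i * int L) :: real)" by simp
        hence e: "int n - int m = i * int L" using of_int_eq_iff by blast
        have "\<bar>int n - int m\<bar> < int L" using nm by linarith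
        hence "\<bar>i\<bar> * int L < 1 * int L" unfolding e abs_mult by simp
        hence "\<bar>i\<bar> < 1" using mult_less_cancel_right[of "\<bar>i\<bar>" "int L" 1] L by simp
        thus False using e False by simp
      qed
      moreover have "\<zeta> ^ L = 1"
      proof -
        have "\<zeta> ^ L = cis (2 * pi * of_int (int n - int m))"
          unfolding \<zeta>_def Complex.DeMoivre using L by (intro arg_cong[of _ _ cis]) simp
        thus ?thesis by (simp only: cis_multiple_2pi Ints_of_int)
      qed
      ultimately show ?thesis using False unfolding pow by (simp add: geometric_sum)
    qed
  qed
  have "complex_of_real (\<Sum>j<L. (norm (\<Sum>n<L. c n * \<omega> j ^ n))\<^sup>2)
      = (\<Sum>j<L. (\<Sum>n<L. c n * \<omega> j ^ n) * cnj (\<Sum>m<L. c m * \<omega> j ^ m))"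
    unfolding of_real_sum by (intro sum.cong refl) (rule complex_norm_square)
  also have "\<dots> = (\<Sum>j<L. \<Sum>n<L. \<Sum>m<L. c n * cnj (c m) * (\<omega> j ^ n * cnj (\<omega> j ^ m)))"
    unfolding cnj_sum sum_product by (intro sum.cong refl) simp
  also have "\<dots> = (\<Sum>n<L. \<Sum>m<L. c n * cnj (c m) * (\<Sum>j<L. \<omega> j ^ n * cnj (\<omega> j ^ m)))"
    unfolding sum_distrib_left by (subst sum.swap) (intro sum.cong refl sum.swap)
  also have "\<dots> = (\<Sum>n<L. \<Sum>m<L. if n = m then c n * cnj (c m) * of_nat L else 0)"
    by (intro sum.cong refl, subst orth) auto
  also have "\<dots> = (\<Sum>n<L. of_real ((norm (c n))\<^sup>2) * of_nat L)"
    by (simp add: complex_norm_square del: of_real_power)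
  also have "\<dots> = complex_of_real (real L * (\<Sum>n<L. (norm (c n))\<^sup>2))"
    by (simp add: sum_distrib_left mult.commute)
  finally show ?thesis unfolding \<omega>_def of_real_eq_iff .
qed

text \<open>The series is truncated after \<open>L\<close> terms, where the tail is uniformly below
  \<eta>, and the truncation is sampled at \<open>L\<close> points. The choice of \<eta> makes (B +
  \<eta>)^2 at most B^2 + \<epsilon>.\<close>

lemma powser_mean_square_bound:
  fixes a :: "nat \<Rightarrow> complex"
  assumes sm: "summable (\<lambda>n. norm (a n) * r ^ n)" and r: "r \<ge> 0" and B: "B \<ge> 0"
    and bd: "\<And>q. norm q = r \<Longrightarrow> norm (\<Sum>n. a n * q ^ n) \<le> B"
  shows "(\<Sum>n<K. (norm (a n))\<^sup>2 * r ^ (2 * n)) \<le> B\<^sup>2"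
proof (rule field_le_epsilon)
  fix \<epsilon> :: real assume \<epsilon>: "\<epsilon> > 0"
  define \<eta> where "\<eta> = min 1 (\<epsilon> / (2 * B + 1))"
  have \<eta>: "\<eta> > 0" "\<eta> \<le> 1" "\<eta> * (2 * B + 1) \<le> \<epsilon>"
  proof -
    have "\<eta> \<le> \<epsilon> / (2 * B + 1)" by (simp add: \<eta>_def)
    thus "\<eta> * (2 * B + 1) \<le> \<epsilon>" using B by (simp add: pos_le_divide_eq)
  qed (use \<epsilon> B in \<open>auto simp: \<eta>_def\<close>)
  obtain L0 where L0: "\<And>n. n \<ge> L0 \<Longrightarrow> norm (\<Sum>i. norm (a (i + n)) * r ^ (i + n)) < \<eta>"
    using suminf_exist_split[OF \<eta>(1) sm] by auto
  define L where "L = max (max L0 K) 1"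
  have L: "L \<ge> L0" "L \<ge> K" "L > 0" by (auto simp: L_def)
  have part: "norm (\<Sum>n<L. a n * q ^ n) \<le> B + \<eta>" if q: "norm q = r" for q
  proof -
    have sq: "summable (\<lambda>n. norm (a n * q ^ n))" using sm q by (simp add: norm_mult norm_power)
    have "(\<Sum>n. a n * q ^ n) = (\<Sum>n. a (n + L) * q ^ (n + L)) + (\<Sum>n<L. a n * q ^ n)"
      by (rule suminf_split_initial_segment[OF summable_norm_cancel[OF sq]])
    moreover have "norm (\<Sum>n. a (n + L) * q ^ (n + L)) \<le> (\<Sum>n. norm (a (n + L) * q ^ (n + L)))"
      by (rule summable_norm) (use summable_ignore_initial_segment[OF sq, of L] in simp)
    moreover have "(\<Sum>n. norm (a (n + L) * q ^ (n + L))) < \<eta>"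
      using L0[OF L(1)] q by (simp add: norm_mult norm_power)
    ultimately show ?thesis using bd[OF q]
      norm_triangle_ineq4[of "\<Sum>n. a n * q ^ n" "\<Sum>n. a (n + L) * q ^ (n + L)"] by simp
  qed
  have "real L * (\<Sum>n<L. (norm (a n * of_real r ^ n))\<^sup>2) =
      (\<Sum>j<L. (norm (\<Sum>n<L. a n * of_real r ^ n * cis (2 * pi * real j / real L) ^ n))\<^sup>2)"
    by (rule discrete_Parseval[OF L(3), symmetric])
  also have "\<dots> \<le> (\<Sum>j<L. (B + \<eta>)\<^sup>2)"
  proof (intro sum_mono power_mono)
    fix j
    show "norm (\<Sum>n<L. a n * of_real r ^ n * cis (2 * pi * real j / real L) ^ n) \<le> B + \<eta>"
      using part[of "of_real r * cis (2 * pi * real j / real L)"] r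
      by (simp add: norm_mult power_mult_distrib mult.assoc)
  qed auto
  also have "\<dots> = real L * (B + \<eta>)\<^sup>2" by simp
  finally have "(\<Sum>n<L. (norm (a n * of_real r ^ n))\<^sup>2) \<le> (B + \<eta>)\<^sup>2" using L(3) by simp
  moreover have "(\<Sum>n<K. (norm (a n))\<^sup>2 * r ^ (2 * n)) \<le> (\<Sum>n<L. (norm (a n))\<^sup>2 * r ^ (2 * n))"
    using L(2) r by (intro sum_mono2) auto
  moreover have "(norm (a n * of_real r ^ n))\<^sup>2 = (norm (a n))\<^sup>2 * r ^ (2 * n)" for n
    using r by (simp add: norm_mult norm_power power_mult_distrib power_mult[symmetric] mult.commute)
  moreover have "(B + \<eta>)\<^sup>2 \<le> B\<^sup>2 + \<epsilon>"
  proof -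
    have "(B + \<eta>)\<^sup>2 = B\<^sup>2 + \<eta> * (2 * B + \<eta>)" by (simp add: power2_eq_square algebra_simps)
    also have "\<eta> * (2 * B + \<eta>) \<le> \<eta> * (2 * B + 1)" using \<eta> by (intro mult_left_mono) auto
    finally show ?thesis using \<eta>(3) by simp
  qed
  ultimately show "(\<Sum>n<K. (norm (a n))\<^sup>2 * r ^ (2 * n)) \<le> B\<^sup>2 + \<epsilon>" by simp
qed

lemma dyadic_sum: "(\<Sum>n<2 ^ J. (f::nat\<Rightarrow>real) n) = f 0 + (\<Sum>j<J. \<Sum>n\<in>{2^j..<2^Suc j}. f n)"
proof (induction J)
  case (Suc J)
  have "{..<2 ^ Suc J} = {..<2 ^ J} \<union> {2 ^ J..<2 ^ Suc J :: nat}" by auto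
  hence "(\<Sum>n<2 ^ Suc J. f n) = (\<Sum>n<2 ^ J. f n) + (\<Sum>n\<in>{2^J..<2^Suc J}. f n)"
    using sum.union_disjoint[of "{..<2 ^ J}" "{2 ^ J..<2 ^ Suc J :: nat}" f] by fastforce
  thus ?case using Suc by simp
qed simp

text \<open>Cauchy--Schwarz turns the mean square bound of order \<open>X ^ k\<close> into absolute convergence
  half a unit further to the left than the pointwise bound would give.\<close>

lemma summable_if_mean_square_bound:
  fixes a :: "nat \<Rightarrow> complex"
  assumes ms: "\<And>X. X \<ge> 1 \<Longrightarrow> (\<Sum>n<X. (norm (a n))\<^sup>2) \<le> C * real X ^ k" and C: "C \<ge> 0"
    and \<sigma>: "\<sigma> > (real k + 1) / 2"
  shows "summable (\<lambda>n. norm (a n) * real n powr (-\<sigma>))"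
proof -
  \<comment> \<open>The excess 2 \<sigma> - (k + 1) is divided equally between the two factors:
    n^(-(k+\<eta>)/2), which goes with the coefficients, and n^(-(1+\<eta>)/2). Both are square
    summable.\<close>
  define \<eta> where "\<eta> = (2 * \<sigma> - real k - 1) / 2"
  have \<eta>: "\<eta> > 0" using \<sigma> by (simp add: \<eta>_def field_simps)
  have s\<eta>: "2 * \<sigma> = real k + 1 + 2 * \<eta>" by (simp add: \<eta>_def field_simps)
  define u where "u = (\<lambda>n. (norm (a n))\<^sup>2 * real n powr (-(real k + \<eta>)))"
  have u0: "u n \<ge> 0" for n by (simp add: u_def)
  have blk: "(\<Sum>n\<in>{2^j..<2^Suc j}. u n) \<le> C * 2 ^ k * (2 powr (-\<eta>)) ^ j" for j
  proof -
    have "(\<Sum>n\<in>{2^j..<2^Suc j}. u n) \<le> (\<Sum>n\<in>{2^j..<2^Suc j}. (norm (a n))\<^sup>2 * (2 ^ j) powr (-(real k + \<eta>)))"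
    proof (intro sum_mono)
      fix n :: nat assume n: "n \<in> {2^j..<2^Suc j}"
      have "real n \<ge> 2 ^ j" using n by (metis atLeastLessThan_iff of_nat_le_iff of_nat_numeral of_nat_power)
      hence "real n powr (-(real k + \<eta>)) \<le> (2 ^ j) powr (-(real k + \<eta>))"
        using \<eta> by (intro powr_mono2') auto
      thus "u n \<le> (norm (a n))\<^sup>2 * (2 ^ j) powr (-(real k + \<eta>))"
        unfolding u_def by (intro mult_left_mono) auto
    qed
    also have "\<dots> = (\<Sum>n\<in>{2^j..<2^Suc j}. (norm (a n))\<^sup>2) * (2 ^ j) powr (-(real k + \<eta>))"
      by (simp add: sum_distrib_right)
    also have "\<dots> \<le> (\<Sum>n<2^Suc j. (norm (a n))\<^sup>2) * (2 ^ j) powr (-(real k + \<eta>))"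
      by (intro mult_right_mono sum_mono2) auto
    also have "\<dots> \<le> (C * real (2 ^ Suc j) ^ k) * (2 ^ j) powr (-(real k + \<eta>))"
      by (intro mult_right_mono ms) auto
    also have "\<dots> = C * 2 ^ k * (2 powr (-\<eta>)) ^ j"
    proof -
      have "(2 ^ j) powr (-(real k + \<eta>)) = (2 powr (-\<eta>)) ^ j * inverse ((2 ^ j) ^ k :: real)"
      proof -
        have "(2 ^ j :: real) powr (-(real k + \<eta>)) = (2 ^ j) powr (-real k) * (2 ^ j) powr (-\<eta>)"
          by (simp add: powr_add[symmetric])
        moreover have "(2 ^ j :: real) powr (-real k) = inverse ((2 ^ j) ^ k)" by (simp add: powr_minus powr_realpow)
        moreover have "(2 ^ j :: real) powr (-\<eta>) = (2 powr (-\<eta>)) ^ j"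
          by (simp add: powr_power powr_realpow[symmetric] powr_powr mult.commute)
        ultimately show ?thesis by simp
      qed
      moreover have "real (2 ^ Suc j) ^ k = 2 ^ k * (2 ^ j) ^ k" by (simp add: power_mult_distrib)
      ultimately show ?thesis by simp
    qed
    finally show ?thesis .
  qed
  define \<rho> where "\<rho> = 2 powr (-\<eta>)"
  have \<rho>: "0 \<le> \<rho>" "\<rho> < 1" using \<eta> by (auto simp: \<rho>_def powr_less_one)
  have sumu: "summable u"
  proof (rule bounded_imp_summable[where B = "u 0 + C * 2 ^ k * (1 / (1 - \<rho>))"])
    fix n
    have "(\<Sum>i\<le>n. u i) \<le> (\<Sum>i<2 ^ Suc n. u i)"
    proof (intro sum_mono2)
      have "Suc n < 2 ^ Suc n" by (rule less_exp)
      thus "{..n} \<subseteq> {..<2 ^ Suc n}" by auto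
    qed (use u0 in auto)
    also have "\<dots> \<le> u 0 + (\<Sum>j<Suc n. C * 2 ^ k * \<rho> ^ j)"
      unfolding dyadic_sum using blk by (intro add_left_mono sum_mono) (simp add: \<rho>_def)
    also have "(\<Sum>j<Suc n. C * 2 ^ k * \<rho> ^ j) \<le> C * 2 ^ k * (1 / (1 - \<rho>))"
    proof -
      have "(\<Sum>j<Suc n. \<rho> ^ j) \<le> (\<Sum>j. \<rho> ^ j)" by (rule sum_le_suminf) (use \<rho> in \<open>auto intro: summable_geometric\<close>)
      also have "\<dots> = 1 / (1 - \<rho>)" by (rule suminf_geometric) (use \<rho> in auto)
      finally have "C * 2 ^ k * (\<Sum>j<Suc n. \<rho> ^ j) \<le> C * 2 ^ k * (1 / (1 - \<rho>))"
        using C by (intro mult_left_mono) auto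
      thus ?thesis by (simp only: sum_distrib_left)
    qed
    finally show "(\<Sum>i\<le>n. u i) \<le> u 0 + C * 2 ^ k * (1 / (1 - \<rho>))" by simp
  qed (rule u0)
  have sv: "summable (\<lambda>n. real n powr (-1 - \<eta>))" by (subst summable_real_powr_iff) (use \<eta> in auto)
  show ?thesis
  proof (rule summable_comparison_test'[OF summable_add[OF sumu sv]])
    fix n :: nat
    have pp: "real n powr (-(real k + \<eta>)) * real n powr (-1 - \<eta>) = (real n powr (-\<sigma>))\<^sup>2"
    proof -
      have "-(real k + \<eta>) + (-1 - \<eta>) = -\<sigma> + -\<sigma>" using s\<eta> by simp
      thus ?thesis by (metis powr_add power2_eq_square)
    qed
    define x y where "x = norm (a n) * sqrt (real n powr (-(real k + \<eta>)))" and "y = sqrt (real n powr (-1 - \<eta>))"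
    have "x * y = norm (a n) * real n powr (-\<sigma>)"
    proof -
      have "x * y = norm (a n) * sqrt (real n powr (-(real k + \<eta>)) * real n powr (-1 - \<eta>))"
        by (simp add: x_def y_def real_sqrt_mult)
      thus ?thesis unfolding pp by simp
    qed
    moreover have "2 * (x * y) \<le> x\<^sup>2 + y\<^sup>2" using sum_squares_bound[of x y] by (simp add: mult.assoc)
    moreover have "x\<^sup>2 = u n" "y\<^sup>2 = real n powr (-1 - \<eta>)" by (auto simp: x_def y_def u_def power_mult_distrib)
    moreover have "norm (a n) * real n powr (-\<sigma>) \<ge> 0" by simp
    ultimately have "norm (a n) * real n powr (-\<sigma>) \<le> u n + real n powr (-1 - \<eta>)" by linarith
    thus "norm (norm (a n) * real n powr (-\<sigma>)) \<le> u n + real n powr (-1 - \<eta>)"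
      by (simp add: abs_mult)
  qed
qed

text \<open>Removing one Euler factor. The sum over the multiples of \<open>p\<close> in
  \<open>A\<close> is expressed by the sum over \<open>A\<close> through the recursion; for a Hecke
  eigenform 1 - \<alpha> + \<beta> is the polynomial 1 - a(p) p^(-s) + chi(p) p^(k-1-2s).\<close>

lemma abs_summable_multiples:
  fixes D :: "nat \<Rightarrow> complex"
  assumes p: "p > 0" and sm: "(\<lambda>n. norm (D n)) summable_on UNIV"
    and A: "\<And>t. p * t \<in> A \<longleftrightarrow> t \<in> A"
    and rel: "\<And>t. t \<in> A \<Longrightarrow> D (p * t) = \<alpha> * D t - (if p dvd t then \<beta> * D (t div p) else 0)"
  shows "(1 - \<alpha> + \<beta>) * (\<Sum>\<^sub>\<infinity>n\<in>A. D n) = (\<Sum>\<^sub>\<infinity>n\<in>{n\<in>A. \<not> p dvd n}. D n)"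
proof -
  have s: "D summable_on B" for B
    using abs_summable_summable[OF summable_on_subset_banach[OF sm subset_UNIV]] .
  have split: "A = {n\<in>A. \<not> p dvd n} \<union> (\<lambda>t. p * t) ` A" "{n\<in>A. \<not> p dvd n} \<inter> (\<lambda>t. p * t) ` A = {}"
    using A by (auto elim!: dvdE)
  have inj: "inj_on (\<lambda>t. p * t) B" for B using p by (auto simp: inj_on_def)
  have mult: "(\<Sum>\<^sub>\<infinity>n\<in>(\<lambda>t. p * t) ` A. D n) = (\<Sum>\<^sub>\<infinity>t\<in>A. D (p * t))"
    using infsum_reindex[OF inj, of D A] by (simp add: o_def)
  have s2: "(\<lambda>t. if p dvd t then \<beta> * D (t div p) else 0) summable_on A"
    and e2: "(\<Sum>\<^sub>\<infinity>t\<in>A. if p dvd t then \<beta> * D (t div p) else 0) = \<beta> * (\<Sum>\<^sub>\<infinity>t\<in>A. D t)"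
  proof -
    have hs: "((\<lambda>t. \<beta> * D t) has_sum (\<beta> * (\<Sum>\<^sub>\<infinity>t\<in>A. D t))) A"
      by (intro has_sum_cmult_right has_sum_infsum s)
    have "((\<lambda>t. if p dvd t then \<beta> * D (t div p) else 0) \<circ> (\<lambda>t. p * t)) = (\<lambda>t. \<beta> * D t)"
      using p by auto
    hence "((\<lambda>t. if p dvd t then \<beta> * D (t div p) else 0) has_sum (\<beta> * (\<Sum>\<^sub>\<infinity>t\<in>A. D t))) ((\<lambda>t. p * t) ` A)"
      using hs by (subst has_sum_reindex[OF inj]) simp
    hence "((\<lambda>t. if p dvd t then \<beta> * D (t div p) else 0) has_sum (\<beta> * (\<Sum>\<^sub>\<infinity>t\<in>A. D t))) A"
      by (rule has_sum_cong_neutral[THEN iffD1, rotated -1]) (use A in \<open>auto elim!: dvdE\<close>)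
    thus "(\<lambda>t. if p dvd t then \<beta> * D (t div p) else 0) summable_on A"
      "(\<Sum>\<^sub>\<infinity>t\<in>A. if p dvd t then \<beta> * D (t div p) else 0) = \<beta> * (\<Sum>\<^sub>\<infinity>t\<in>A. D t)"
      by (auto simp: summable_on_def infsumI)
  qed
  have s1: "(\<lambda>t. \<alpha> * D t) summable_on A" by (intro summable_on_cmult_right s)
  have "(\<Sum>\<^sub>\<infinity>t\<in>A. D (p * t)) = (\<Sum>\<^sub>\<infinity>t\<in>A. \<alpha> * D t - (if p dvd t then \<beta> * D (t div p) else 0))"
    by (intro infsum_cong rel)
  also have "\<dots> = (\<Sum>\<^sub>\<infinity>t\<in>A. \<alpha> * D t) - (\<Sum>\<^sub>\<infinity>t\<in>A. if p dvd t then \<beta> * D (t div p) else 0)"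
    using infsum_add[OF s1 summable_on_uminus[THEN iffD2, OF s2]] by (simp add: infsum_uminus)
  also have "\<dots> = \<alpha> * (\<Sum>\<^sub>\<infinity>t\<in>A. D t) - \<beta> * (\<Sum>\<^sub>\<infinity>t\<in>A. D t)"
    unfolding e2 by (subst infsum_cmult_right) (use s in auto)
  finally have "(\<Sum>\<^sub>\<infinity>n\<in>A. D n) = (\<Sum>\<^sub>\<infinity>n\<in>{n\<in>A. \<not> p dvd n}. D n) + (\<alpha> * (\<Sum>\<^sub>\<infinity>t\<in>A. D t) - \<beta> * (\<Sum>\<^sub>\<infinity>t\<in>A. D t))"
    using infsum_Un_disjoint[OF s s split(2)] split(1) mult by metis
  thus ?thesis by (simp add: algebra_simps)
qed

text \<open>Removing the Euler factors of the primes up to \<open>P\<close> leaves \<open>1\<close> plus a tail that tends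
  to zero, so no convergence of the Euler product is needed.\<close>

lemma hecke_series_nonzero:
  fixes D :: "nat \<Rightarrow> complex"
  assumes sm: "(\<lambda>n. norm (D n)) summable_on UNIV" and D: "D 1 = 1" "D 0 = 0"
    and rel: "\<And>p t. prime p \<Longrightarrow> t > 0 \<Longrightarrow> D (p * t) = \<alpha> p * D t - (if p dvd t then \<beta> p * D (t div p) else 0)"
  shows "(\<Sum>\<^sub>\<infinity>n\<in>UNIV. D n) \<noteq> 0"
proof
  assume 0: "(\<Sum>\<^sub>\<infinity>n\<in>UNIV. D n) = 0"
  have s: "D summable_on B" for B
    using abs_summable_summable[OF summable_on_subset_banach[OF sm subset_UNIV]] .
  define A where "A = (\<lambda>P::nat. {n. n > 0 \<and> (\<forall>p. prime p \<longrightarrow> p \<le> P \<longrightarrow> \<not> p dvd n)})"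
  have zero: "(\<Sum>\<^sub>\<infinity>n\<in>A P. D n) = 0" for P
  proof (induction P)
    case 0
    have "A 0 = {n. n > 0}" unfolding A_def by (auto dest: prime_gt_0_nat)
    moreover have "(\<Sum>\<^sub>\<infinity>n\<in>{n. n > 0}. D n) = (\<Sum>\<^sub>\<infinity>n\<in>UNIV. D n)"
      by (rule infsum_cong_neutral) (use D in auto)
    ultimately show ?case using \<open>(\<Sum>\<^sub>\<infinity>n\<in>UNIV. D n) = 0\<close> by simp
  next
    case (Suc P)
    show ?case
    proof (cases "prime (Suc P)")
      case False
      hence "A (Suc P) = A P" unfolding A_def by (metis le_Suc_eq)
      thus ?thesis using Suc by simp
    next
      case True
      have "A (Suc P) = {n\<in>A P. \<not> Suc P dvd n}" using True unfolding A_def by (auto simp: le_Suc_eq)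
      moreover have "(1 - \<alpha> (Suc P) + \<beta> (Suc P)) * (\<Sum>\<^sub>\<infinity>n\<in>A P. D n) = (\<Sum>\<^sub>\<infinity>n\<in>{n\<in>A P. \<not> Suc P dvd n}. D n)"
      proof (rule abs_summable_multiples[OF _ sm])
        show "Suc P * t \<in> A P \<longleftrightarrow> t \<in> A P" for t
        proof -
          have "p dvd Suc P * t \<longleftrightarrow> p dvd t" if "prime p" "p \<le> P" for p
          proof -
            have "\<not> p dvd Suc P" using that True primes_dvd_imp_eq[of p "Suc P"] by auto
            thus ?thesis using that(1) prime_dvd_mult_iff by blast
          qed
          thus ?thesis by (auto simp: A_def simp del: mult_Suc)
        qed
        show "D (Suc P * t) = \<alpha> (Suc P) * D t - (if Suc P dvd t then \<beta> (Suc P) * D (t div Suc P) else 0)" if "t \<in> A P" for t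
          using rel[OF True, of t] that by (simp add: A_def del: mult_Suc)
      qed simp
      ultimately show ?thesis using Suc by simp
    qed
  qed
  have sn: "summable (\<lambda>n. norm (D n))"
    using sm by (simp add: summable_on_UNIV_nonneg_real_iff)
  obtain M where M: "\<And>n. n \<ge> M \<Longrightarrow> norm (\<Sum>i. norm (D (i + n))) < 1"
    using suminf_exist_split[of 1 "\<lambda>n. norm (D n)"] sn by auto
  define P where "P = max M 2"
  have one: "1 \<in> A P" unfolding A_def by (auto dest: prime_gt_1_nat)
  \<comment> \<open>Apart from 1, a number without prime factors up to \<open>P\<close> exceeds
    \<open>P\<close>. The remaining sum would be -1, but it is bounded by a tail smaller than
    1.\<close>
  have sub: "A P - {1} \<subseteq> {P..}"
  proof
    fix n assume n: "n \<in> A P - {1}"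
    then obtain p where p: "prime p" "p dvd n" using prime_factor_nat[of n] by auto
    hence "P < p" using n unfolding A_def by (auto simp: not_le)
    moreover have "p \<le> n" using p n by (auto simp: A_def dvd_imp_le)
    ultimately show "n \<in> {P..}" by simp
  qed
  have "(\<Sum>\<^sub>\<infinity>n\<in>A P. D n) = D 1 + (\<Sum>\<^sub>\<infinity>n\<in>A P - {1}. D n)"
    using infsum_Un_disjoint[OF s[of "{1}"] s[of "A P - {1}"]] one by (simp add: insert_absorb)
  hence e: "(\<Sum>\<^sub>\<infinity>n\<in>A P - {1}. D n) = - 1" using zero D by (simp add: add_eq_0_iff)
  have sn': "(\<lambda>n. norm (D n)) summable_on B" for B
    using summable_on_subset_banach[OF sm subset_UNIV] .
  have "norm (\<Sum>\<^sub>\<infinity>n\<in>A P - {1}. D n) \<le> (\<Sum>\<^sub>\<infinity>n\<in>A P - {1}. norm (D n))"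
    by (rule norm_infsum_bound[OF sn'])
  also have "\<dots> \<le> (\<Sum>\<^sub>\<infinity>n\<in>{P..}. norm (D n))"
    by (rule infsum_mono_neutral[OF sn' sn']) (use sub in auto)
  also have "\<dots> = (\<Sum>\<^sub>\<infinity>i\<in>UNIV. norm (D (i + P)))"
  proof -
    have "{P..} = (\<lambda>i. i + P) ` UNIV" by (auto simp: image_iff) (metis le_add_diff_inverse2)
    thus ?thesis using infsum_reindex[of "\<lambda>i. i + P" UNIV "\<lambda>n. norm (D n)"] by (simp add: o_def)
  qed
  also have "\<dots> = (\<Sum>i. norm (D (i + P)))"
  proof -
    have "summable (\<lambda>i. norm (D (i + P)))" using sn by (rule summable_ignore_initial_segment)
    hence "(\<lambda>i. norm (D (i + P))) summable_on UNIV" by (simp add: summable_on_UNIV_nonneg_real_iff)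
    thus ?thesis using has_sum_imp_sums[OF has_sum_infsum] sums_unique by metis
  qed
  also have "\<dots> < 1" using M[of P] by (simp add: P_def)
  finally show False using e by simp
qed

section \<open>Growth of cusp forms\<close>

definition mat2 :: "int \<Rightarrow> int \<Rightarrow> int \<Rightarrow> int \<Rightarrow> int ^ 2 ^ 2" where
  "mat2 a b c d = vector [vector [a, b], vector [c, d]]"

lemma mat2_nth [simp]:
  "mat2 a b c d $ 1 $ 1 = a" "mat2 a b c d $ 1 $ 2 = b" "mat2 a b c d $ 2 $ 1 = c" "mat2 a b c d $ 2 $ 2 = d"
  by (simp_all add: mat2_def)

lemma mat2_SL2Z [simp]: "mat2 a b c d \<in> SL2Z \<longleftrightarrow> a * d - b * c = 1"
  by (simp add: SL2Z_def det_2)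

lemma mat2_Gamma0 [simp]: "mat2 a b c d \<in> Gamma0 N \<longleftrightarrow> a * d - b * c = 1 \<and> int N dvd c"
  by (simp add: Gamma0_def)

lemma slash_mat2: "slash k (mat2 a b c d) f z =
    (of_int c * z + of_int d) powi (- int k) * f ((of_int a * z + of_int b) / (of_int c * z + of_int d))"
  by (simp add: slash_def moebius_act_def)

lemma automorphy_nonzero:
  assumes "a * d - b * c = 1" "Im z > 0"
  shows "of_int c * z + of_int d \<noteq> (0 :: complex)"
proof
  assume "of_int c * z + of_int d = (0 :: complex)"
  hence "of_int c * Im z = 0" "of_int c * Re z + of_int d = 0"
    by (auto simp: complex_eq_iff)
  hence "c = 0" "d = 0" using assms(2) by auto
  thus False using assms(1) by simp
qed

lemma Im_moebius:
  assumes "a * d - b * c = (1::int)" "Im z > 0"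
  shows "Im ((of_int a * z + of_int b) / (of_int c * z + of_int d)) = Im z / (norm (of_int c * z + of_int d))\<^sup>2"
proof -
  have "real_of_int a * of_int d - of_int b * of_int c = 1"
    using arg_cong[OF assms(1), of real_of_int] by simp
  hence "(of_int a * Im z) * (of_int c * Re z + of_int d) - (of_int a * Re z + of_int b) * (of_int c * Im z) = Im z"
  proof -
    have "(of_int a * Im z) * (of_int c * Re z + of_int d) - (of_int a * Re z + of_int b) * (of_int c * Im z)
      = Im z * (real_of_int a * of_int d - of_int b * of_int c)" by (simp add: algebra_simps)
    thus ?thesis using \<open>real_of_int a * of_int d - of_int b * of_int c = 1\<close> by simp
  qed
  thus ?thesis by (simp add: Im_divide cmod_power2)
qed

lemma chi_1: "dirichlet_char N chi \<Longrightarrow> chi 1 = 1"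
  unfolding dirichlet_char_def by (metis coprime_1_left mult_cancel_right1 mult_1)

lemma chi_cong_1:
  assumes "dirichlet_char N chi" "int N dvd (a - 1)"
  shows "chi a = 1"
proof -
  have per: "chi (b + int N) = chi b" for b using assms(1) by (simp add: dirichlet_char_def)
  have nat: "chi (b + int n * int N) = chi b" for b n
  proof (induction n)
    case (Suc n)
    thus ?case using per[of "b + int n * int N"] by (simp add: algebra_simps)
  qed simp
  obtain m where m: "a - 1 = int N * m" using assms(2) by blast
  have "chi a = chi 1"
  proof (cases "m \<ge> 0")
    case True
    thus ?thesis using nat[of 1 "nat m"] m by (simp add: algebra_simps)
  next
    case False
    thus ?thesis using nat[of a "nat (-m)"] m by (simp add: algebra_simps)
  qed
  thus ?thesis using chi_1[OF assms(1)] by simp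
qed

section \<open>Bounds for the translates of a cusp form\<close>

locale cusp_form =
  fixes k N :: nat and chi :: "int \<Rightarrow> complex" and f :: "complex \<Rightarrow> complex"
  assumes N: "N \<ge> 1" and chi: "dirichlet_char N chi" and f: "f \<in> cusp_forms k N chi"
begin

lemma holo: "f holomorphic_on upper_half_plane"
  and transf: "A \<in> Gamma0 N \<Longrightarrow> Im z > 0 \<Longrightarrow> slash k A f z = chi (A $ 2 $ 2) * f z"
  and vanish: "A \<in> SL2Z \<Longrightarrow> (slash k A f \<longlongrightarrow> 0) (filtercomap Im at_top)"
  using f by (auto simp: cusp_forms_def upper_half_plane_def)

text \<open>\<open>G\<close> is the first matrix times the inverse of the second. It is congruent to
  the identity modulo \<open>N\<close>, so the character is 1 on it and the two translates coincide.
  Hence only finitely many different translates occur.\<close>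

lemma slash_cong:
  assumes A: "a * d - b * c = 1" and B: "a' * d' - b' * c' = 1"
    and cong: "int N dvd a - a'" "int N dvd b - b'" "int N dvd c - c'" "int N dvd d - d'" and z: "Im z > 0"
  shows "slash k (mat2 a b c d) f z = slash k (mat2 a' b' c' d') f z"
proof -
  define G where "G = mat2 (a * d' - b * c') (- a * b' + b * a') (c * d' - d * c') (- c * b' + d * a')"
  have det: "(a * d' - b * c') * (- c * b' + d * a') - (- a * b' + b * a') * (c * d' - d * c') = 1"
  proof -
    have "(a * d' - b * c') * (- c * b' + d * a') - (- a * b' + b * a') * (c * d' - d * c')
      = (a * d - b * c) * (a' * d' - b' * c')" by (simp add: algebra_simps)
    thus ?thesis using A B by simp
  qed
  have "c * d' - d * c' = (c - c') * d' - (d - d') * c'" by (simp add: algebra_simps)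
  hence "int N dvd c * d' - d * c'" using cong by simp
  hence G: "G \<in> Gamma0 N" using det by (simp add: G_def)
  have "- c * b' + d * a' - 1 = (d - d') * a' - (c - c') * b'" using B by (simp add: algebra_simps)
  hence "int N dvd - c * b' + d * a' - 1" using cong by simp
  hence chi1: "chi (G $ 2 $ 2) = 1" using chi_cong_1[OF chi] by (simp add: G_def)
  define w where "w = (of_int a' * z + of_int b') / (of_int c' * z + of_int d')"
  have nz: "of_int c * z + of_int d \<noteq> (0::complex)" "of_int c' * z + of_int d' \<noteq> (0::complex)"
    using automorphy_nonzero A B z by blast+
  have w: "Im w > 0" unfolding w_def Im_moebius[OF B z] using z nz by simp
  have Br: "of_int a' * of_int d' - of_int b' * of_int c' = (1::complex)"
    using arg_cong[OF B, of complex_of_int] by simp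
  have den: "of_int (c * d' - d * c') * w + of_int (- c * b' + d * a')
      = (of_int c * z + of_int d) / (of_int c' * z + of_int d' :: complex)"
  proof -
    have "(of_int (c * d' - d * c') * w + of_int (- c * b' + d * a')) * (of_int c' * z + of_int d')
       = of_int (c * d' - d * c') * (of_int a' * z + of_int b') + of_int (- c * b' + d * a') * (of_int c' * z + of_int d')"
      using nz by (simp add: w_def distrib_right)
    also have "\<dots> = (of_int a' * of_int d' - of_int b' * of_int c') * (of_int c * z + of_int d)"
      by (simp add: algebra_simps)
    finally show ?thesis using Br nz by (simp add: eq_divide_eq)
  qed
  have num: "of_int (a * d' - b * c') * w + of_int (- a * b' + b * a')
      = (of_int a * z + of_int b) / (of_int c' * z + of_int d' :: complex)"
  proof -
    have "(of_int (a * d' - b * c') * w + of_int (- a * b' + b * a')) * (of_int c' * z + of_int d')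
       = of_int (a * d' - b * c') * (of_int a' * z + of_int b') + of_int (- a * b' + b * a') * (of_int c' * z + of_int d')"
      using nz by (simp add: w_def distrib_right)
    also have "\<dots> = (of_int a' * of_int d' - of_int b' * of_int c') * (of_int a * z + of_int b)"
      by (simp add: algebra_simps)
    finally show ?thesis using Br nz by (simp add: eq_divide_eq)
  qed
  have "slash k G f w = f w" using transf[OF G w] chi1 by simp
  hence "((of_int c * z + of_int d) / (of_int c' * z + of_int d')) powi (- int k) *
      f ((of_int a * z + of_int b) / (of_int c * z + of_int d)) = f w"
    unfolding G_def slash_mat2 den num using nz by simp
  hence "(of_int c * z + of_int d) powi (- int k) * f ((of_int a * z + of_int b) / (of_int c * z + of_int d))
      = (of_int c' * z + of_int d') powi (- int k) * f w"
    using nz by (auto simp: power_int_divide_distrib divide_simps mult_ac)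
  thus ?thesis unfolding slash_mat2 w_def .
qed

lemma slash_holomorphic:
  assumes A: "a * d - b * c = 1"
  shows "slash k (mat2 a b c d) f holomorphic_on {z. Im z > 0}"
proof -
  have nz: "of_int c * z + of_int d \<noteq> (0::complex)" if "Im z > 0" for z
    using automorphy_nonzero[OF A that] .
  have "(\<lambda>z. f ((of_int a * z + of_int b) / (of_int c * z + of_int d))) holomorphic_on {z. Im z > 0}"
  proof (rule holomorphic_on_compose_gen[of _ _ f upper_half_plane, unfolded o_def, OF _ holo])
    show "(\<lambda>z. (of_int a * z + of_int b) / (of_int c * z + of_int d)) holomorphic_on {z. Im z > 0}"
      by (intro holomorphic_intros) (use nz in auto)
    show "(\<lambda>z. (of_int a * z + of_int b) / (of_int c * z + of_int d)) ` {z. Im z > 0} \<subseteq> upper_half_plane"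
      using nz by (auto simp: upper_half_plane_def Im_moebius[OF A])
  qed
  thus ?thesis unfolding slash_mat2[abs_def] by (intro holomorphic_intros) (use nz in auto)
qed

text \<open>A shift of z by \<open>N\<close> changes the matrix only modulo \<open>N\<close>, so the
  translate has period \<open>N\<close>. Its expansion \<open>G\<close> vanishes at 0, and a bound
  for the derivative on a closed disc gives |G q| \<le> C |q|.\<close>

lemma slash_decay:
  assumes A: "a * d - b * c = 1" and t: "t > 0"
  obtains C where "C \<ge> 0" "\<And>z. Im z \<ge> t \<Longrightarrow> norm (slash k (mat2 a b c d) f z) \<le> C * exp (- (2 * pi * Im z / real N))"
proof -
  define g where "g = slash k (mat2 a b c d) f"
  have per: "g (z + of_real (real N)) = g z" if z: "Im z > 0" for z
  proof -
    have "g (z + of_real (real N)) = slash k (mat2 a (b + a * int N) c (d + c * int N)) f z"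
      unfolding g_def slash_mat2 by (simp add: algebra_simps)
    also have "\<dots> = g z" unfolding g_def
      by (rule slash_cong[OF _ A _ _ _ _ z]) (use A in \<open>auto simp: algebra_simps\<close>)
    finally show ?thesis .
  qed
  have lim: "(g \<longlongrightarrow> 0) (filtercomap Im at_top)" unfolding g_def by (rule vanish) (use A in simp)
  have N0: "real N > 0" using N by simp
  obtain G where G: "G holomorphic_on ball 0 1" "G 0 = 0"
    "\<And>z. Im z > 0 \<Longrightarrow> g z = G (exp (2 * of_real pi * \<i> * z / of_real (real N)))"
    using q_expansion_exists[OF slash_holomorphic[OF A, folded g_def] N0 per lim] by metis
  define r where "r = exp (- (2 * pi * t / real N))"
  have r: "0 < r" "r < 1" using N0 t by (auto simp: r_def)
  have "compact (deriv G ` cball 0 r)"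
    using r G(1) by (intro compact_continuous_image holomorphic_on_imp_continuous_on holomorphic_on_subset[OF holomorphic_deriv[OF G(1)]]) auto
  hence "bounded (deriv G ` cball 0 r)" by (rule compact_imp_bounded)
  then obtain C where C: "\<forall>y\<in>deriv G ` cball 0 r. norm y \<le> C" unfolding bounded_iff ..
  have C0: "C \<ge> 0" using C r by (meson centre_in_cball image_eqI less_imp_le norm_ge_zero order.trans)
  have lip: "norm (G q) \<le> C * norm q" if q: "norm q \<le> r" for q
  proof -
    have "norm (G q - G 0) \<le> C * norm (q - 0)"
    proof (rule field_differentiable_bound[of "cball 0 r" G "deriv G"])
      fix z :: complex assume z: "z \<in> cball 0 r"
      hence "z \<in> ball 0 1" using r by auto
      thus "(G has_field_derivative deriv G z) (at z within cball 0 r)"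
        using holomorphic_derivI[OF G(1) open_ball] has_field_derivative_at_within by blast
      show "norm (deriv G z) \<le> C" using C z by blast
    qed (use q r in auto)
    thus ?thesis using G(2) by simp
  qed
  show ?thesis
  proof (rule that[OF C0])
    fix z assume z: "Im z \<ge> t"
    have n: "norm (exp (2 * of_real pi * \<i> * z / of_real (real N))) = exp (- (2 * pi * Im z / real N))"
      by simp
    have "\<dots> \<le> r" unfolding r_def exp_le_cancel_iff neg_le_iff_le
      by (intro divide_right_mono mult_left_mono z) (use N0 in auto)
    hence "norm (G (exp (2 * of_real pi * \<i> * z / of_real (real N)))) \<le> C * exp (- (2 * pi * Im z / real N))"
      using lip n by metis
    thus "norm (slash k (mat2 a b c d) f z) \<le> C * exp (- (2 * pi * Im z / real N))"
      using G(3)[of z] z t by (simp add: g_def)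
  qed
qed

text \<open>A single term of the exponential series is at most its sum.\<close>

lemma power_le_exp: "(y::real) \<ge> 0 \<Longrightarrow> c > 0 \<Longrightarrow> y ^ m * exp (- c * y) \<le> fact m / c ^ m"
proof -
  assume y: "y \<ge> 0" and c: "c > 0"
  have "(c * y) ^ m / fact m \<le> exp (c * y)"
  proof -
    have s: "(\<lambda>n. (c * y) ^ n /\<^sub>R fact n) sums exp (c * y)" by (rule exp_converges)
    have "(\<Sum>n\<in>{m}. (c * y) ^ n /\<^sub>R fact n) \<le> (\<Sum>n. (c * y) ^ n /\<^sub>R fact n)"
      by (rule sum_le_suminf) (use s y c in \<open>auto simp: sums_iff\<close>)
    thus ?thesis using sums_unique[OF s] by (simp add: divide_inverse mult.commute)
  qed
  hence "(c * y) ^ m * exp (- (c * y)) \<le> fact m * exp (c * y) * exp (- (c * y))"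
    by (intro mult_right_mono) (simp_all add: divide_le_eq mult.commute)
  also have "\<dots> = fact m" by (simp add: mult.assoc exp_add[symmetric])
  finally show "y ^ m * exp (- c * y) \<le> fact m / c ^ m"
    using c by (simp add: power_mult_distrib pos_le_divide_eq mult_ac)
qed

text \<open>By \<open>slash_cong\<close> a constant is needed only for each of the finitely many
  residues modulo \<open>N\<close>; their sum serves all matrices. The height 1/5 is the one reached
  in \<open>moebius_large_imaginary_part\<close>.\<close>

lemma slash_uniform_bound:
  obtains C where "C \<ge> 0" "\<And>a b c d z. a * d - b * c = 1 \<Longrightarrow> Im z \<ge> 1/5 \<Longrightarrow>
    (norm (slash k (mat2 a b c d) f z))\<^sup>2 * Im z ^ k \<le> C"
proof -
  have ex: "\<exists>C\<ge>0. \<forall>z. Im z \<ge> 1/5 \<longrightarrow> (norm (slash k (mat2 a b c d) f z))\<^sup>2 * Im z ^ k \<le> C"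
    if A: "a * d - b * c = 1" for a b c d
  proof -
    obtain C where C: "C \<ge> 0" "\<And>z. Im z \<ge> 1/5 \<Longrightarrow> norm (slash k (mat2 a b c d) f z) \<le> C * exp (- (2 * pi * Im z / real N))"
      by (rule slash_decay[OF A, of "1/5"]) (simp, blast)
    define \<beta> where "\<beta> = 4 * pi / real N"
    have \<beta>: "\<beta> > 0" using N by (simp add: \<beta>_def)
    have "(norm (slash k (mat2 a b c d) f z))\<^sup>2 * Im z ^ k \<le> C\<^sup>2 * (fact k / \<beta> ^ k)" if z: "Im z \<ge> 1/5" for z
    proof -
      have "(norm (slash k (mat2 a b c d) f z))\<^sup>2 * Im z ^ k \<le> (C * exp (- (2 * pi * Im z / real N)))\<^sup>2 * Im z ^ k"
        using C(2)[OF z] z by (intro mult_right_mono power_mono) auto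
      also have "\<dots> = C\<^sup>2 * (Im z ^ k * exp (- \<beta> * Im z))"
        by (simp add: power_mult_distrib \<beta>_def power2_eq_square exp_add[symmetric] mult_ac)
      also have "\<dots> \<le> C\<^sup>2 * (fact k / \<beta> ^ k)"
        using power_le_exp[of "Im z" \<beta> k] \<beta> z by (intro mult_left_mono) auto
      finally show ?thesis .
    qed
    moreover have "C\<^sup>2 * (fact k / \<beta> ^ k) \<ge> 0" using \<beta> by simp
    ultimately show ?thesis by blast
  qed
  define red where "red = (\<lambda>(a, b, c, d). (a mod int N, b mod int N, c mod int N, d mod int N))"
  define SL where "SL = {(a, b, c, d). a * d - b * c = (1::int)}"
  define R where "R = red ` SL"
  have "R \<subseteq> {0..int N} \<times> {0..int N} \<times> {0..int N} \<times> {0..int N}"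
    using N by (auto simp: R_def red_def less_imp_le)
  hence finR: "finite R" by (rule finite_subset) auto
  have "\<forall>\<rho>\<in>R. \<exists>C\<ge>0. \<forall>a b c d z. (a, b, c, d) \<in> SL \<longrightarrow> red (a, b, c, d) = \<rho> \<longrightarrow> Im z \<ge> 1/5 \<longrightarrow>
      (norm (slash k (mat2 a b c d) f z))\<^sup>2 * Im z ^ k \<le> C"
  proof
    fix \<rho> assume "\<rho> \<in> R"
    then obtain a' b' c' d' where A': "a' * d' - b' * c' = 1" "\<rho> = red (a', b', c', d')"
      by (auto simp: R_def SL_def)
    obtain C where C: "C \<ge> 0" "\<And>z. Im z \<ge> 1/5 \<Longrightarrow> (norm (slash k (mat2 a' b' c' d') f z))\<^sup>2 * Im z ^ k \<le> C"
      using ex[OF A'(1)] by blast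
    have "(norm (slash k (mat2 a b c d) f z))\<^sup>2 * Im z ^ k \<le> C"
      if "(a, b, c, d) \<in> SL" "red (a, b, c, d) = \<rho>" "Im z \<ge> 1/5" for a b c d z
    proof -
      have "slash k (mat2 a b c d) f z = slash k (mat2 a' b' c' d') f z"
        by (rule slash_cong) (use that A' in \<open>auto simp: SL_def red_def mod_eq_dvd_iff\<close>)
      thus ?thesis using C(2)[OF that(3)] by simp
    qed
    thus "\<exists>C\<ge>0. \<forall>a b c d z. (a, b, c, d) \<in> SL \<longrightarrow> red (a, b, c, d) = \<rho> \<longrightarrow> Im z \<ge> 1/5 \<longrightarrow>
      (norm (slash k (mat2 a b c d) f z))\<^sup>2 * Im z ^ k \<le> C" using C(1) by blast
  qed
  then obtain Cf where Cf: "\<And>\<rho>. \<rho> \<in> R \<Longrightarrow> Cf \<rho> \<ge> 0"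
    "\<And>\<rho> a b c d z. \<rho> \<in> R \<Longrightarrow> (a, b, c, d) \<in> SL \<Longrightarrow> red (a, b, c, d) = \<rho> \<Longrightarrow> Im z \<ge> 1/5 \<Longrightarrow>
      (norm (slash k (mat2 a b c d) f z))\<^sup>2 * Im z ^ k \<le> Cf \<rho>" by metis
  show ?thesis
  proof (rule that[of "\<Sum>\<rho>\<in>R. Cf \<rho>"])
    show "(\<Sum>\<rho>\<in>R. Cf \<rho>) \<ge> 0" using Cf(1) by (rule sum_nonneg)
    fix a b c d :: int and z assume A: "a * d - b * c = 1" and z: "Im z \<ge> 1/5"
    hence SL: "(a, b, c, d) \<in> SL" by (simp add: SL_def)
    hence R: "red (a, b, c, d) \<in> R" by (simp add: R_def)
    have "(norm (slash k (mat2 a b c d) f z))\<^sup>2 * Im z ^ k \<le> Cf (red (a, b, c, d))" by (rule Cf(2)[OF R SL refl z])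
    also have "\<dots> \<le> (\<Sum>\<rho>\<in>R. Cf \<rho>)" by (rule member_le_sum[OF R _ finR]) (use Cf(1) in auto)
    finally show "(norm (slash k (mat2 a b c d) f z))\<^sup>2 * Im z ^ k \<le> (\<Sum>\<rho>\<in>R. Cf \<rho>)" .
  qed
qed

text \<open>Dirichlet approximation of \<open>Re z\<close> replaces the reduction theory of the modular group.\<close>

lemma moebius_large_imaginary_part:
  assumes z: "Im z > 0"
  obtains a b c d where "a * d - b * c = (1::int)"
    "Im ((of_int a * z + of_int b) / (of_int c * z + of_int d)) \<ge> 1/5"
proof (cases "Im z \<ge> 1/5")
  case True
  thus ?thesis using that[of 1 1 0 0] by simp
next
  case False
  define y where "y = Im z"
  have y: "0 < y" "y < 1" using z False by (auto simp: y_def)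
  \<comment> \<open>With denominators up to Q of size y^(-1/2), approximation gives (c Re z - h)^2
    \<le> y, and c \<le> 2 / sqrt y gives (c y)^2 \<le> 4 y. So |c z - h|^2 \<le> 5 y, whence the
    height 1/5.\<close>
  define Q where "Q = nat \<lceil>1 / sqrt y\<rceil>"
  have s: "0 < sqrt y" "sqrt y < 1" using y by auto
  hence s1: "1 < 1 / sqrt y" by simp
  have Q: "real Q \<ge> 1 / sqrt y" "real Q \<le> 1 / sqrt y + 1" "Q > 0"
    unfolding Q_def using s1 by linarith+
  obtain h c where hc: "coprime h c" "0 < c" "c \<le> int Q" "\<bar>of_int c * Re z - of_int h\<bar> < 1 / real Q"
    by (rule Dirichlet_approx_coprime[OF Q(3), of "Re z"]) blast
  obtain u v where uv: "u * h + v * c = 1"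
    using bezout_int[of h c] hc(1) by (auto simp: coprime_iff_gcd_eq_1)
  have det: "(-u) * (-h) - (-v) * c = 1" using uv by simp
  have b1: "(of_int c * Re z - of_int h)\<^sup>2 \<le> y"
  proof -
    have "1 / real Q \<le> sqrt y" using Q(1,3) s by (simp add: field_simps)
    hence "\<bar>of_int c * Re z - of_int h\<bar> \<le> sqrt y" using hc(4) by linarith
    hence "(of_int c * Re z - of_int h)\<^sup>2 \<le> (sqrt y)\<^sup>2" by (metis abs_ge_zero power2_abs power_mono)
    thus ?thesis using y by simp
  qed
  have b2: "(of_int c * y)\<^sup>2 \<le> 4 * y"
  proof -
    have "real_of_int c \<le> real Q" using hc(3) by linarith
    also have "\<dots> \<le> 2 / sqrt y" using Q(2) s1 by simp
    finally have "of_int c * y \<le> 2 / sqrt y * y" using y by (intro mult_right_mono) auto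
    also have "\<dots> = 2 * sqrt y" using y by (simp add: real_div_sqrt mult.commute[of "2 / sqrt y"] divide_simps)
    finally have "(of_int c * y)\<^sup>2 \<le> (2 * sqrt y)\<^sup>2" using hc(2) y by (intro power_mono) auto
    thus ?thesis using y by (simp add: power_mult_distrib)
  qed
  have "(norm (of_int c * z + of_int (-h)))\<^sup>2 = (of_int c * Re z - of_int h)\<^sup>2 + (of_int c * y)\<^sup>2"
    by (simp add: cmod_power2 y_def)
  hence n: "(norm (of_int c * z + of_int (-h)))\<^sup>2 \<le> 5 * y" using b1 b2 by simp
  have "of_int c * z + of_int (-h) \<noteq> (0::complex)" by (rule automorphy_nonzero[OF det z])
  hence n0: "(norm (of_int c * z + of_int (-h)))\<^sup>2 > 0" by simp
  have "Im ((of_int (-u) * z + of_int (-v)) / (of_int c * z + of_int (-h))) \<ge> 1/5"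
    unfolding Im_moebius[OF det z] using n n0 by (simp add: y_def pos_le_divide_eq)
  thus ?thesis using that[OF det] by blast
qed

text \<open>The quantity |f|^2 y^k at z equals that of the translate by the inverse matrix at the
  transformed point, which can be chosen at height \<ge> 1/5.\<close>

lemma mean_bound:
  obtains C where "C \<ge> 0" "\<And>z. Im z > 0 \<Longrightarrow> (norm (f z))\<^sup>2 * Im z ^ k \<le> C"
proof -
  obtain C where C: "C \<ge> 0" "\<And>a b c d z. a * d - b * c = 1 \<Longrightarrow> Im z \<ge> 1/5 \<Longrightarrow>
    (norm (slash k (mat2 a b c d) f z))\<^sup>2 * Im z ^ k \<le> C" by (rule slash_uniform_bound) blast
  show ?thesis
  proof (rule that[OF C(1)])
    fix z assume z: "Im z > 0"
    obtain a b c d where A: "a * d - b * c = (1::int)"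
      "Im ((of_int a * z + of_int b) / (of_int c * z + of_int d)) \<ge> 1/5"
      by (rule moebius_large_imaginary_part[OF z]) blast
    define w where "w = (of_int a * z + of_int b) / (of_int c * z + of_int d)"
    have w: "Im w \<ge> 1/5" using A(2) by (simp add: w_def)
    have det': "d * a - (-b) * (-c) = 1" using A(1) by (simp add: algebra_simps)
    have nz: "of_int c * z + of_int d \<noteq> (0::complex)" by (rule automorphy_nonzero[OF A(1) z])
    have nz': "of_int (-c) * w + of_int a \<noteq> (0::complex)" by (rule automorphy_nonzero[OF det']) (use w in simp)
    have Ac: "of_int a * of_int d - of_int b * of_int c = (1::complex)"
      using arg_cong[OF A(1), of complex_of_int] by simp
    have den: "(of_int (-c) * w + of_int a) * (of_int c * z + of_int d) = (1::complex)"
    proof -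
      have "(of_int (-c) * w + of_int a) * (of_int c * z + of_int d) =
         of_int (-c) * (w * (of_int c * z + of_int d)) + of_int a * (of_int c * z + of_int d)"
        by (simp add: algebra_simps)
      also have "w * (of_int c * z + of_int d) = of_int a * z + of_int b" using nz by (simp add: w_def)
      finally have "(of_int (-c) * w + of_int a) * (of_int c * z + of_int d) =
         of_int (-c) * (of_int a * z + of_int b) + of_int a * (of_int c * z + of_int d)" .
      thus ?thesis using Ac by (simp add: algebra_simps)
    qed
    have num: "(of_int d * w + of_int (-b)) * (of_int c * z + of_int d) = z"
    proof -
      have "(of_int d * w + of_int (-b)) * (of_int c * z + of_int d) =
         of_int d * (w * (of_int c * z + of_int d)) + of_int (-b) * (of_int c * z + of_int d)"
        by (simp add: algebra_simps)
      also have "w * (of_int c * z + of_int d) = of_int a * z + of_int b" using nz by (simp add: w_def)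
      also have "of_int d * (of_int a * z + of_int b) + of_int (-b) * (of_int c * z + of_int d) = (of_int a * of_int d - of_int b * of_int c) * z" by (simp add: algebra_simps)
      finally show ?thesis using Ac by simp
    qed
    have zw: "(of_int d * w + of_int (-b)) / (of_int (-c) * w + of_int a) = z"
      using num den nz nz' by (metis mult_cancel_right nonzero_eq_divide_eq mult.commute mult.left_commute mult_1)
    have "norm (slash k (mat2 d (-b) (-c) a) f w) = norm (f z) / norm (of_int (-c) * w + of_int a) ^ k"
      unfolding slash_mat2 zw by (simp add: norm_mult norm_power_int power_int_minus norm_inverse norm_power divide_inverse mult.commute)
    moreover have "Im z = Im w / (norm (of_int (-c) * w + of_int a))\<^sup>2"
      using Im_moebius[OF det', of w] zw w by simp
    moreover have n0: "norm (of_int (-c) * w + of_int a) \<noteq> 0" using nz' by simp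
    ultimately have "(norm (f z))\<^sup>2 * Im z ^ k = (norm (slash k (mat2 d (-b) (-c) a) f w))\<^sup>2 * Im w ^ k"
      by (simp add: power_divide power_mult[symmetric] mult.commute)
    also have "\<dots> \<le> C" by (rule C(2)[OF det' w])
    finally show "(norm (f z))\<^sup>2 * Im z ^ k \<le> C" .
  qed
qed

end

section \<open>Mellin transforms\<close>

lemma exp_decay_beats_log_square:
  assumes \<beta>: "\<beta> > 0" and B: "B > 0"
  obtains K where "K \<ge> 0" "\<And>u. u \<ge> 1 \<Longrightarrow> u ^ m * exp (- \<beta> * u + B * (ln u)\<^sup>2) \<le> (K::real)"
proof -
  define F where "F = (\<lambda>u::real. u ^ m * exp (- \<beta> * u + B * (ln u)\<^sup>2))"
  have "filterlim (\<lambda>u. real m * ln u - \<beta> * u + B * (ln u)\<^sup>2) at_bot at_top"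
    using \<beta> B by real_asymp
  hence "\<forall>\<^sub>F u in at_top. real m * ln u - \<beta> * u + B * (ln u)\<^sup>2 \<le> 0"
    by (simp add: filterlim_at_bot)
  then obtain U where U: "\<And>u. u \<ge> U \<Longrightarrow> real m * ln u - \<beta> * u + B * (ln u)\<^sup>2 \<le> 0"
    unfolding eventually_at_top_linorder by blast
  have "continuous_on {1..U} F" unfolding F_def by (intro continuous_intros) auto
  hence "compact (F ` {1..U})" by (rule compact_continuous_image) auto
  hence "bounded (F ` {1..U})" by (rule compact_imp_bounded)
  then obtain K where K: "\<forall>y\<in>F ` {1..U}. norm y \<le> K" unfolding bounded_iff ..
  show ?thesis
  proof (rule that[of "max K 1"])
    fix u :: real assume u: "u \<ge> 1"
    show "u ^ m * exp (- \<beta> * u + B * (ln u)\<^sup>2) \<le> max K 1"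
    proof (cases "u \<le> U")
      case True
      hence "norm (F u) \<le> K" using K u by auto
      thus ?thesis unfolding F_def by simp
    next
      case False
      have "u ^ m = exp (real m * ln u)" using u by (simp add: exp_of_nat_mult)
      hence "u ^ m * exp (- \<beta> * u + B * (ln u)\<^sup>2) = exp (real m * ln u - \<beta> * u + B * (ln u)\<^sup>2)"
        by (simp add: exp_add[symmetric])
      also have "\<dots> \<le> 1" using U[of u] False by simp
      finally show ?thesis by simp
    qed
  qed simp
qed

lemma integrable_exp_minus_halfline:
  assumes "a > 0"
  shows "integrable (lebesgue_on {0<..}) (\<lambda>y. exp (- a * y) :: real)"
proof -
  have "(\<lambda>y. exp (- a * y) :: real) absolutely_integrable_on {0..}"
    by (intro nonnegative_absolutely_integrable_1 integrable_on_exp_minus_to_infinity assms) auto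
  hence "(\<lambda>y. exp (- a * y) :: real) absolutely_integrable_on {0<..}"
    by (rule set_integrable_subset) auto
  thus ?thesis by (simp add: integrable_restrict_space set_integrable_def)
qed

lemma Gamma_integral_scaled:
  assumes s: "Re s > 0" and c: "c > 0"
  shows "integrable (lebesgue_on {0<..}) (\<lambda>y. complex_of_real y powr (s - 1) / of_real (exp (c * y)))"
    and "integral\<^sup>L (lebesgue_on {0<..}) (\<lambda>y. complex_of_real y powr (s - 1) / of_real (exp (c * y)))
      = of_real c powr (- s) * Gamma s"
proof -
  let ?f = "\<lambda>t. complex_of_real t powr (s - 1) / of_real (exp t)"
  have S: "(\<lambda>x. c * x) ` {0<..} = {0<..}"
  proof -
    have "x \<in> (\<lambda>x. c * x) ` {0<..}" if "x > 0" for x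
      using that c by (intro image_eqI[of _ _ "x / c"]) auto
    thus ?thesis using c by auto
  qed
  have "(\<lambda>x. \<bar>c\<bar> *\<^sub>R ?f (c * x)) absolutely_integrable_on {0<..} \<and>
      integral {0<..} (\<lambda>x. \<bar>c\<bar> *\<^sub>R ?f (c * x)) = Gamma s" (is ?conj)
  proof (rule has_absolute_integral_change_of_variables_real[of "{0<..}" "\<lambda>x. c * x" "\<lambda>_. c", THEN iffD2])
    show "?f absolutely_integrable_on (\<lambda>x. c * x) ` {0<..} \<and> integral ((\<lambda>x. c * x) ` {0<..}) ?f = Gamma s"
      unfolding S using absolutely_integrable_Gamma_integral'[OF s] Gamma_integral_complex'[OF s]
      by (simp add: integral_unique)
  qed (use c in \<open>auto intro!: derivative_eq_intros simp: inj_on_def\<close>)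
  have eq: "\<bar>c\<bar> *\<^sub>R ?f (c * x) = of_real c powr s * (of_real x powr (s - 1) / of_real (exp (c * x)))"
    if "x \<in> {0<..}" for x
  proof -
    have "of_real c * of_real c powr (s - 1) = (of_real c powr s :: complex)"
      using c by (simp add: powr_diff)
    thus ?thesis using c that
      by (simp add: scaleR_conv_of_real powr_times_real_left mult.assoc[symmetric])
  qed
  from \<open>?conj\<close> have ai: "(\<lambda>x. \<bar>c\<bar> *\<^sub>R ?f (c * x)) absolutely_integrable_on {0<..}"
    and iv: "integral {0<..} (\<lambda>x. \<bar>c\<bar> *\<^sub>R ?f (c * x)) = Gamma s" by blast+
  have *: "(\<lambda>x. of_real c powr s * (of_real x powr (s - 1) / of_real (exp (c * x)))) absolutely_integrable_on {0<..}"
    by (rule iffD1[OF set_integrable_cong[OF refl refl eq] ai])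
  have **: "integral {0<..} (\<lambda>x. of_real c powr s * (of_real x powr (s - 1) / of_real (exp (c * x)))) = Gamma s"
    by (rule trans[OF Henstock_Kurzweil_Integration.integral_cong[OF eq[symmetric]] iv])
  have cs: "of_real c powr s \<noteq> (0::complex)" using c by simp
  have i: "integrable (lebesgue_on {0<..}) (\<lambda>x. of_real c powr s * (of_real x powr (s - 1) / of_real (exp (c * x))))"
    using * by (simp add: integrable_restrict_space set_integrable_def)
  from integrable_mult_right[OF this, of "inverse (of_real c powr s)"] cs
  show i': "integrable (lebesgue_on {0<..}) (\<lambda>y. complex_of_real y powr (s - 1) / of_real (exp (c * y)))"
    by (simp add: mult.assoc[symmetric])
  have "integral\<^sup>L (lebesgue_on {0<..}) (\<lambda>y. of_real c powr s * (complex_of_real y powr (s - 1) / of_real (exp (c * y)))) = Gamma s"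
    by (rule trans[OF lebesgue_integral_eq_integral[OF i] **]) simp
  hence "of_real c powr s * integral\<^sup>L (lebesgue_on {0<..}) (\<lambda>y. complex_of_real y powr (s - 1) / of_real (exp (c * y))) = Gamma s"
    by (simp only: integral_mult_right_zero)
  thus "integral\<^sup>L (lebesgue_on {0<..}) (\<lambda>y. complex_of_real y powr (s - 1) / of_real (exp (c * y)))
      = of_real c powr (- s) * Gamma s"
    using cs by (simp add: powr_minus field_simps)
qed

text \<open>Exponential decay at both ends makes the Mellin integral converge for every s, so the
  continuation needs neither splitting the integral nor a functional equation.\<close>

locale mellin_kernel =
  fixes \<phi> :: "real \<Rightarrow> complex" and \<beta> C :: real and k :: nat
  assumes cont: "continuous_on {0<..} \<phi>" and \<beta>: "\<beta> > 0" and C: "C \<ge> 0"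
    and large: "\<And>y. y \<ge> 1 \<Longrightarrow> norm (\<phi> y) \<le> C * exp (- \<beta> * y)"
    and small: "\<And>y. 0 < y \<Longrightarrow> y \<le> 1 \<Longrightarrow> norm (\<phi> y) \<le> C * inverse y ^ k * exp (- \<beta> * inverse y)"
begin

definition mellin :: "complex \<Rightarrow> complex" where
  "mellin s = integral\<^sup>L (lebesgue_on {0<..}) (\<lambda>y. \<phi> y * of_real y powr (s - 1))"

lemma powr_exp: "y > 0 \<Longrightarrow> complex_of_real y powr (s - 1) = exp (s * of_real (ln y)) / of_real y"
  by (simp add: powr_def exp_diff left_diff_distrib Ln_of_real exp_of_real)

text \<open>A majorant independent of s: by \<open>exp_log_le\<close> the growth exp(|s| |ln y|)
  costs a factor exp(\<epsilon> |s|^2) and a weight with B = 1/(4 \<epsilon>). This is the source of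
  the subgaussian bound.\<close>

definition weight :: "real \<Rightarrow> real \<Rightarrow> real" where
  "weight B y = norm (\<phi> y) / y * exp (B * (ln y)\<^sup>2)"

lemma weight_integrable:
  assumes B: "B > 0"
  shows "integrable (lebesgue_on {0<..}) (weight B)"
proof -
  have b2: "\<beta> / 2 > 0" using \<beta> by simp
  obtain K1 where K1: "K1 \<ge> 0" "\<And>u. u \<ge> 1 \<Longrightarrow> u ^ 0 * exp (- (\<beta>/2) * u + B * (ln u)\<^sup>2) \<le> K1"
    by (rule exp_decay_beats_log_square[OF b2 B]) blast
  obtain K2 where K2: "K2 \<ge> 0" "\<And>u. u \<ge> 1 \<Longrightarrow> u ^ (k+1) * exp (- \<beta> * u + B * (ln u)\<^sup>2) \<le> K2"
    by (rule exp_decay_beats_log_square[OF \<beta> B]) blast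
  define K where "K = C * K1 + C * K2 * exp (\<beta>/2)"
  have bd: "weight B y \<le> K * exp (- (\<beta>/2) * y)" if y: "y > 0" for y
  proof (cases "y \<ge> 1")
    case True
    have "norm (\<phi> y) / y \<le> norm (\<phi> y)" using True by (simp add: divide_le_eq mult_left_le_one_le mult_le_cancel_left1)
    hence "weight B y \<le> norm (\<phi> y) * exp (B * (ln y)\<^sup>2)" unfolding weight_def by (intro mult_right_mono) auto
    also have "\<dots> \<le> (C * exp (- \<beta> * y)) * exp (B * (ln y)\<^sup>2)" by (intro mult_right_mono large True) auto
    also have "\<dots> = C * (exp (- (\<beta>/2) * y + B * (ln y)\<^sup>2)) * exp (- (\<beta>/2) * y)"
      by (simp add: exp_add[symmetric] mult.assoc)
    also have "\<dots> \<le> C * K1 * exp (- (\<beta>/2) * y)" using K1(2)[OF True] C by (intro mult_right_mono mult_left_mono) auto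
    also have "\<dots> \<le> K * exp (- (\<beta>/2) * y)" using C K2 by (intro mult_right_mono) (auto simp: K_def)
    finally show ?thesis .
  next
    case False
    define u where "u = inverse y"
    have u: "u \<ge> 1" using False y by (simp add: u_def one_le_inverse)
    have ln: "(ln y)\<^sup>2 = (ln u)\<^sup>2" using y by (simp add: u_def ln_inverse)
    have "weight B y = norm (\<phi> y) * u * exp (B * (ln u)\<^sup>2)" unfolding weight_def ln by (simp add: u_def divide_inverse)
    also have "\<dots> \<le> (C * u ^ k * exp (- \<beta> * u)) * u * exp (B * (ln u)\<^sup>2)"
      using small[OF y] False u y by (intro mult_right_mono) (auto simp: u_def)
    also have "\<dots> = C * (u ^ (k+1) * exp (- \<beta> * u + B * (ln u)\<^sup>2))"
      by (simp only: exp_add power_add power_one_right mult_ac)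
    also have "\<dots> \<le> C * K2" using K2(2)[OF u] C by (rule mult_left_mono)
    also have "\<dots> \<le> C * K2 * exp (\<beta>/2) * exp (- (\<beta>/2) * y)"
    proof -
      have "(1::real) \<le> exp (\<beta>/2 + - (\<beta>/2) * y)" using False \<beta> by (simp add: field_simps)
      hence "C * K2 * 1 \<le> C * K2 * exp (\<beta>/2 + - (\<beta>/2) * y)" using C K2 by (intro mult_left_mono) auto
      thus ?thesis by (simp only: exp_add mult.assoc mult_1_right)
    qed
    also have "\<dots> \<le> K * exp (- (\<beta>/2) * y)" using C K1 by (intro mult_right_mono) (auto simp: K_def)
    finally show ?thesis .
  qed
  show ?thesis
  proof (rule Bochner_Integration.integrable_bound[OF integrable_mult_right[OF integrable_exp_minus_halfline[OF b2], of K]])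
    have "continuous_on {0<..} (weight B)" unfolding weight_def
      by (intro continuous_intros cont) auto
    thus "weight B \<in> borel_measurable (lebesgue_on {0<..})" by (rule continuous_imp_measurable_on_sets_lebesgue) auto
    show "AE y in lebesgue_on {0<..}. norm (weight B y) \<le> norm (K * exp (- (\<beta>/2) * y))"
    proof (rule AE_I2)
      fix y :: real assume "y \<in> space (lebesgue_on {0<..})"
      hence y: "y > 0" by simp
      have "weight B y \<ge> 0" using y by (simp add: weight_def)
      thus "norm (weight B y) \<le> norm (K * exp (- (\<beta>/2) * y))" using bd[OF y] by simp
    qed
  qed
qed

text \<open>Completing the square: r |l| \<le> \<epsilon> r^2 + l^2 / (4 \<epsilon>).\<close>

lemma exp_log_le:
  assumes "\<epsilon> > 0"
  shows "exp (r * \<bar>l\<bar>) \<le> exp (\<epsilon> * r\<^sup>2) * exp (1 / (4 * \<epsilon>) * (l::real)\<^sup>2)"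
proof -
  have "0 \<le> (sqrt \<epsilon> * r - \<bar>l\<bar> / (2 * sqrt \<epsilon>))\<^sup>2" by simp
  also have "\<dots> = \<epsilon> * r\<^sup>2 - r * \<bar>l\<bar> + 1 / (4 * \<epsilon>) * l\<^sup>2"
    using assms by (simp add: power2_diff power_mult_distrib power_divide field_simps)
  finally show ?thesis unfolding exp_add[symmetric] by simp
qed

lemma mellin_integrand_bound:
  assumes "y > 0" "\<epsilon> > 0"
  shows "norm (\<phi> y) / y * exp (norm s * \<bar>ln y\<bar>) \<le> exp (\<epsilon> * (norm s)\<^sup>2) * weight (1 / (4 * \<epsilon>)) y"
proof -
  have "norm (\<phi> y) / y * exp (norm s * \<bar>ln y\<bar>) \<le> norm (\<phi> y) / y * (exp (\<epsilon> * (norm s)\<^sup>2) * exp (1 / (4 * \<epsilon>) * (ln y)\<^sup>2))"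
    using exp_log_le[OF assms(2)] assms(1) by (intro mult_left_mono) auto
  thus ?thesis by (simp add: weight_def mult_ac)
qed

lemma mellin_integrable:
  "integrable (lebesgue_on {0<..}) (\<lambda>y. norm (\<phi> y) / y * exp (norm s * \<bar>ln y\<bar>))"
proof (rule Bochner_Integration.integrable_bound[OF integrable_mult_right[OF weight_integrable[of "1/4"], of "exp ((norm s)\<^sup>2)"]])
  have "continuous_on {0<..} (\<lambda>y. norm (\<phi> y) / y * exp (norm s * \<bar>ln y\<bar>))"
    by (intro continuous_intros cont) auto
  thus "(\<lambda>y. norm (\<phi> y) / y * exp (norm s * \<bar>ln y\<bar>)) \<in> borel_measurable (lebesgue_on {0<..})"
    by (rule continuous_imp_measurable_on_sets_lebesgue) auto
  show "AE y in lebesgue_on {0<..}. norm (norm (\<phi> y) / y * exp (norm s * \<bar>ln y\<bar>)) \<le> norm (exp ((norm s)\<^sup>2) * weight (1/4) y)"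
  proof (rule AE_I2)
    fix y :: real assume "y \<in> space (lebesgue_on {0<..})"
    hence y: "y > 0" by simp
    have "weight (1/4) y \<ge> 0" using y by (simp add: weight_def)
    thus "norm (norm (\<phi> y) / y * exp (norm s * \<bar>ln y\<bar>)) \<le> norm (exp ((norm s)\<^sup>2) * weight (1/4) y)"
      using mellin_integrand_bound[OF y zero_less_one, of s] y by (simp add: abs_mult)
  qed
qed simp

lemma norm_mellin_integrand:
  assumes "y > 0"
  shows "norm (\<phi> y * of_real y powr (s - 1)) \<le> norm (\<phi> y) / y * exp (norm s * \<bar>ln y\<bar>)"
proof -
  have "Re (s * of_real (ln y)) \<le> norm (s * of_real (ln y))" by (rule complex_Re_le_cmod)
  hence "Re s * ln y \<le> norm s * \<bar>ln y\<bar>" by (simp add: norm_mult)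
  hence "norm (\<phi> y) / y * exp (Re s * ln y) \<le> norm (\<phi> y) / y * exp (norm s * \<bar>ln y\<bar>)"
    using assms by (intro mult_left_mono) auto
  thus ?thesis using assms by (simp add: powr_exp norm_mult norm_divide)
qed

lemma integrand_integrable: "integrable (lebesgue_on {0<..}) (\<lambda>y. \<phi> y * of_real y powr (s - 1))"
proof (rule Bochner_Integration.integrable_bound[OF mellin_integrable[of s]])
  have "continuous_on {0<..} (\<lambda>y. \<phi> y * (exp (s * of_real (ln y)) / of_real y))"
    by (intro continuous_intros cont) auto
  hence "continuous_on {0<..} (\<lambda>y. \<phi> y * of_real y powr (s - 1))"
    by (rule continuous_on_eq) (simp add: powr_exp)
  thus "(\<lambda>y. \<phi> y * of_real y powr (s - 1)) \<in> borel_measurable (lebesgue_on {0<..})"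
    by (rule continuous_imp_measurable_on_sets_lebesgue) auto
  show "AE y in lebesgue_on {0<..}. norm (\<phi> y * of_real y powr (s - 1)) \<le> norm (norm (\<phi> y) / y * exp (norm s * \<bar>ln y\<bar>))"
    by (rule AE_I2) (use norm_mellin_integrand in \<open>auto simp: abs_mult\<close>)
qed

lemma mellin_subgaussian:
  assumes "\<epsilon> > 0"
  shows "\<exists>D. \<forall>s. norm (mellin s) \<le> D * exp (\<epsilon> * (norm s)\<^sup>2)"
proof (intro exI allI)
  fix s
  have wi: "integrable (lebesgue_on {0<..}) (weight (1 / (4 * \<epsilon>)))" by (rule weight_integrable) (use assms in simp)
  have "norm (mellin s) \<le> integral\<^sup>L (lebesgue_on {0<..}) (\<lambda>y. norm (\<phi> y * of_real y powr (s - 1)))"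
    unfolding mellin_def by (rule integral_norm_bound)
  also have "\<dots> \<le> integral\<^sup>L (lebesgue_on {0<..}) (\<lambda>y. exp (\<epsilon> * (norm s)\<^sup>2) * weight (1 / (4 * \<epsilon>)) y)"
  proof (rule integral_mono)
    fix y :: real assume "y \<in> space (lebesgue_on {0<..})"
    hence y: "y > 0" by simp
    show "norm (\<phi> y * of_real y powr (s - 1)) \<le> exp (\<epsilon> * (norm s)\<^sup>2) * weight (1 / (4 * \<epsilon>)) y"
      by (rule order.trans[OF norm_mellin_integrand[OF y] mellin_integrand_bound[OF y assms]])
  qed (use integrand_integrable wi in \<open>auto intro: integrable_norm\<close>)
  also have "\<dots> = integral\<^sup>L (lebesgue_on {0<..}) (weight (1 / (4 * \<epsilon>))) * exp (\<epsilon> * (norm s)\<^sup>2)"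
    by (simp add: mult.commute)
  finally show "norm (mellin s) \<le> integral\<^sup>L (lebesgue_on {0<..}) (weight (1 / (4 * \<epsilon>))) * exp (\<epsilon> * (norm s)\<^sup>2)" .
qed

text \<open>Expanding exp(s ln y) and integrating term by term gives an everywhere convergent power
  series, so holomorphy follows without differentiating under the integral.\<close>

lemma mellin_sums:
  "(\<lambda>n. integral\<^sup>L (lebesgue_on {0<..}) (\<lambda>y. \<phi> y / of_real y * of_real (ln y ^ n / fact n)) * s ^ n) sums mellin s"
proof -
  let ?M = "lebesgue_on {0<..}"
  define F where "F = (\<lambda>n y. \<phi> y / of_real y * of_real (ln y ^ n / fact n) * s ^ n)"
  have normF: "norm (F n y) = norm (\<phi> y) / y * ((norm s * \<bar>ln y\<bar>) ^ n / fact n)" if "y > 0" for n y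
    using that by (simp add: F_def norm_mult norm_divide norm_power power_mult_distrib power_abs)
  have exps: "(\<lambda>n. x ^ n / fact n) sums exp x" for x :: real
    using exp_converges[of x] by (simp add: divide_inverse mult.commute)
  have sumn: "(\<lambda>n. norm (F n y)) sums (norm (\<phi> y) / y * exp (norm s * \<bar>ln y\<bar>))" if "y > 0" for y
    unfolding normF[OF that] by (intro sums_mult exps)
  have intF: "integrable ?M (F n)" for n
  proof (rule Bochner_Integration.integrable_bound[OF mellin_integrable[of s]])
    have "continuous_on {0<..} (F n)" unfolding F_def by (intro continuous_intros cont) auto
    thus "F n \<in> borel_measurable ?M" by (rule continuous_imp_measurable_on_sets_lebesgue) auto
    show "AE y in ?M. norm (F n y) \<le> norm (norm (\<phi> y) / y * exp (norm s * \<bar>ln y\<bar>))"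
    proof (rule AE_I2)
      fix y :: real assume "y \<in> space ?M"
      hence y: "y > 0" by simp
      have "(\<Sum>n\<in>{n}. norm (F n y)) \<le> (\<Sum>n. norm (F n y))"
        by (rule sum_le_suminf) (use sumn[OF y] in \<open>auto simp: sums_iff\<close>)
      also have "\<dots> = norm (\<phi> y) / y * exp (norm s * \<bar>ln y\<bar>)" using sumn[OF y] by (simp add: sums_iff)
      finally show "norm (F n y) \<le> norm (norm (\<phi> y) / y * exp (norm s * \<bar>ln y\<bar>))" using y by (simp add: abs_mult)
    qed
  qed
  have "(\<lambda>n. integral\<^sup>L ?M (F n)) sums (integral\<^sup>L ?M (\<lambda>y. \<Sum>n. F n y))"
  proof (rule sums_integral[OF intF])
    show "AE y in ?M. summable (\<lambda>n. norm (F n y))"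
      by (rule AE_I2) (use sumn in \<open>auto simp: sums_iff\<close>)
    show "summable (\<lambda>n. integral\<^sup>L ?M (\<lambda>y. norm (F n y)))"
    proof (rule bounded_imp_summable[where B = "integral\<^sup>L ?M (\<lambda>y. norm (\<phi> y) / y * exp (norm s * \<bar>ln y\<bar>))"])
      fix n
      have "(\<Sum>i\<le>n. integral\<^sup>L ?M (\<lambda>y. norm (F i y))) = integral\<^sup>L ?M (\<lambda>y. \<Sum>i\<le>n. norm (F i y))"
        by (rule Bochner_Integration.integral_sum[symmetric]) (use intF in auto)
      also have "\<dots> \<le> integral\<^sup>L ?M (\<lambda>y. norm (\<phi> y) / y * exp (norm s * \<bar>ln y\<bar>))"
      proof (rule integral_mono[OF _ mellin_integrable])
        fix y :: real assume "y \<in> space ?M"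
        hence y: "y > 0" by simp
        have "(\<Sum>i\<le>n. norm (F i y)) \<le> (\<Sum>i. norm (F i y))"
          by (rule sum_le_suminf) (use sumn[OF y] in \<open>auto simp: sums_iff\<close>)
        thus "(\<Sum>i\<le>n. norm (F i y)) \<le> norm (\<phi> y) / y * exp (norm s * \<bar>ln y\<bar>)"
          using sumn[OF y] by (simp add: sums_iff)
      qed (use intF in auto)
      finally show "(\<Sum>i\<le>n. integral\<^sup>L ?M (\<lambda>y. norm (F i y))) \<le> \<dots>" .
    qed auto
  qed
  moreover have "integral\<^sup>L ?M (\<lambda>y. \<Sum>n. F n y) = mellin s"
    unfolding mellin_def
  proof (rule Bochner_Integration.integral_cong[OF refl])
    fix y :: real assume "y \<in> space ?M"
    hence y: "y > 0" by simp
    have "(\<lambda>n. (s * of_real (ln y)) ^ n /\<^sub>R fact n) sums exp (s * of_real (ln y))" by (rule exp_converges)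
    hence "(\<lambda>n. \<phi> y / of_real y * ((s * of_real (ln y)) ^ n /\<^sub>R fact n)) sums (\<phi> y / of_real y * exp (s * of_real (ln y)))"
      by (rule sums_mult)
    moreover have "\<phi> y / of_real y * ((s * of_real (ln y)) ^ n /\<^sub>R fact n) = F n y" for n
      by (simp add: F_def scaleR_conv_of_real power_mult_distrib field_simps)
    ultimately show "(\<Sum>n. F n y) = \<phi> y * of_real y powr (s - 1)" using y by (simp add: sums_iff powr_exp)
  qed
  moreover have "integral\<^sup>L ?M (F n) = integral\<^sup>L ?M (\<lambda>y. \<phi> y / of_real y * of_real (ln y ^ n / fact n)) * s ^ n" for n
    unfolding F_def by (rule integral_mult_left_zero)
  ultimately show ?thesis by (simp only:)
qed

lemma mellin_holomorphic: "mellin holomorphic_on UNIV"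
proof -
  have "mellin holomorphic_on ball 0 r" for r
    by (rule power_series_holomorphic) (use mellin_sums in simp)
  hence "mellin holomorphic_on (\<Union>r\<in>{0<..}. ball 0 r)" by (intro holomorphic_on_UN_open) auto
  moreover have "(\<Union>r\<in>{0<..}. ball 0 r) = (UNIV :: complex set)"
  proof -
    have "z \<in> (\<Union>r\<in>{0<..}. ball 0 r)" for z :: complex
      by (rule UN_I[of "norm z + 1"]) (auto simp: add_nonneg_pos)
    thus ?thesis by blast
  qed
  ultimately show ?thesis by simp
qed

lemma mellin_cnj:
  assumes "\<And>y. y > 0 \<Longrightarrow> cnj (\<phi> y) = \<phi> y"
  shows "mellin (cnj s) = cnj (mellin s)"
  unfolding mellin_def Bochner_Integration.integral_cnj[symmetric]
proof (rule Bochner_Integration.integral_cong[OF refl])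
  fix y :: real assume "y \<in> space (lebesgue_on {0<..})"
  hence y: "y > 0" by simp
  show "\<phi> y * complex_of_real y powr (cnj s - 1) = cnj (\<phi> y * complex_of_real y powr (s - 1))"
    using assms[OF y] y by (simp add: powr_exp exp_cnj)
qed

end

section \<open>The completed L-function\<close>

lemma fourier_coeffs_zero:
  assumes "\<And>z. Im z > 0 \<Longrightarrow> (\<lambda>r. c r * exp (2 * of_real pi * \<i> * of_nat r * z)) sums 0"
  shows "c r = 0"
proof (rule powser_coeffs_zero[of 1])
  fix q :: complex assume q: "q \<noteq> 0" "norm q < 1"
  define z where "z = Ln q / (2 * of_real pi * \<i>)"
  have "Im z = - Re (Ln q) / (2 * pi)" by (simp add: z_def Im_divide power2_eq_square field_simps)
  hence "Im z > 0" using q by (simp add: divide_neg_pos ln_less_zero_iff)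
  moreover have e: "exp (2 * of_real pi * \<i> * of_nat r * z) = q ^ r" for r
  proof -
    have "exp (2 * of_real pi * \<i> * of_nat r * z) = exp (of_nat r * Ln q)" by (simp add: z_def)
    thus ?thesis using q(1) by (simp add: exp_of_nat_mult)
  qed
  ultimately show "(\<lambda>n. c n * q ^ n) sums 0" using assms[of z] unfolding e by blast
qed simp

lemma exp_fourier: "exp (2 * of_real pi * \<i> * of_nat r * z) = exp (2 * of_real pi * \<i> * z) ^ r"
  by (simp add: exp_of_nat_mult[symmetric] mult_ac)

lemma fourier_expansion_unique:
  assumes "fourier_expansion f a" "fourier_expansion f b"
  shows "a = b"
proof
  fix r
  have "a r - b r = 0"
  proof (rule fourier_coeffs_zero[where c = "\<lambda>r. a r - b r"])
    fix z :: complex assume z: "Im z > 0"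
    have "(\<lambda>r. a r * exp (2 * of_real pi * \<i> * of_nat r * z) - b r * exp (2 * of_real pi * \<i> * of_nat r * z)) sums (f z - f z)"
      using assms z unfolding fourier_expansion_def upper_half_plane_def by (intro sums_diff) auto
    thus "(\<lambda>r. (a r - b r) * exp (2 * of_real pi * \<i> * of_nat r * z)) sums 0"
      by (simp add: left_diff_distrib)
  qed
  thus "a r = b r" by simp
qed

section \<open>Fourier coefficients, Dirichlet series and decay along the imaginary axis\<close>

context cusp_form
begin

abbreviation "a \<equiv> fourier_coeff f"

lemma slash_1: "slash k (mat2 1 0 0 1) f = f"
  by (rule ext) (simp add: slash_mat2)

lemma periodic: assumes "Im z > 0" shows "f (z + 1) = f z"
  using transf[of "mat2 1 1 0 1" z] assms chi_1[OF chi] by (simp add: slash_mat2)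

lemma fourier: "fourier_expansion f a" and coeff_0: "a 0 = 0"
proof -
  have lim: "(f \<longlongrightarrow> 0) (filtercomap Im at_top)" using vanish[of "mat2 1 0 0 1"] by (simp add: slash_1)
  have ho: "f holomorphic_on {z. Im z > 0}" using holo by (simp add: upper_half_plane_def)
  have per: "f (z + of_real 1) = f z" if "Im z > 0" for z using periodic[OF that] by simp
  obtain G where G: "G holomorphic_on ball 0 1" "G 0 = 0"
    "\<And>z. Im z > 0 \<Longrightarrow> f z = G (exp (2 * of_real pi * \<i> * z / of_real 1))"
    using q_expansion_exists[OF ho zero_less_one per lim] by metis
  define b where "b = (\<lambda>r. (deriv ^^ r) G 0 / fact r)"
  have "fourier_expansion f b"
    unfolding fourier_expansion_def
  proof
    fix z assume "z \<in> upper_half_plane"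
    hence z: "Im z > 0" by (simp add: upper_half_plane_def)
    define q where "q = exp (2 * of_real pi * \<i> * z)"
    have "norm q < 1" using z by (simp add: q_def)
    hence "(\<lambda>n. (deriv ^^ n) G 0 / fact n * (q - 0) ^ n) sums G q"
      by (intro holomorphic_power_series[OF G(1)]) simp
    thus "(\<lambda>r. b r * exp (2 * of_real pi * \<i> * of_nat r * z)) sums f z"
      unfolding exp_fourier using G(3)[OF z] by (simp add: b_def q_def)
  qed
  moreover have "a = b" unfolding fourier_coeff_def
    by (rule the_equality) (use calculation fourier_expansion_unique in blast)+
  ultimately show "fourier_expansion f a" "a 0 = 0" using G(2) by (auto simp: b_def)
qed

lemma fourier_sums: "Im z > 0 \<Longrightarrow> (\<lambda>r. a r * exp (2 * of_real pi * \<i> * z) ^ r) sums f z"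
  using fourier unfolding fourier_expansion_def upper_half_plane_def exp_fourier by auto

lemma fourier_abs_summable:
  assumes "norm q < 1" shows "summable (\<lambda>r. norm (a r * q ^ r))"
proof -
  define t where "t = (norm q + 1) / 2"
  have t: "norm q < t" "0 < t" "t < 1" using assms by (auto simp: t_def add_nonneg_pos)
  define z where "z = \<i> * of_real (- ln t / (2 * pi))"
  have "ln t < 0" using t by simp
  hence "Im z > 0" by (simp add: z_def divide_neg_pos)
  moreover have "exp (2 * of_real pi * \<i> * z) = of_real t"
  proof -
    have "2 * of_real pi * \<i> * z = of_real (ln t)" by (simp add: z_def field_simps)
    thus ?thesis using t by (simp add: exp_of_real)
  qed
  ultimately have "(\<lambda>r. a r * of_real t ^ r) sums f z" using fourier_sums[of z] by simp
  hence "summable (\<lambda>r. a r * of_real t ^ r)" by (rule sums_summable)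
  thus ?thesis by (rule powser_insidea) (use t in simp)
qed

text \<open>On the line of height 1/X, |f|^2 is at most C X^k, and the weights exp(-4 pi n/X) of the
  first X coefficients are at least exp(-4 pi).\<close>

lemma coeff_mean_square:
  obtains C where "C \<ge> 0" "\<And>X. X \<ge> 1 \<Longrightarrow> (\<Sum>n<X. (norm (a n))\<^sup>2) \<le> C * real X ^ k"
proof -
  obtain C where C: "C \<ge> 0" "\<And>z. Im z > 0 \<Longrightarrow> (norm (f z))\<^sup>2 * Im z ^ k \<le> C" by (rule mean_bound) blast
  show ?thesis
  proof (rule that[of "C * exp (4 * pi)"])
    fix X :: nat assume X: "X \<ge> 1"
    define r where "r = exp (- (2 * pi / real X))"
    have r: "0 < r" "r < 1" using X by (auto simp: r_def)
    define B where "B = sqrt (C * real X ^ k)"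
    have B: "B \<ge> 0" "B\<^sup>2 = C * real X ^ k" using C by (auto simp: B_def)
    have "(\<Sum>n<X. (norm (a n))\<^sup>2 * r ^ (2 * n)) \<le> B\<^sup>2"
    proof (rule powser_mean_square_bound)
      show "summable (\<lambda>n. norm (a n) * r ^ n)"
        using fourier_abs_summable[of "of_real r"] r by (simp add: norm_mult norm_power)
      fix q :: complex assume q: "norm q = r"
      define z where "z = Ln q / (2 * of_real pi * \<i>)"
      have q0: "q \<noteq> 0" using q r by auto
      have "Im z = - ln (norm q) / (2 * pi)" using q0 by (simp add: z_def Im_divide power2_eq_square field_simps)
      also have "\<dots> = 1 / real X" unfolding q r_def by (simp add: field_simps)
      finally have Im: "Im z = 1 / real X" .
      hence z: "Im z > 0" using X by simp
      have "exp (2 * of_real pi * \<i> * z) = q" using q0 by (simp add: z_def)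
      hence "(\<Sum>n. a n * q ^ n) = f z" using fourier_sums[OF z] by (simp add: sums_iff)
      moreover have "(norm (f z))\<^sup>2 \<le> B\<^sup>2"
        using C(2)[OF z] X unfolding Im B(2) by (simp add: power_divide divide_le_eq)
      ultimately show "norm (\<Sum>n. a n * q ^ n) \<le> B" using B(1) power2_le_imp_le by metis
    qed (use r B in auto)
    moreover have "(\<Sum>n<X. (norm (a n))\<^sup>2 * exp (- (4 * pi))) \<le> (\<Sum>n<X. (norm (a n))\<^sup>2 * r ^ (2 * n))"
    proof (intro sum_mono mult_left_mono)
      fix n assume "n \<in> {..<X}"
      hence n: "real n \<le> real X" by simp
      have "r ^ (2 * n) = exp (- (real (2 * n) * (2 * pi / real X)))"
        unfolding r_def by (subst exp_of_nat_mult[symmetric]) simp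
      moreover have "real (2 * n) * (2 * pi / real X) \<le> 4 * pi" using n X by (simp add: field_simps)
      ultimately show "exp (- (4 * pi)) \<le> r ^ (2 * n)" by simp
    qed auto
    ultimately have "(\<Sum>n<X. (norm (a n))\<^sup>2) * exp (- (4 * pi)) \<le> C * real X ^ k"
      unfolding B(2) by (simp add: sum_distrib_right)
    hence "(\<Sum>n<X. (norm (a n))\<^sup>2) * exp (- (4 * pi)) * exp (4 * pi) \<le> C * real X ^ k * exp (4 * pi)"
      by (rule mult_right_mono) simp
    thus "(\<Sum>n<X. (norm (a n))\<^sup>2) \<le> C * exp (4 * pi) * real X ^ k"
      by (simp only: mult.assoc exp_add[symmetric]) (simp add: mult_ac)
  qed (use C in simp)
qed

lemma coeff_summable:
  assumes "\<sigma> > (real k + 1) / 2"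
  shows "summable (\<lambda>n. norm (a n) * real n powr (-\<sigma>))"
proof -
  obtain C where C: "C \<ge> 0" "\<And>X. X \<ge> 1 \<Longrightarrow> (\<Sum>n<X. (norm (a n))\<^sup>2) \<le> C * real X ^ k"
    by (rule coeff_mean_square) blast
  show ?thesis by (rule summable_if_mean_square_bound[OF C(2,1) assms])
qed

definition dterm :: "complex \<Rightarrow> nat \<Rightarrow> complex" where
  "dterm s n = a n * of_nat n powr (- s)"

lemma norm_dterm: "norm (dterm s n) = norm (a n) * real n powr (- Re s)"
proof -
  have "norm (of_nat n powr (- s)) = real n powr (- Re s)"
    using norm_powr_real[of "of_nat n" "-s"] by (cases "n = 0") (auto simp: powr_def)
  thus ?thesis by (simp add: dterm_def norm_mult)
qed

lemma dterm_summable: "Re s > (real k + 1) / 2 \<Longrightarrow> summable (\<lambda>n. norm (dterm s n))"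
  unfolding norm_dterm by (rule coeff_summable)

lemma L_series_eq:
  assumes "Re s > (real k + 1) / 2"
  shows "(\<lambda>n. dterm s n) sums L_series f s"
proof -
  have s: "summable (dterm s)" using dterm_summable[OF assms] by (rule summable_norm_cancel)
  have "L_series f s = (\<Sum>r. dterm s (Suc r))"
    unfolding L_series_def dterm_def by (simp only: powr_minus divide_inverse)
  also have "\<dots> = suminf (dterm s) - dterm s 0" by (rule suminf_split_head[OF s])
  also have "dterm s 0 = 0" by (simp add: dterm_def coeff_0)
  finally show ?thesis using s by (simp add: sums_iff)
qed

text \<open>Scaling by sqrt N puts the conductor factor (sqrt N / (2 pi))^s into the Mellin
  transform.\<close>

definition on_axis :: "real \<Rightarrow> complex" where
  "on_axis y = f (\<i> * of_real (y / sqrt (real N)))"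

lemma sqrt_N: "sqrt (real N) \<ge> 1" "sqrt (real N) > 0"
  using N by auto

text \<open>Decay near 0 is decay at infinity of the translate under z -> -1/z, evaluated at i sqrt
  N / y. It holds because the form vanishes at every cusp; the inversion need not belong to
  \<open>Gamma0 N\<close>.\<close>

lemma mellin_kernel_on_axis: "\<exists>\<beta> C. mellin_kernel on_axis \<beta> C k"
proof -
  have pos: "1 / sqrt (real N) > 0" using sqrt_N by simp
  have slI: "(1::int) * 1 - 0 * 0 = 1" and slS: "(0::int) * 0 - (-1) * 1 = 1" by simp_all
  obtain C1 where C1: "C1 \<ge> 0" "\<And>z. Im z \<ge> 1 / sqrt (real N) \<Longrightarrow> norm (f z) \<le> C1 * exp (- (2 * pi * Im z / real N))"
    using slash_decay[OF slI pos] unfolding slash_1 by metis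
  obtain C2 where C2: "C2 \<ge> 0" "\<And>z. Im z \<ge> 1 \<Longrightarrow> norm (slash k (mat2 0 (-1) 1 0) f z) \<le> C2 * exp (- (2 * pi * Im z / real N))"
    using slash_decay[OF slS zero_less_one] by metis
  \<comment> \<open>The smaller of the two rates 2 pi / (N sqrt N) for large y and 2 pi sqrt N / N
    in terms of 1/y for small y.\<close>
  define \<beta> where "\<beta> = 2 * pi / (real N * sqrt (real N))"
  define C where "C = C1 + C2 * sqrt (real N) ^ k"
  have N0: "real N > 0" using N by simp
  have "mellin_kernel on_axis \<beta> C k"
  proof
    show "continuous_on {0<..} on_axis" unfolding on_axis_def
    proof (rule continuous_on_compose2[OF holomorphic_on_imp_continuous_on[OF holo]])
      show "(\<lambda>y. \<i> * of_real (y / sqrt (real N))) ` {0<..} \<subseteq> upper_half_plane"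
        using sqrt_N by (auto simp: upper_half_plane_def)
    qed (intro continuous_intros, use sqrt_N in auto)
    show "\<beta> > 0" using N0 sqrt_N by (simp add: \<beta>_def)
    show "C \<ge> 0" using C1 C2 sqrt_N by (simp add: C_def)
    fix y :: real
    {
      assume y: "y \<ge> 1"
      have "1 / sqrt (real N) \<le> y / sqrt (real N)" using y sqrt_N by (intro divide_right_mono) auto
      hence "norm (on_axis y) \<le> C1 * exp (- (2 * pi * (y / sqrt (real N)) / real N))"
        unfolding on_axis_def using C1(2)[of "\<i> * of_real (y / sqrt (real N))"] by simp
      also have "2 * pi * (y / sqrt (real N)) / real N = \<beta> * y" by (simp add: \<beta>_def mult.commute)
      also have "C1 * exp (- (\<beta> * y)) \<le> C * exp (- \<beta> * y)"
        using C2 sqrt_N by (simp add: C_def)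
      finally show "norm (on_axis y) \<le> C * exp (- \<beta> * y)" .
    }
    assume y: "0 < y" "y \<le> 1"
    define v where "v = sqrt (real N) * inverse y"
    have iy: "inverse y \<ge> 1" using y by (simp add: one_le_inverse)
    have v: "v \<ge> 1" unfolding v_def using iy sqrt_N by (metis mult_mono mult_1 zero_le_one less_imp_le)
    have "slash k (mat2 0 (-1) 1 0) f (\<i> * of_real v) = (\<i> * of_real v) powi (- int k) * on_axis y"
    proof -
      have "- 1 / (\<i> * of_real v) = \<i> * of_real (y / sqrt (real N))"
        using y sqrt_N by (simp add: v_def field_simps)
      thus ?thesis by (simp add: slash_mat2 on_axis_def)
    qed
    hence "norm (slash k (mat2 0 (-1) 1 0) f (\<i> * of_real v)) = norm (on_axis y) / v ^ k"
      using v by (simp add: norm_mult power_int_minus norm_inverse norm_power divide_inverse mult.commute)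
    hence "norm (on_axis y) / v ^ k \<le> C2 * exp (- (2 * pi * v / real N))"
      using C2(2)[of "\<i> * of_real v"] v by simp
    hence "norm (on_axis y) \<le> C2 * exp (- (2 * pi * v / real N)) * v ^ k"
      using v by (simp add: divide_le_eq)
    also have "\<dots> = (C2 * sqrt (real N) ^ k) * inverse y ^ k * exp (- (2 * pi * v / real N))"
      by (simp add: v_def power_mult_distrib)
    also have "\<dots> \<le> C * inverse y ^ k * exp (- \<beta> * inverse y)"
    proof (intro mult_mono)
      have "\<beta> \<le> 2 * pi * sqrt (real N) / real N"
      proof -
        have "2 * pi / (real N * sqrt (real N)) \<le> 2 * pi / (real N * 1)"
          using N0 sqrt_N by (intro divide_left_mono mult_left_mono mult_pos_pos) auto
        also have "\<dots> \<le> 2 * pi * sqrt (real N) / real N" using N0 sqrt_N by (simp add: divide_right_mono)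
        finally show ?thesis by (simp add: \<beta>_def)
      qed
      hence "\<beta> * inverse y \<le> 2 * pi * sqrt (real N) / real N * inverse y" using y by (intro mult_right_mono) auto
      thus "exp (- (2 * pi * v / real N)) \<le> exp (- \<beta> * inverse y)" by (simp add: v_def)
      show "C2 * sqrt (real N) ^ k \<le> C" using C1 by (simp add: C_def)
    qed (use y C1 C2 sqrt_N in \<open>auto simp: C_def\<close>)
    finally show "norm (on_axis y) \<le> C * inverse y ^ k * exp (- \<beta> * inverse y)" .
  qed
  thus ?thesis by blast
qed

end

section \<open>Hecke operators at primes and nonvanishing of the L-series\<close>

lemma sum_roots_of_unity:
  assumes p: "p > 0"
  shows "(\<Sum>b<p. exp (2 * of_real pi * \<i> * (of_nat r * of_nat b / of_nat p))) = (if p dvd r then of_nat p else 0 :: complex)"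
proof -
  define \<zeta> where "\<zeta> = exp (2 * of_real pi * \<i> * of_nat r / of_nat p :: complex)"
  have pow: "exp (2 * of_real pi * \<i> * (of_nat r * of_nat b / of_nat p)) = \<zeta> ^ b" for b
    unfolding \<zeta>_def exp_of_nat_mult[symmetric] by (intro arg_cong[of _ _ exp]) (simp add: field_simps)
  have pp: "\<zeta> ^ p = 1"
  proof -
    have "\<zeta> ^ p = exp (2 * of_real pi * \<i>) ^ r"
      unfolding \<zeta>_def exp_of_nat_mult[symmetric] using p by (intro arg_cong[of _ _ exp]) (simp add: field_simps)
    thus ?thesis by simp
  qed
  have iff: "\<zeta> = 1 \<longleftrightarrow> p dvd r"
  proof
    assume "\<zeta> = 1"
    then obtain n :: int where "Im (2 * of_real pi * \<i> * of_nat r / of_nat p :: complex) = of_int (2 * n) * pi"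
      unfolding \<zeta>_def exp_eq_1 by blast
    hence "2 * pi * real r / real p = of_int (2 * n) * pi" by (simp add: Im_divide_of_nat)
    hence "2 * pi * real r = 2 * pi * (of_int n * real p)" using p by (simp add: divide_eq_eq)
    hence "real r = of_int n * real p" using pi_neq_zero by simp
    hence "int r = n * int p" by (metis of_int_eq_iff of_int_mult of_int_of_nat_eq)
    thus "p dvd r" by (metis dvd_triv_right int_dvd_int_iff)
  next
    assume "p dvd r"
    then obtain u where u: "r = p * u" by blast
    have "\<zeta> = exp (2 * of_real pi * \<i>) ^ u"
      unfolding \<zeta>_def exp_of_nat_mult[symmetric] u using p by (intro arg_cong[of _ _ exp]) (simp add: field_simps)
    thus "\<zeta> = 1" by simp
  qed
  show ?thesis
  proof (cases "p dvd r")
    case True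
    thus ?thesis unfolding pow using iff by simp
  next
    case False
    hence "\<zeta> \<noteq> 1" using iff by simp
    thus ?thesis unfolding pow using pp False by (simp add: geometric_sum)
  qed
qed

lemma hecke_prime:
  assumes p: "prime p" and chi: "chi 1 = 1"
  shows "hecke k chi p f z = 1 / of_nat p * (\<Sum>b<p. f ((z + of_nat b) / of_nat p))
    + chi (int p) * of_nat p ^ k / of_nat p * f (of_nat p * z)"
proof -
  have set: "{d. d dvd p} = {1, p}" using p by (auto simp: prime_nat_iff)
  have p1: "1 \<noteq> p" "p \<noteq> 0" using p by auto
  show ?thesis unfolding hecke_def set using p1 chi by (simp add: distrib_left)
qed

context cusp_form
begin

lemma f_sums: "Im z > 0 \<Longrightarrow> (\<lambda>r. a r * exp (2 * of_real pi * \<i> * (of_nat r * z))) sums f z"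
  using fourier unfolding fourier_expansion_def upper_half_plane_def by (auto simp: mult_ac)

text \<open>Averaging over \<open>b\<close> keeps the exponents divisible by \<open>p\<close>, by
  orthogonality of roots of unity; the term f(p z) contributes to the exponents that are multiples
  of \<open>p\<close>.\<close>

lemma hecke_sums:
  assumes p: "prime p" and z: "Im z > 0"
  shows "(\<lambda>t. (a (p * t) + (if p dvd t then chi (int p) * of_nat p ^ k / of_nat p * a (t div p) else 0))
    * exp (2 * of_real pi * \<i> * of_nat t * z)) sums hecke k chi p f z"
proof -
  have p0: "p > 0" using p prime_gt_0_nat by blast
  have inj: "strict_mono (\<lambda>t. p * t)" using p0 by (simp add: strict_mono_def)
  have zb: "Im ((z + of_nat b) / of_nat p) > 0" for b using z p0 by (simp add: Im_divide_of_nat)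
  have pz: "Im (of_nat p * z) > 0" using z p0 by simp
  have "(\<lambda>r. \<Sum>b<p. a r * exp (2 * of_real pi * \<i> * (of_nat r * ((z + of_nat b) / of_nat p)))) sums
      (\<Sum>b<p. f ((z + of_nat b) / of_nat p))"
    by (intro sums_sum f_sums zb)
  hence "(\<lambda>r. 1 / of_nat p * (\<Sum>b<p. a r * exp (2 * of_real pi * \<i> * (of_nat r * ((z + of_nat b) / of_nat p))))) sums
      (1 / of_nat p * (\<Sum>b<p. f ((z + of_nat b) / of_nat p)))"
    by (rule sums_mult)
  moreover have "1 / of_nat p * (\<Sum>b<p. a r * exp (2 * of_real pi * \<i> * (of_nat r * ((z + of_nat b) / of_nat p))))
      = (if p dvd r then a r * exp (2 * of_real pi * \<i> * (of_nat r / of_nat p * z)) else 0)" for r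
  proof -
    have "exp (2 * of_real pi * \<i> * (of_nat r * ((z + of_nat b) / of_nat p)))
        = exp (2 * of_real pi * \<i> * (of_nat r / of_nat p * z)) * exp (2 * of_real pi * \<i> * (of_nat r * of_nat b / of_nat p))" for b
      unfolding exp_add[symmetric] by (intro arg_cong[of _ _ exp]) (simp add: algebra_simps add_divide_distrib)
    hence "(\<Sum>b<p. a r * exp (2 * of_real pi * \<i> * (of_nat r * ((z + of_nat b) / of_nat p))))
        = a r * exp (2 * of_real pi * \<i> * (of_nat r / of_nat p * z)) *
          (\<Sum>b<p. exp (2 * of_real pi * \<i> * (of_nat r * of_nat b / of_nat p)))"
      by (simp only: sum_distrib_left mult.assoc)
    thus ?thesis unfolding sum_roots_of_unity[OF p0] using p0 by simp
  qed
  ultimately have "(\<lambda>r. if p dvd r then a r * exp (2 * of_real pi * \<i> * (of_nat r / of_nat p * z)) else 0) sums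
      (1 / of_nat p * (\<Sum>b<p. f ((z + of_nat b) / of_nat p)))" by (simp only:)
  hence "(\<lambda>t. if p dvd p * t then a (p * t) * exp (2 * of_real pi * \<i> * (of_nat (p * t) / of_nat p * z)) else 0) sums
      (1 / of_nat p * (\<Sum>b<p. f ((z + of_nat b) / of_nat p)))"
    by (subst sums_mono_reindex[OF inj]) auto
  hence 1: "(\<lambda>t. a (p * t) * exp (2 * of_real pi * \<i> * of_nat t * z)) sums
      (1 / of_nat p * (\<Sum>b<p. f ((z + of_nat b) / of_nat p)))"
    using p0 by (simp add: mult.assoc)
  define F where "F = (\<lambda>t. if p dvd t then a (t div p) * exp (2 * of_real pi * \<i> * of_nat t * z) else 0)"
  have "(\<lambda>t. F (p * t)) sums f (of_nat p * z)"
    using f_sums[OF pz] p0 by (simp add: F_def mult_ac)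
  hence "F sums f (of_nat p * z)"
    by (subst (asm) sums_mono_reindex[OF inj]) (auto simp: F_def elim!: dvdE)
  hence 2: "(\<lambda>t. chi (int p) * of_nat p ^ k / of_nat p * F t) sums (chi (int p) * of_nat p ^ k / of_nat p * f (of_nat p * z))"
    by (rule sums_mult)
  have "(\<lambda>t. a (p * t) * exp (2 * of_real pi * \<i> * of_nat t * z) + chi (int p) * of_nat p ^ k / of_nat p * F t) sums hecke k chi p f z"
    unfolding hecke_prime[of p chi, OF p chi_1[OF chi]] by (rule sums_add[OF 1 2])
  thus ?thesis by (rule sums_cong[THEN iffD1, rotated]) (auto simp: F_def distrib_right)
qed

text \<open>Comparing coefficients in the eigenvalue equation; the coefficient at 1 identifies the
  eigenvalue as \<open>a p\<close>.\<close>

lemma hecke_relation: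
  assumes p: "prime p" and one: "a 1 = 1"
    and eig: "\<And>z. Im z > 0 \<Longrightarrow> hecke k chi p f z = c * f z"
  shows "a (p * t) = a p * a t - (if p dvd t then chi (int p) * of_nat p ^ k / of_nat p * a (t div p) else 0)"
proof -
  define b where "b = (\<lambda>t. a (p * t) + (if p dvd t then chi (int p) * of_nat p ^ k / of_nat p * a (t div p) else 0))"
  have bt: "b t = c * a t" for t
  proof -
    have "b t - c * a t = 0"
    proof (rule fourier_coeffs_zero[where c = "\<lambda>t. b t - c * a t"])
      fix z assume z: "Im z > 0"
      have "(\<lambda>r. b r * exp (2 * of_real pi * \<i> * of_nat r * z) - c * (a r * exp (2 * of_real pi * \<i> * (of_nat r * z)))) sums
          (hecke k chi p f z - c * f z)"
        unfolding b_def by (intro sums_diff sums_mult f_sums hecke_sums p z)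
      thus "(\<lambda>r. (b r - c * a r) * exp (2 * of_real pi * \<i> * of_nat r * z)) sums 0"
        using eig[OF z] by (simp add: left_diff_distrib mult.assoc)
    qed
    thus ?thesis by simp
  qed
  have "\<not> p dvd 1" using p by auto
  hence "c = a p" using bt[of 1] one by (simp add: b_def)
  thus ?thesis using bt[of t] by (simp add: b_def algebra_simps)
qed

lemma L_series_nonzero:
  assumes one: "a 1 = 1" and eig: "\<And>p. prime p \<Longrightarrow> \<exists>c. \<forall>z \<in> upper_half_plane. hecke k chi p f z = c * f z"
    and s: "Re s > (real k + 1) / 2"
  shows "L_series f s \<noteq> 0"
proof -
  have sm: "summable (\<lambda>n. norm (dterm s n))" by (rule dterm_summable[OF s])
  have "(dterm s has_sum L_series f s) UNIV"
    by (rule norm_summable_imp_has_sum[OF sm L_series_eq[OF s]])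
  hence "L_series f s = (\<Sum>\<^sub>\<infinity>n\<in>UNIV. dterm s n)" by (simp add: infsumI)
  also have "\<dots> \<noteq> 0"
  proof (rule hecke_series_nonzero[where \<alpha> = "\<lambda>p. a p * of_nat p powr (- s)"
        and \<beta> = "\<lambda>p. chi (int p) * of_nat p ^ k / of_nat p * of_nat p powr (- s) * of_nat p powr (- s)"])
    show "(\<lambda>n. norm (dterm s n)) summable_on UNIV" using sm by (simp add: summable_on_UNIV_nonneg_real_iff)
    show "dterm s 1 = 1" "dterm s 0 = 0" using one by (auto simp: dterm_def)
    fix p t :: nat assume p: "prime p" and t: "t > 0"
    have mul: "of_nat (p * u) powr (- s) = (of_nat p powr (- s) * of_nat u powr (- s) :: complex)" for u
      by (simp add: powr_times_real)
    obtain c where c: "\<And>z. Im z > 0 \<Longrightarrow> hecke k chi p f z = c * f z"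
      using eig[OF p] by (auto simp: upper_half_plane_def)
    show "dterm s (p * t) = a p * of_nat p powr (- s) * dterm s t -
        (if p dvd t then chi (int p) * of_nat p ^ k / of_nat p * of_nat p powr (- s) * of_nat p powr (- s) * dterm s (t div p) else 0)"
    proof (cases "p dvd t")
      case True
      then obtain u where u: "t = p * u" by blast
      have "t div p = u" using u p by (simp add: prime_gt_0_nat)
      hence hr: "a (p * t) = a p * a t - chi (int p) * of_nat p ^ k / of_nat p * a u"
        using hecke_relation[OF p one c, of t] True by simp
      have "dterm s (p * t) = (a p * a t - chi (int p) * of_nat p ^ k / of_nat p * a u) * (of_nat p powr (- s) * of_nat t powr (- s))"
        unfolding dterm_def mul[of t] hr ..
      moreover have "of_nat t powr (- s) = (of_nat p powr (- s) * of_nat u powr (- s) :: complex)" unfolding u by (rule mul)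
      ultimately show ?thesis using True \<open>t div p = u\<close> by (simp add: dterm_def algebra_simps)
    next
      case False
      hence hr: "a (p * t) = a p * a t" using hecke_relation[OF p one c, of t] by simp
      show ?thesis unfolding dterm_def mul[of t] hr using False by simp
    qed
  qed
  finally show ?thesis .
qed

section \<open>The completed L-function as a Mellin transform\<close>

definition Lam :: "complex \<Rightarrow> complex" where
  "Lam = mellin_kernel.mellin on_axis"

lemma Lam_eq:
  assumes s: "Re s > (real k + 1) / 2"
  shows "Lam s = of_real (sqrt (real N) / (2 * pi)) powr s * Gamma s * L_series f s"
proof -
  let ?M = "lebesgue_on {0<..} :: real measure"
  obtain \<beta> C where "mellin_kernel on_axis \<beta> C k" using mellin_kernel_on_axis by blast
  then interpret mellin_kernel on_axis \<beta> C k .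
  define w where "w = 2 * pi / sqrt (real N)"
  have w: "w > 0" using sqrt_N by (simp add: w_def)
  have s0: "Re s > 0" using s by (simp add: add_pos_nonneg less_trans[rotated])
  define F where "F = (\<lambda>r y. a r * (complex_of_real y powr (s - 1) / of_real (exp (w * real r * y))))"
  have intF: "integrable ?M (F r)" and valF: "integral\<^sup>L ?M (F r) = of_real w powr (- s) * Gamma s * dterm s r" for r
  proof -
    \<comment> \<open>The constant term would have a divergent integral; it is absent because
      \<open>a 0 = 0\<close>.\<close>
    have "integrable ?M (F r) \<and> integral\<^sup>L ?M (F r) = of_real w powr (- s) * Gamma s * dterm s r"
    proof (cases "r = 0")
      case True
      thus ?thesis by (simp add: F_def coeff_0 dterm_def)
    next
      case False
      hence wr: "w * real r > 0" using w by simp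
      have "of_real (w * real r) powr (- s) = (of_real w powr (- s) * of_nat r powr (- s) :: complex)"
        using w by (simp add: powr_times_real)
      hence "integral\<^sup>L ?M (F r) = a r * ((of_real w powr (- s) * of_nat r powr (- s)) * Gamma s)"
        unfolding F_def integral_mult_right_zero Gamma_integral_scaled(2)[OF s0 wr] by (simp only:)
      moreover have "integrable ?M (F r)"
        unfolding F_def by (intro integrable_mult_right Gamma_integral_scaled(1)[OF s0 wr])
      ultimately show ?thesis by (simp add: dterm_def mult_ac)
    qed
    thus "integrable ?M (F r)" "integral\<^sup>L ?M (F r) = of_real w powr (- s) * Gamma s * dterm s r" by auto
  qed
  have expand: "on_axis y = (\<Sum>r. a r * of_real (exp (- (w * real r * y))))"
    and summ: "summable (\<lambda>r. norm (a r * of_real (exp (- (w * real r * y)))))" if y: "y > 0" for y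
  proof -
    define z where "z = \<i> * of_real (y / sqrt (real N))"
    have z: "Im z > 0" using y sqrt_N by (simp add: z_def)
    have "exp (2 * of_real pi * \<i> * z) = of_real (exp (- (w * y)))"
    proof -
      have "2 * of_real pi * \<i> * z = of_real (- (w * y))" by (simp add: z_def w_def algebra_simps)
      thus ?thesis by (simp only: exp_of_real)
    qed
    hence e: "exp (2 * of_real pi * \<i> * z) ^ r = of_real (exp (- (w * real r * y)))" for r
      by (simp add: exp_of_nat_mult[symmetric] mult_ac flip: of_real_power)
    show "on_axis y = (\<Sum>r. a r * of_real (exp (- (w * real r * y))))"
      using fourier_sums[OF z] unfolding e by (simp add: on_axis_def z_def sums_iff)
    have "norm (exp (2 * of_real pi * \<i> * z)) < 1" using z by simp
    from fourier_abs_summable[OF this] show "summable (\<lambda>r. norm (a r * of_real (exp (- (w * real r * y)))))"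
      unfolding e .
  qed
  have F_alt: "F r y = a r * of_real (exp (- (w * real r * y))) * of_real y powr (s - 1)" for r y
    by (simp add: F_def exp_minus divide_inverse)
  have "(\<lambda>r. integral\<^sup>L ?M (F r)) sums (integral\<^sup>L ?M (\<lambda>y. \<Sum>r. F r y))"
  proof (rule sums_integral[OF intF])
    show "AE y in ?M. summable (\<lambda>r. norm (F r y))"
    proof (rule AE_I2)
      fix y assume "y \<in> space ?M"
      hence y: "y > 0" by simp
      have "summable (\<lambda>r. norm (a r * of_real (exp (- (w * real r * y)))) * norm (of_real y powr (s - 1) :: complex))"
        by (rule summable_mult2[OF summ[OF y]])
      thus "summable (\<lambda>r. norm (F r y))" unfolding F_alt norm_mult[symmetric] .
    qed
    define \<sigma> where "\<sigma> = Re s"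
    have "integral\<^sup>L ?M (\<lambda>y. norm (F r y)) = w powr (- \<sigma>) * Gamma \<sigma> * (norm (a r) * real r powr (- \<sigma>))" for r
    proof (cases "r = 0")
      case True
      thus ?thesis by (simp add: F_def coeff_0)
    next
      case False
      hence wr: "w * real r > 0" using w by simp
      have r\<sigma>: "Re (of_real \<sigma> :: complex) > 0" using s0 by (simp add: \<sigma>_def)
      have "complex_of_real (integral\<^sup>L ?M (\<lambda>y. norm (F r y))) = integral\<^sup>L ?M (\<lambda>y. of_real (norm (F r y)))"
        by (rule integral_complex_of_real[symmetric])
      also have "\<dots> = integral\<^sup>L ?M (\<lambda>y. of_real (norm (a r)) * (complex_of_real y powr (of_real \<sigma> - 1) / of_real (exp (w * real r * y))))"
      proof (rule Bochner_Integration.integral_cong[OF refl])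
        fix y assume "y \<in> space ?M"
        hence y: "y > 0" by simp
        have "norm (of_real y powr (s - 1) :: complex) = y powr (\<sigma> - 1)"
          using norm_powr_real[of "of_real y" "s - 1"] y by (simp add: \<sigma>_def powr_def)
        moreover have "complex_of_real y powr (of_real \<sigma> - 1) = of_real (y powr (\<sigma> - 1))"
          using y by (metis powr_of_real less_imp_le of_real_1 of_real_diff)
        ultimately show "of_real (norm (F r y)) = of_real (norm (a r)) * (complex_of_real y powr (of_real \<sigma> - 1) / of_real (exp (w * real r * y)))"
          by (simp add: F_def norm_mult norm_divide)
      qed
      also have "\<dots> = of_real (norm (a r)) * (of_real (w * real r) powr (- of_real \<sigma>) * Gamma (of_real \<sigma>))"
        unfolding integral_mult_right_zero Gamma_integral_scaled(2)[OF r\<sigma> wr] ..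
      also have "of_real (w * real r) powr (- of_real \<sigma>) = complex_of_real ((w * real r) powr (- \<sigma>))"
        using wr by (metis powr_of_real less_imp_le of_real_minus)
      also have "of_real (norm (a r)) * (complex_of_real ((w * real r) powr (- \<sigma>)) * Gamma (of_real \<sigma>))
          = complex_of_real (w powr (- \<sigma>) * Gamma \<sigma> * (norm (a r) * real r powr (- \<sigma>)))"
        using w by (simp add: powr_mult Gamma_complex_of_real mult_ac)
      finally show ?thesis by (simp only: of_real_eq_iff)
    qed
    moreover have "summable (\<lambda>r. w powr (- \<sigma>) * Gamma \<sigma> * (norm (a r) * real r powr (- \<sigma>)))"
      by (intro summable_mult coeff_summable) (use s in \<open>simp add: \<sigma>_def\<close>)
    ultimately show "summable (\<lambda>r. integral\<^sup>L ?M (\<lambda>y. norm (F r y)))" by (simp only:)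
  qed
  moreover have "integral\<^sup>L ?M (\<lambda>y. \<Sum>r. F r y) = Lam s"
    unfolding Lam_def mellin_def
  proof (rule Bochner_Integration.integral_cong[OF refl])
    fix y assume "y \<in> space ?M"
    hence y: "y > 0" by simp
    show "(\<Sum>r. F r y) = on_axis y * of_real y powr (s - 1)"
      unfolding F_alt expand[OF y] by (rule suminf_mult2[symmetric, OF summable_norm_cancel[OF summ[OF y]]])
  qed
  ultimately have "(\<lambda>r. of_real w powr (- s) * Gamma s * dterm s r) sums Lam s" unfolding valF by simp
  moreover have "(\<lambda>r. of_real w powr (- s) * Gamma s * dterm s r) sums (of_real w powr (- s) * Gamma s * L_series f s)"
    by (intro sums_mult L_series_eq s)
  ultimately have "Lam s = of_real w powr (- s) * Gamma s * L_series f s" by (rule sums_unique2)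
  moreover have "of_real w powr (- s) = (of_real (sqrt (real N) / (2 * pi)) powr s :: complex)"
  proof -
    have "complex_of_real (sqrt (real N) / (2 * pi)) = of_real (inverse w)" by (simp add: w_def)
    moreover have "complex_of_real w powr (- s) = of_real (inverse w) powr s"
      using w by (simp add: powr_def Ln_of_real ln_inverse del: of_real_inverse)
    ultimately show ?thesis by simp
  qed
  ultimately show ?thesis by simp
qed

lemma Lam_entire: "Lam holomorphic_on UNIV"
  and Lam_growth: "\<epsilon> > 0 \<Longrightarrow> \<exists>D. \<forall>s. norm (Lam s) \<le> D * exp (\<epsilon> * (norm s)\<^sup>2)"
proof -
  obtain \<beta> C where "mellin_kernel on_axis \<beta> C k" using mellin_kernel_on_axis by blast
  then interpret mellin_kernel on_axis \<beta> C k .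
  show "Lam holomorphic_on UNIV" "\<epsilon> > 0 \<Longrightarrow> \<exists>D. \<forall>s. norm (Lam s) \<le> D * exp (\<epsilon> * (norm s)\<^sup>2)"
    unfolding Lam_def using mellin_holomorphic mellin_subgaussian by auto
qed

lemma Lam_cnj:
  assumes "\<And>r. a r \<in> \<real>"
  shows "Lam (cnj s) = cnj (Lam s)"
proof -
  obtain \<beta> C where "mellin_kernel on_axis \<beta> C k" using mellin_kernel_on_axis by blast
  then interpret mellin_kernel on_axis \<beta> C k .
  have "cnj (on_axis y) = on_axis y" if y: "y > 0" for y
  proof -
    define z where "z = \<i> * of_real (y / sqrt (real N))"
    have z: "Im z > 0" using y sqrt_N by (simp add: z_def)
    define x where "x = - (2 * pi * (y / sqrt (real N)))"
    have "2 * of_real pi * \<i> * z = of_real x" by (simp add: z_def x_def algebra_simps)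
    hence e: "exp (2 * of_real pi * \<i> * z) = of_real (exp x)" by (simp only: exp_of_real)
    have "(\<lambda>r. cnj (a r * exp (2 * of_real pi * \<i> * z) ^ r)) sums cnj (f z)"
      using fourier_sums[OF z] by (simp only: sums_cnj)
    moreover have "cnj (a r * exp (2 * of_real pi * \<i> * z) ^ r) = a r * exp (2 * of_real pi * \<i> * z) ^ r" for r
      using assms[of r] unfolding e by (simp add: Reals_cnj_iff)
    ultimately have "(\<lambda>r. a r * exp (2 * of_real pi * \<i> * z) ^ r) sums cnj (f z)" by (simp only:)
    hence "cnj (f z) = f z" using fourier_sums[OF z] sums_unique2 by blast
    thus ?thesis by (simp add: on_axis_def z_def)
  qed
  thus ?thesis unfolding Lam_def by (rule mellin_cnj)
qed

text \<open>Two entire functions satisfying the description agree on a common half plane, hence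
  everywhere, so the definite description denotes the Mellin transform.\<close>

lemma completed_L_eq: "completed_L N f = Lam"
  unfolding completed_L_def
proof (rule the_equality)
  show "Lam holomorphic_on UNIV \<and> (\<exists>\<sigma>. \<forall>s. Re s > \<sigma> \<longrightarrow>
      Lam s = of_real (sqrt (real N) / (2 * pi)) powr s * Gamma s * L_series f s)"
    using Lam_entire Lam_eq by blast
  fix M assume M: "M holomorphic_on UNIV \<and> (\<exists>\<sigma>. \<forall>s. Re s > \<sigma> \<longrightarrow>
      M s = of_real (sqrt (real N) / (2 * pi)) powr s * Gamma s * L_series f s)"
  then obtain \<sigma> where \<sigma>: "\<And>s. Re s > \<sigma> \<Longrightarrow> M s = of_real (sqrt (real N) / (2 * pi)) powr s * Gamma s * L_series f s"
    by blast
  define \<tau> where "\<tau> = max \<sigma> ((real k + 1) / 2)"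
  have "M s = Lam s" for s
  proof (rule analytic_continuation_open[of "{s. Re s > \<tau>}" UNIV M Lam])
    show "open {s. Re s > \<tau>}" by (rule open_halfspace_Re_gt)
    have "of_real (\<tau> + 1) \<in> {s. Re s > \<tau>}" by simp
    thus "{s. Re s > \<tau>} \<noteq> {}" by blast
    show "M z = Lam z" if "z \<in> {s. Re s > \<tau>}" for z
      using that \<sigma>[of z] Lam_eq[of z] by (simp add: \<tau>_def)
  qed (use M Lam_entire in auto)
  thus "M = Lam" by blast
qed

lemma Lam_nonzero:
  assumes one: "a 1 = 1" and eig: "\<And>p. prime p \<Longrightarrow> \<exists>c. \<forall>z \<in> upper_half_plane. hecke k chi p f z = c * f z"
    and s: "Re s > (real k + 1) / 2"
  shows "Lam s \<noteq> 0"
proof -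
  have s0: "Re s > 0" using s by (simp add: add_pos_nonneg less_trans[rotated])
  have "Gamma s \<noteq> 0" using s0 by (auto simp: Gamma_eq_zero_iff elim!: nonpos_Ints_cases)
  thus ?thesis unfolding Lam_eq[OF s] using L_series_nonzero[OF one eig s] sqrt_N by simp
qed

text \<open>Relative to a fixed exponent \<open>m0\<close> of absolute convergence, all terms from
  the second on carry an additional factor of at most 2^(m0 - m).\<close>

lemma L_series_limit:
  assumes one: "a 1 = 1"
  shows "(\<lambda>m. L_series f (of_nat m)) \<longlonglongrightarrow> 1"
proof -
  define m0 where "m0 = k + 2"
  have m0: "real m0 > (real k + 1) / 2" by (simp add: m0_def field_simps)
  have sm0: "summable (\<lambda>n. norm (a n) * real n powr (- real m0))" by (rule coeff_summable[OF m0])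
  define S where "S = (\<Sum>n. norm (a n) * real n powr (- real m0))"
  have bd: "norm (L_series f (of_nat m) - 1) \<le> S * 2 ^ m0 * (1/2) ^ m" if m: "m \<ge> m0" for m
  proof -
    have mr: "Re (of_nat m :: complex) > (real k + 1) / 2" using m m0 by simp
    have "(dterm (of_nat m)) sums L_series f (of_nat m)" by (rule L_series_eq[OF mr])
    hence "(\<lambda>n. dterm (of_nat m) (n + 2)) sums (L_series f (of_nat m) - (\<Sum>i<2. dterm (of_nat m) i))"
      by (subst sums_iff_shift) simp
    moreover have "(\<Sum>i<2. dterm (of_nat m) i) = 1" using one by (simp add: numeral_2_eq_2 dterm_def coeff_0)
    ultimately have sh: "(\<lambda>n. dterm (of_nat m) (n + 2)) sums (L_series f (of_nat m) - 1)" by simp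
    have le: "norm (dterm (of_nat m) (n + 2)) \<le> 2 ^ m0 * (1/2) ^ m * (norm (a (n + 2)) * real (n + 2) powr (- real m0))" for n
    proof -
      have "- real m = - real m0 + - (real m - real m0)" by simp
      hence "real (n + 2) powr (- real m) = real (n + 2) powr (- real m0) * real (n + 2) powr (- (real m - real m0))"
        by (metis powr_add)
      also have "\<dots> \<le> real (n + 2) powr (- real m0) * 2 powr (- (real m - real m0))"
        using m by (intro mult_left_mono powr_mono2') auto
      also have "2 powr (- (real m - real m0)) = 2 powr real m0 * 2 powr (- real m)"
      proof -
        have "- (real m - real m0) = real m0 + - real m" by simp
        thus ?thesis by (simp only: powr_add)
      qed
      also have "2 powr real m0 * 2 powr (- real m) = 2 ^ m0 * ((1/2) ^ m :: real)"
        by (simp only: powr_realpow powr_minus power_one_over divide_inverse mult_1 zero_less_numeral power_inverse)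
      finally have "norm (a (n + 2)) * real (n + 2) powr (- real m) \<le> norm (a (n + 2)) * (real (n + 2) powr (- real m0) * (2 ^ m0 * (1/2) ^ m))"
        by (intro mult_left_mono) auto
      thus ?thesis unfolding norm_dterm by (simp add: mult_ac)
    qed
    have sm: "summable (\<lambda>n. norm (a (n + 2)) * real (n + 2) powr (- real m0))"
      using summable_ignore_initial_segment[OF sm0, of 2] .
    have "norm (L_series f (of_nat m) - 1) \<le> (\<Sum>n. 2 ^ m0 * (1/2) ^ m * (norm (a (n + 2)) * real (n + 2) powr (- real m0)))"
      using norm_suminf_le[OF le summable_mult[OF sm]] sh by (simp add: sums_iff)
    also have "\<dots> = 2 ^ m0 * (1/2) ^ m * (\<Sum>n. norm (a (n + 2)) * real (n + 2) powr (- real m0))"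
      by (rule suminf_mult[OF sm])
    also have "\<dots> \<le> 2 ^ m0 * (1/2) ^ m * S"
    proof (intro mult_left_mono)
      have "S = (\<Sum>n. norm (a (n + 2)) * real (n + 2) powr (- real m0)) + (\<Sum>n<2. norm (a n) * real n powr (- real m0))"
        unfolding S_def by (rule suminf_split_initial_segment[OF sm0])
      moreover have "(\<Sum>n<2. norm (a n) * real n powr (- real m0)) \<ge> 0" by (intro sum_nonneg) auto
      ultimately show "(\<Sum>n. norm (a (n + 2)) * real (n + 2) powr (- real m0)) \<le> S" by simp
    qed auto
    finally show ?thesis by (simp add: mult_ac)
  qed
  have "(\<lambda>m. L_series f (of_nat m) - 1) \<longlonglongrightarrow> 0"
  proof (rule Lim_null_comparison)
    show "\<forall>\<^sub>F m in sequentially. norm (L_series f (of_nat m) - 1) \<le> S * 2 ^ m0 * (1/2) ^ m"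
      using eventually_ge_at_top[of m0] by eventually_elim (rule bd)
    have "(\<lambda>m. S * 2 ^ m0 * (1/2::real) ^ m) \<longlonglongrightarrow> S * 2 ^ m0 * 0"
      by (intro tendsto_mult_left LIMSEQ_power_zero) simp
    thus "(\<lambda>m. S * 2 ^ m0 * (1/2::real) ^ m) \<longlonglongrightarrow> 0" by simp
  qed
  thus ?thesis by (simp add: LIM_zero_iff)
qed

text \<open>At a large integer m the value is (sqrt N / (2 pi))^m (m - 1)! L(f, m), where L(f, m)
  tends to 1; no polynomial grows that fast.\<close>

lemma Lam_not_polynomial:
  assumes one: "a 1 = 1"
  shows "\<exists>z. (deriv ^^ d) Lam z \<noteq> 0"
proof (rule ccontr)
  assume "\<nexists>z. (deriv ^^ d) Lam z \<noteq> 0"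
  hence z: "(deriv ^^ d) Lam = (\<lambda>_. 0)" by auto
  have zero: "(deriv ^^ n) Lam 0 = 0" if "n \<ge> d" for n
  proof -
    have "(deriv ^^ n) Lam = (deriv ^^ (n - d)) ((deriv ^^ d) Lam)"
      using that by (metis funpow_add comp_apply le_add_diff_inverse2)
    also have "\<dots> = (\<lambda>_. 0)" unfolding z by (induction "n - d") (auto simp: funpow_swap1)
    finally show ?thesis by simp
  qed
  define c where "c = (\<lambda>n. (deriv ^^ n) Lam 0 / fact n)"
  have poly: "Lam w = (\<Sum>n<d. c n * w ^ n)" for w
  proof -
    have "(\<lambda>n. (deriv ^^ n) Lam 0 / fact n * (w - 0) ^ n) sums Lam w"
      by (rule holomorphic_power_series[of _ 0 "norm w + 1"])
         (auto intro: holomorphic_on_subset[OF Lam_entire] simp: add_nonneg_pos)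
    moreover have "(\<lambda>n. (deriv ^^ n) Lam 0 / fact n * (w - 0) ^ n) sums (\<Sum>n<d. c n * w ^ n)"
      using sums_finite[of "{..<d}" "\<lambda>n. (deriv ^^ n) Lam 0 / fact n * (w - 0) ^ n"] zero
      by (simp add: c_def)
    ultimately show ?thesis by (rule sums_unique2)
  qed
  define B where "B = (\<Sum>n<d. norm (c n))"
  have Lbd: "norm (Lam (of_nat m)) \<le> B * real m ^ d" if m: "m \<ge> 1" for m
  proof -
    have "norm (Lam (of_nat m)) \<le> (\<Sum>n<d. norm (c n * of_nat m ^ n))" unfolding poly by (rule norm_sum)
    also have "\<dots> \<le> (\<Sum>n<d. norm (c n) * real m ^ d)"
    proof (intro sum_mono)
      fix n assume "n \<in> {..<d}"
      hence "real m ^ n \<le> real m ^ d" using m by (intro power_increasing) auto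
      thus "norm (c n * of_nat m ^ n) \<le> norm (c n) * real m ^ d"
        by (simp add: norm_mult norm_power mult_left_mono)
    qed
    finally show ?thesis by (simp add: B_def sum_distrib_right)
  qed
  define A where "A = sqrt (real N) / (2 * pi)"
  have A: "A > 0" using sqrt_N by (simp add: A_def)
  \<comment> \<open>A factor 2^m is inserted above and below, so that the power of m and the
    exponential over the factorial each tend to 0.\<close>
  define E where "E = (\<lambda>m::nat. B * (real m ^ (d + 1) / 2 ^ m) * ((2 / A) ^ m /\<^sub>R fact m))"
  have "E \<longlonglongrightarrow> B * 0 * 0" unfolding E_def
  proof (intro tendsto_mult tendsto_const)
    show "(\<lambda>m::nat. real m ^ (d + 1) / 2 ^ m) \<longlonglongrightarrow> 0"
      by real_asymp
    show "(\<lambda>m. (2 / A) ^ m /\<^sub>R fact m) \<longlonglongrightarrow> 0"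
      by (rule summable_LIMSEQ_zero[OF summable_exp_generic])
  qed
  hence E0: "E \<longlonglongrightarrow> 0" by simp
  have "\<forall>\<^sub>F m in sequentially. norm (L_series f (of_nat m)) \<le> E m"
    using eventually_ge_at_top[of "k + 2"]
  proof eventually_elim
    case (elim m)
    hence m: "m \<ge> 1" "Re (of_nat m :: complex) > (real k + 1) / 2" by auto
    have G: "Gamma (of_nat m :: complex) = of_real (fact (m - 1))"
      using Gamma_fact[of "m - 1", where 'a = complex] m(1) by (simp add: of_nat_diff)
    have Apow: "of_real A powr (of_nat m :: complex) = of_real (A ^ m)" using A by simp
    have "norm (Lam (of_nat m)) = A ^ m * fact (m - 1) * norm (L_series f (of_nat m))"
      unfolding Lam_eq[OF m(2)] A_def[symmetric] Apow G using A by (simp add: norm_mult norm_power)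
    hence "A ^ m * fact (m - 1) * norm (L_series f (of_nat m)) \<le> B * real m ^ d" using Lbd[OF m(1)] by simp
    hence "norm (L_series f (of_nat m)) \<le> B * real m ^ d / (A ^ m * fact (m - 1))"
      using A by (simp add: pos_le_divide_eq mult_ac)
    also have "\<dots> = E m"
    proof -
      have "fact m = real m * fact (m - 1)" using m(1) by (simp add: fact_reduce)
      thus ?thesis using A m(1) by (simp add: E_def power_divide divide_simps)
    qed
    finally show ?case .
  qed
  hence "(\<lambda>m. L_series f (of_nat m)) \<longlonglongrightarrow> 0" using E0 by (rule Lim_null_comparison)
  thus False using L_series_limit[OF one] LIMSEQ_unique by fastforce
qed

end

section \<open>The polynomials of the theorem\<close>

lemma poly_P_poly:
  "poly (P_poly k N f m \<delta> n) z = (\<Sum>j\<le>2*n+1. of_nat ((2*n+1) choose j) *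
     (deriv ^^ m) (completed_L N f) (of_real (real k / 2 + real \<delta> * (real j - real n - 1 / 2))) * z ^ j)"
  by (simp add: P_poly_def poly_sum poly_monom del: sum.atMost_Suc binomial_Suc_Suc)

text \<open>The parity of \<open>lam\<close> is the functional equation of the m-th derivative. It
  makes the coefficients palindromic up to \<kappa>, so that the definite description in
  \<open>Q_poly\<close> has exactly one solution.\<close>

lemma Q_poly_eq:
  assumes k: "\<kappa> = 1 \<or> \<kappa> = (-1::real)" and \<kappa>: "of_real \<epsilon> * (-1) ^ m = (of_real \<kappa> :: complex)"
    and par: "\<And>\<omega>. lam (-\<omega>) = \<kappa> * lam \<omega>"
    and lam: "\<And>\<omega>. (deriv ^^ m) (completed_L N f) (of_real (real k / 2 + real \<delta> * \<omega>)) = of_real (lam \<omega>)"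
  shows "degree (Q_poly k N f \<epsilon> m \<delta> n) \<le> n" (is ?deg)
    and "z \<noteq> 0 \<Longrightarrow> (\<Sum>j\<le>2*n+1. of_real (real ((2*n+1) choose j) * lam (real j - real n - 1/2)) * z ^ j)
      = z ^ n * (z + of_real \<kappa>) * poly (cpoly (Q_poly k N f \<epsilon> m \<delta> n)) (z + inverse z)"
proof -
  define b where "b = (\<lambda>j. real ((2*n+1) choose j) * lam (real j - real n - 1/2))"
  have P: "poly (P_poly k N f m \<delta> n) z = (\<Sum>j\<le>2*n+1. of_real (b j) * z ^ j)" for z
    unfolding poly_P_poly lam b_def by (simp only: of_real_mult of_real_of_nat_eq)
  have sym: "b (2 * n + 1 - j) = \<kappa> * b j" if j: "j \<le> 2 * n + 1" for j
  proof -
    have "real (2 * n + 1 - j) - real n - 1/2 = - (real j - real n - 1/2)" using j by (simp add: of_nat_diff)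
    moreover have "(2*n+1) choose (2*n+1-j) = (2*n+1) choose j" using j by (rule binomial_symmetric[symmetric])
    ultimately show ?thesis unfolding b_def by (simp only: par mult.left_commute)
  qed
  obtain Q where Q: "degree Q \<le> n" "\<And>z::complex. z \<noteq> 0 \<Longrightarrow>
      (\<Sum>j\<le>2 * n + 1. of_real (b j) * z ^ j) = z ^ n * (z + of_real \<kappa>) * poly (cpoly Q) (z + inverse z)"
    using reciprocal_poly_exists[OF k, of n b, OF sym] by blast
  have "Q_poly k N f \<epsilon> m \<delta> n = Q"
    unfolding Q_poly_def P \<kappa>
  proof (rule the_equality)
    show "\<forall>z. z \<noteq> 0 \<longrightarrow> (\<Sum>j\<le>2*n+1. of_real (b j) * z ^ j) = z ^ n * (z + of_real \<kappa>) * poly (cpoly Q) (z + inverse z)"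
      using Q(2) by blast
    fix Q' assume "\<forall>z. z \<noteq> 0 \<longrightarrow> (\<Sum>j\<le>2*n+1. of_real (b j) * z ^ j) = z ^ n * (z + of_real \<kappa>) * poly (cpoly Q') (z + inverse z)"
    thus "Q' = Q" using Q(2) by (intro reciprocal_poly_unique[of n \<kappa>]) simp_all
  qed
  thus ?deg "z \<noteq> 0 \<Longrightarrow> (\<Sum>j\<le>2*n+1. of_real (real ((2*n+1) choose j) * lam (real j - real n - 1/2)) * z ^ j)
      = z ^ n * (z + of_real \<kappa>) * poly (cpoly (Q_poly k N f \<epsilon> m \<delta> n)) (z + inverse z)"
    using Q(1) Q(2)[of z] unfolding b_def by blast+
qed

lemma holomorphic_on_affine:
  assumes "F holomorphic_on UNIV"
  shows "(\<lambda>X. F (u * X + w)) holomorphic_on UNIV"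
proof -
  have "(F \<circ> (\<lambda>X. u * X + w)) holomorphic_on UNIV"
    by (rule holomorphic_on_compose[OF _ holomorphic_on_subset[OF assms]])
      (auto intro!: holomorphic_intros)
  thus ?thesis by (simp add: o_def)
qed

lemma higher_deriv_rotated:
  assumes "F holomorphic_on UNIV"
  shows "(deriv ^^ m) (\<lambda>X. c * F (u * X + w)) z = c * u ^ m * (deriv ^^ m) F (u * z + w)"
proof -
  have hol: "(\<lambda>X. F (u * X + w)) holomorphic_on UNIV"
    by (rule holomorphic_on_affine[OF assms])
  have "(deriv ^^ m) (\<lambda>X. F (u * X + w)) z = u ^ m * (deriv ^^ m) F (u * z + w)"
    by (rule higher_deriv_compose_linear'[OF assms, where S = UNIV]) auto
  moreover have "(deriv ^^ m) (\<lambda>X. c * F (u * X + w)) z = c * (deriv ^^ m) (\<lambda>X. F (u * X + w)) z"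
    by (rule higher_deriv_cmult[OF hol]) auto
  ultimately show ?thesis by simp
qed

text \<open>The map X -> k/2 - i \<delta> X takes the real axis to the critical line and i \<omega>
  to the sampling point k/2 + \<delta> \<omega>. On the critical line the completed L-function is
  real for \<epsilon> = 1 and imaginary for \<epsilon> = -1; the constant \<iota> makes the result
  real in both cases.\<close>

lemma strip_entire_completed_L:
  assumes N: "N \<ge> 1" and chi: "dirichlet_char N chi" and nf: "primitive_newform k N chi f"
    and re: "\<And>r. fourier_coeff f r \<in> \<real>" and \<epsilon>: "\<epsilon> = 1 \<or> \<epsilon> = -1"
    and fe: "\<And>s. completed_L N f s = of_real \<epsilon> * completed_L N f (of_nat k - s)"
    and \<delta>: "\<delta> \<ge> 1" and \<iota>: "\<iota> \<noteq> 0" "cnj \<iota> = of_real \<epsilon> * \<iota>"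
  shows "strip_entire \<epsilon> (\<lambda>X. \<iota> * completed_L N f (- (\<i> * of_nat \<delta>) * X + of_nat k / 2))"
    and "completed_L N f holomorphic_on UNIV"
    and "completed_L N f (cnj s) = cnj (completed_L N f s)"
proof -
  interpret cusp_form k N chi f
    by unfold_locales (use N chi nf in \<open>auto simp: primitive_newform_def new_subspace_def\<close>)
  have one: "fourier_coeff f 1 = 1" using nf unfolding primitive_newform_def by blast
  have eig: "\<exists>c. \<forall>z \<in> upper_half_plane. hecke k chi p f z = c * f z" if "prime p" for p
    using nf prime_ge_1_nat[OF that] unfolding primitive_newform_def by blast
  note L = completed_L_eq
  have holo: "Lam holomorphic_on UNIV" by (rule Lam_entire)
  show "completed_L N f holomorphic_on UNIV" unfolding L by (rule holo)
  show cn: "completed_L N f (cnj s) = cnj (completed_L N f s)" for s unfolding L by (rule Lam_cnj[OF re])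
  define u where "u = - (\<i> * of_nat \<delta> :: complex)"
  define w where "w = (of_nat k / 2 :: complex)"
  have u: "cnj u = - u" "cnj w = w" "u \<noteq> 0" using \<delta> by (auto simp: u_def w_def)
  define G where "G = (\<lambda>X. \<iota> * Lam (u * X + w))"
  have fe': "Lam (w + x) = of_real \<epsilon> * Lam (w - x)" for x
    using fe[of "w + x"] unfolding L w_def by (simp add: algebra_simps)
  have par: "G (- z) = of_real \<epsilon> * G z" for z
    using fe'[of "- (u * z)"] by (simp add: G_def algebra_simps)
  have cnG: "G (cnj z) = cnj (G z)" for z
  proof -
    have "cnj (G z) = cnj \<iota> * Lam (w + - (u * cnj z))"
      using Lam_cnj[OF re, of "u * z + w"] u by (simp add: G_def add.commute)
    also have "\<dots> = (of_real \<epsilon> * of_real \<epsilon>) * (\<iota> * Lam (w + u * cnj z))" unfolding fe'[of "- (u * cnj z)"] \<iota>(2) by simp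
    also have "of_real \<epsilon> * of_real \<epsilon> = (1::complex)" using \<epsilon> by auto
    finally show ?thesis by (simp add: G_def add.commute)
  qed
  \<comment> \<open>Im z > 1/2 moves the argument into Re s > k/2 + \<delta>/2, and \<delta> \<ge> 1
    places this inside the half plane of absolute convergence.\<close>
  have nz: "G z \<noteq> 0" if z: "Im z > 1/2" for z
  proof -
    have Re: "Re (u * z + w) = real \<delta> * Im z + real k / 2" by (simp add: u_def w_def)
    have "1 * Im z \<le> real \<delta> * Im z" using \<delta> z by (intro mult_right_mono) auto
    with z have "1 / 2 < real \<delta> * Im z" unfolding mult_1_left by (rule less_le_trans)
    hence "Re (u * z + w) > (real k + 1) / 2" unfolding Re add_divide_distrib by simp
    thus ?thesis using Lam_nonzero[OF one eig] \<iota>(1) by (simp add: G_def)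
  qed
  have strip: "\<bar>Im z\<bar> \<le> 1/2" if z: "G z = 0" for z
  proof (rule ccontr)
    assume "\<not> \<bar>Im z\<bar> \<le> 1/2"
    hence "Im z > 1/2 \<or> Im (- z) > 1/2" by auto
    moreover have "G (- z) = 0" using par z by simp
    ultimately show False using nz z by blast
  qed
  have growth: "subgaussian G"
    unfolding subgaussian_def
  proof (intro allI impI)
    fix e :: real assume e: "e > 0"
    have u0: "norm u > 0" using u by simp
    define e' where "e' = e / (2 * (norm u)\<^sup>2)"
    have e': "e' > 0" using e u0 by (simp add: e'_def)
    obtain D where D: "\<And>s. norm (Lam s) \<le> D * exp (e' * (norm s)\<^sup>2)" using Lam_growth[OF e'] by blast
    have "D * exp (e' * (norm (0::complex))\<^sup>2) \<ge> 0" by (rule order.trans[OF norm_ge_zero D])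
    hence D0: "D \<ge> 0" by simp
    have "norm (G z) \<le> (norm \<iota> * D * exp (e' * (2 * (norm w)\<^sup>2))) * exp (e * (norm z)\<^sup>2)" for z
    proof -
      have "(norm (u * z + w))\<^sup>2 \<le> (norm u * norm z + norm w)\<^sup>2"
        using norm_triangle_ineq[of "u * z" w] by (intro power_mono) (auto simp: norm_mult)
      also have "\<dots> \<le> 2 * (norm u * norm z)\<^sup>2 + 2 * (norm w)\<^sup>2"
        using zero_le_power2[of "norm u * norm z - norm w"] by (simp add: power2_eq_square algebra_simps)
      finally have "e' * (norm (u * z + w))\<^sup>2 \<le> e' * (2 * (norm u * norm z)\<^sup>2 + 2 * (norm w)\<^sup>2)"
        using e' by (intro mult_left_mono) auto
      also have "\<dots> = e * (norm z)\<^sup>2 + e' * (2 * (norm w)\<^sup>2)"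
        using u0 by (simp add: e'_def power_mult_distrib field_simps)
      finally have "exp (e' * (norm (u * z + w))\<^sup>2) \<le> exp (e' * (2 * (norm w)\<^sup>2)) * exp (e * (norm z)\<^sup>2)"
        by (simp add: exp_add[symmetric] add.commute)
      hence "D * exp (e' * (norm (u * z + w))\<^sup>2) \<le> D * (exp (e' * (2 * (norm w)\<^sup>2)) * exp (e * (norm z)\<^sup>2))"
        using D0 by (rule mult_left_mono)
      hence "norm (Lam (u * z + w)) \<le> D * (exp (e' * (2 * (norm w)\<^sup>2)) * exp (e * (norm z)\<^sup>2))"
        using D order.trans by blast
      hence "norm \<iota> * norm (Lam (u * z + w)) \<le> norm \<iota> * (D * (exp (e' * (2 * (norm w)\<^sup>2)) * exp (e * (norm z)\<^sup>2)))"
        by (rule mult_left_mono) simp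
      thus ?thesis by (simp only: G_def norm_mult mult.assoc)
    qed
    thus "\<exists>C. \<forall>z. norm (G z) \<le> C * exp (e * (norm z)\<^sup>2)" by blast
  qed
  have hG: "G holomorphic_on UNIV"
    unfolding G_def
    by (intro holomorphic_on_mult holomorphic_on_const holomorphic_on_affine holo)
  have np: "\<exists>z. (deriv ^^ d) G z \<noteq> 0" for d
  proof -
    obtain s where s: "(deriv ^^ d) Lam s \<noteq> 0" using Lam_not_polynomial[OF one] by blast
    have "u * ((s - w) / u) + w = s" using u(3) by simp
    hence "(deriv ^^ d) G ((s - w) / u) = \<iota> * u ^ d * (deriv ^^ d) Lam s"
      unfolding G_def higher_deriv_rotated[OF holo] by simp
    thus ?thesis using s u(3) \<iota>(1) by (intro exI[of _ "(s - w) / u"]) simp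
  qed
  show "strip_entire \<epsilon> (\<lambda>X. \<iota> * completed_L N f (- (\<i> * of_nat \<delta>) * X + of_nat k / 2))"
    unfolding L u_def[symmetric] w_def[symmetric] G_def[symmetric] strip_entire_def
    using hG \<epsilon> par cnG strip growth np by blast
qed

lemma higher_deriv_real:
  assumes holo: "F holomorphic_on UNIV" and re: "\<And>z. F (cnj z) = cnj (F z)"
  shows "(deriv ^^ m) F (cnj z) = cnj ((deriv ^^ m) F z)"
proof (induction m arbitrary: z)
  case 0
  thus ?case by (simp add: re)
next
  case (Suc m)
  define H where "H = (deriv ^^ m) F"
  have "H holomorphic_on UNIV" unfolding H_def by (intro holomorphic_higher_deriv holo) auto
  hence d: "(H has_field_derivative deriv H z) (at z)" for z by (auto intro!: holomorphic_derivI[of H UNIV])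
  have "((cnj \<circ> H \<circ> cnj) has_field_derivative cnj (deriv H z)) (at (cnj z))"
    using has_field_derivative_cnj_cnj[of H "deriv H z" "cnj z"] d by simp
  moreover have "cnj \<circ> H \<circ> cnj = H" using Suc by (simp add: fun_eq_iff H_def)
  ultimately have "deriv H (cnj z) = cnj (deriv H z)" using DERIV_imp_deriv by metis
  thus ?case by (simp add: H_def)
qed

theorem corollary8p12:
  fixes k N m \<delta> n :: nat and chi :: "int \<Rightarrow> complex" and f :: "complex \<Rightarrow> complex" and \<epsilon> :: real
  assumes "N \<ge> 1"
    and "dirichlet_char N chi"
    and "primitive_newform k N chi f"
    and "\<And>r. fourier_coeff f r \<in> \<real>"
    and "\<epsilon> \<in> {1, -1}"
    and "\<And>s. completed_L N f s = of_real \<epsilon> * completed_L N f (of_nat k - s)"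
    and "\<delta> \<ge> 1" and "n \<ge> 1"
    and "int \<delta> * (2 * int n + 3) \<le> int k - 2"
    and "[int k - int \<delta> * (2 * int n + 3) = 0] (mod 2)"
  shows "degree (Q_poly k N f \<epsilon> m \<delta> n) = n \<and>
         degree (Q_poly k N f \<epsilon> m \<delta> (n + 1)) = n + 1 \<and>
         simple_zeros_in {-2<..<2} (Q_poly k N f \<epsilon> m \<delta> n) \<and>
         simple_zeros_in {-2<..<2} (Q_poly k N f \<epsilon> m \<delta> (n + 1)) \<and>
         strictly_interlace (Q_poly k N f \<epsilon> m \<delta> n) (Q_poly k N f \<epsilon> m \<delta> (n + 1))"
proof -
  have \<epsilon>: "\<epsilon> = 1 \<or> \<epsilon> = -1" using assms(5) by simp
  define \<iota> where "\<iota> = (if \<epsilon> = 1 then 1 else \<i>)"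
  have \<iota>: "\<iota> \<noteq> 0" "cnj \<iota> = of_real \<epsilon> * \<iota>" using \<epsilon> by (auto simp: \<iota>_def)
  note L = strip_entire_completed_L[OF assms(1-4) \<epsilon> assms(6,7) \<iota>]
  define G where "G = (deriv ^^ m) (\<lambda>X. \<iota> * completed_L N f (- (\<i> * of_nat \<delta>) * X + of_nat k / 2))"
  define \<kappa> where "\<kappa> = \<epsilon> * (-1) ^ m"
  \<comment> \<open>The constant \<iota> times the chain rule factor of m differentiations; its
    phase relates \<open>G\<close> on the imaginary axis to the real derivative values.\<close>
  define \<gamma> where "\<gamma> = \<iota> * (- (\<i> * of_nat \<delta>)) ^ m"
  define lam where "lam = (\<lambda>\<omega>. Re ((deriv ^^ m) (completed_L N f) (of_real (real k / 2 + real \<delta> * \<omega>))))"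
  have G: "strip_entire \<kappa> G" unfolding G_def \<kappa>_def by (rule strip_entire_higher_deriv[OF L(1)])
  have k: "\<kappa> = 1 \<or> \<kappa> = -1" using G by (simp add: strip_entire_def)
  have kc: "of_real \<epsilon> * (-1) ^ m = complex_of_real \<kappa>" by (simp add: \<kappa>_def)
  have \<gamma>: "\<gamma> \<noteq> 0" using \<iota>(1) assms(7) by (simp add: \<gamma>_def)
  have c\<gamma>: "cnj \<gamma> = of_real \<kappa> * \<gamma>"
  proof -
    have "cnj \<gamma> = of_real \<epsilon> * \<iota> * (\<i> * of_nat \<delta>) ^ m" by (simp add: \<gamma>_def \<iota>(2))
    also have "(\<i> * of_nat \<delta>) ^ m = (-1) ^ m * (- (\<i> * of_nat \<delta>) :: complex) ^ m"
      unfolding power_mult_distrib[symmetric] by simp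
    finally show ?thesis unfolding \<gamma>_def kc[symmetric] by (simp only: mult_ac)
  qed
  have lam: "(deriv ^^ m) (completed_L N f) (of_real (real k / 2 + real \<delta> * \<omega>)) = of_real (lam \<omega>)" for \<omega>
  proof -
    have "cnj ((deriv ^^ m) (completed_L N f) (of_real (real k / 2 + real \<delta> * \<omega>)))
        = (deriv ^^ m) (completed_L N f) (of_real (real k / 2 + real \<delta> * \<omega>))"
      using higher_deriv_real[OF L(2,3), of m "of_real (real k / 2 + real \<delta> * \<omega>)"] by (simp only: complex_cnj_complex_of_real)
    thus ?thesis unfolding lam_def by (simp add: complex_eq_iff)
  qed
  have Glam: "G (\<i> * of_real \<omega>) = \<gamma> * of_real (lam \<omega>)" for \<omega>
  proof -
    have "- (\<i> * of_nat \<delta>) * (\<i> * of_real \<omega>) + of_nat k / 2 = complex_of_real (real k / 2 + real \<delta> * \<omega>)"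
      by (simp add: complex_eq_iff)
    thus ?thesis unfolding G_def higher_deriv_rotated[OF L(2)] \<gamma>_def by (simp only: lam)
  qed
  have par: "lam (-\<omega>) = \<kappa> * lam \<omega>" for \<omega>
  proof -
    have "\<gamma> * of_real (lam (- \<omega>)) = G (- (\<i> * of_real \<omega>))"
      unfolding Glam[symmetric] by simp
    also have "\<dots> = of_real \<kappa> * G (\<i> * of_real \<omega>)" using G by (simp add: strip_entire_def)
    also have "\<dots> = \<gamma> * of_real (\<kappa> * lam \<omega>)" unfolding Glam of_real_mult by (rule mult.left_commute)
    finally have "\<gamma> * of_real (lam (- \<omega>)) = \<gamma> * of_real (\<kappa> * lam \<omega>)" .
    hence "complex_of_real (lam (- \<omega>)) = of_real (\<kappa> * lam \<omega>)" using mult_left_cancel[OF \<gamma>] by blast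
    thus ?thesis by (simp only: of_real_eq_iff)
  qed
  note Q = Q_poly_eq[where lam = lam, OF k kc par lam]
  have n: "n \<ge> 1" "Suc n \<ge> 1" using assms(8) by auto
  let ?Q = "Q_poly k N f \<epsilon> m \<delta>"
  \<comment> \<open>For \<open>n + 1\<close> the count is made afresh with 2 n + 3 alternations; the
    combinations of \<open>n\<close> and \<open>n + 1\<close> are needed only for
    interlacing.\<close>
  have zeros: "simple_zeros_in {-2<..<2} (?Q l)" "degree (?Q l) = l" if "l \<ge> 1" for l
    by (rule zeros_of_q[where q = ?Q and lam = lam, OF G \<gamma> c\<gamma> Glam Q that], assumption)+
  have "strictly_interlace (?Q n) (?Q (Suc n))"
    by (rule q_strictly_interlace[where q = ?Q and lam = lam, OF G \<gamma> c\<gamma> Glam Q n(1)])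
  thus ?thesis using zeros[OF n(1)] zeros[OF n(2)] by simp
qed

end
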